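(* Let $\theta_0,\ldots,\theta_{m-1}$ ($m\ge 3$) be a unimodular partition of the unit circle $S^1$, let $B:S^1\to S^1$ be the associated map, let $T:S^1\to S^1$ be $T(z)=z^{-(m-1)}$, and let $\zeta=\exp(2\pi i/m)$. Then there exists a homeomorphism $\Phi:S^1\to S^1$ such that $\Phi\circ B=T\circ\Phi$. This homeomorphism is unique up to postcomposition with elements of the dihedral group of maps $z\mapsto \zeta^h z^e$, with $h\in\{0,\ldots,m-1\}$ and $e\in\{-1,1\}$. The map $\Phi$ establishes a bijection between the set of points in $S^1$ of degree $\le 2$ over $\mathbb{Q}(i)$ and $S^1_{\mathrm{tor}}$, the set $S^1\cap\mathbb{Q}(i)$ corresponding to the direct sum of the subgroup $\langle\zeta\rangle$ generated by $\zeta$ and the finitely many $S^1_{p\text{-tor}}$, for $p$ prime with $p\mid m-1$.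
   Context: $S^1=\{z\in\mathbb{C}:|z|=1\}$ is the boundary of the Poincar\'e disk. A pythagorean triple is $\mathbf{t}=(t_1,t_2,t_3)\in\mathbb{Z}^3$ with $t_3>0$, $\gcd(t_1,t_2,t_3)=1$, $t_1^2+t_2^2=t_3^2$; it is identified with the point $\theta=(t_1+t_2i)/t_3\in S^1\cap\mathbb{Q}(i)$. Let $L=\mathrm{diag}(1,1,-1)$ and $\langle \mathbf{x},\mathbf{y}\rangle=\mathbf{x}^\top L\mathbf{y}=x_1y_1+x_2y_2-x_3y_3$. For distinct pythagorean triples $\mathbf{t},\mathbf{t}'$, the closed arc $[\mathbf{t},\mathbf{t}']$ going counterclockwise from $\mathbf{t}$ to $\mathbf{t}'$ is called unimodular if the vector $\mathbf{w}=(L\mathbf{t}'\times L\mathbf{t})/\langle\mathbf{t}',\mathbf{t}\rangle$ (cross product in $\mathbb{R}^3$) lies in $\mathbb{Z}^3$. A unimodular partition of $S^1$ is a counterclockwise cyclically ordered $m$-tuple $\mathbf{t}_0,\ldots,\mathbf{t}_{m-1}$ of pythagorean triples, $m\ge3$, such that each arc $[\mathbf{t}_a,\mathbf{t}_{a+1}]$ is unimodular (indices modulo $m$); $\theta_a$ denotes the point of $S^1$ identified with $\mathbf{t}_a$. Let $I_a=[\theta_a,\theta_{a+1})$ be the half-open counterclockwise arc. Let $\mathscr{A}_a$ be the hyperbolic reflection of the Poincar\'e disk in the geodesic with ideal endpoints $\theta_a,\theta_{a+1}$, extended to $S^1$, where it acts by $\mathscr{A}_a*z=\dfrac{(\theta_a+\theta_{a+1})z-2\theta_a\theta_{a+1}}{2z-(\theta_a+\theta_{a+1})}$.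 The map $B:S^1\to S^1$ is $B(\sigma)=\mathscr{A}_a*\sigma$ for $\sigma\in I_a$ (it is a continuous $(m-1)$-to-$1$ orientation-reversing covering of $S^1$). $S^1_{\mathrm{tor}}$ is the torsion subgroup of the multiplicative group $S^1$ and, for a prime $p$, $S^1_{p\text{-tor}}=\{\sigma\in S^1:\text{the order of }\sigma\text{ is a power of }p\}$. *)

theory Defs
  imports
    "HOL-Analysis.Analysis"
    "HOL-Algebra.Multiplicative_Group"
    "HOL-Algebra.Generated_Groups"
    "HOL-Algebra.Product_Groups"
    "HOL-Computational_Algebra.Computational_Algebra"
begin

abbreviation circle :: "complex set" where
  "circle \<equiv> sphere 0 1"


section \<open>Pythagorean triples and unimodular partitions\<close>

definition pythagorean_triple :: "int^3 \<Rightarrow> bool" where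
  "pythagorean_triple t \<longleftrightarrow>
     t$3 > 0 \<and> Gcd {t$1, t$2, t$3} = 1 \<and> (t$1)\<^sup>2 + (t$2)\<^sup>2 = (t$3)\<^sup>2"

definition circle_point :: "int^3 \<Rightarrow> complex" where
  "circle_point t = (of_int (t$1) + of_int (t$2) * \<i>) / of_int (t$3)"

definition real_vec :: "int^3 \<Rightarrow> real^3" where
  "real_vec t = (\<chi> i. real_of_int (t$i))"

definition lorentz_matrix :: "real^3^3" where
  "lorentz_matrix = (\<chi> i j. if i = j then (if i = 3 then -1 else 1) else 0)"

definition lorentz_form :: "real^3 \<Rightarrow> real^3 \<Rightarrow> real" where
  "lorentz_form x y = x \<bullet> (lorentz_matrix *v y)"

definition unimodular_arc :: "int^3 \<Rightarrow> int^3 \<Rightarrow> bool" where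
  "unimodular_arc t t' \<longleftrightarrow>
     (let w = (1 / lorentz_form (real_vec t') (real_vec t)) *\<^sub>R
                cross3 (lorentz_matrix *v real_vec t') (lorentz_matrix *v real_vec t)
      in \<forall>i. w$i \<in> \<int>)"

text \<open>For \<open>u, z\<close> on the circle, \<^term>\<open>Arg2pi (z / u)\<close> is the counterclockwise angle in
  \<open>[0, 2\<pi>)\<close> from \<open>u\<close> to \<open>z\<close>; distinctness of the points is part of the cyclic order below.\<close>

definition half_open_arc :: "complex \<Rightarrow> complex \<Rightarrow> complex set" where
  "half_open_arc u v = {z \<in> circle. Arg2pi (z / u) < Arg2pi (v / u)}"

definition ccw_ordered :: "nat \<Rightarrow> (nat \<Rightarrow> complex) \<Rightarrow> bool" where
  "ccw_ordered m \<theta> \<longleftrightarrow> strict_mono_on {..<m} (\<lambda>a. Arg2pi (\<theta> a / \<theta> 0))"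

text \<open>Only the values \<open>t 0, \<dots>, t (m - 1)\<close> matter.\<close>

definition unimodular_partition :: "nat \<Rightarrow> (nat \<Rightarrow> int^3) \<Rightarrow> bool" where
  "unimodular_partition m t \<longleftrightarrow>
     m \<ge> 3 \<and> (\<forall>a<m. pythagorean_triple (t a)) \<and>
     ccw_ordered m (\<lambda>a. circle_point (t a)) \<and>
     (\<forall>a<m. unimodular_arc (t a) (t (Suc a mod m)))"


section \<open>The maps \<open>B\<close> and \<open>T\<close>\<close>

text \<open>The hyperbolic reflection in the geodesic with ideal endpoints \<open>u, v\<close> is the map
  \<open>z \<mapsto> ((u + v) w - 2 u v) / (2 w - (u + v))\<close> with \<open>w = 1 / cnj z\<close>; on the circle
  \<open>w = z\<close>. The denominator does not vanish there, since \<open>(u + v) / 2\<close> lies inside the disk.\<close>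

definition circle_reflection :: "complex \<Rightarrow> complex \<Rightarrow> complex \<Rightarrow> complex" where
  "circle_reflection u v z = ((u + v) * z - 2 * u * v) / (2 * z - (u + v))"

definition partition_arc :: "nat \<Rightarrow> (nat \<Rightarrow> int^3) \<Rightarrow> nat \<Rightarrow> complex set" where
  "partition_arc m t a = half_open_arc (circle_point (t a)) (circle_point (t (Suc a mod m)))"

definition partition_map :: "nat \<Rightarrow> (nat \<Rightarrow> int^3) \<Rightarrow> complex \<Rightarrow> complex" where
  "partition_map m t z =
     (let a = (THE a. a < m \<and> z \<in> partition_arc m t a)
      in circle_reflection (circle_point (t a)) (circle_point (t (Suc a mod m))) z)"

definition power_map :: "nat \<Rightarrow> complex \<Rightarrow> complex" where
  "power_map m z = z powi (- (int m - 1))"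

definition circle_conjugacy ::
    "(complex \<Rightarrow> complex) \<Rightarrow> (complex \<Rightarrow> complex) \<Rightarrow> (complex \<Rightarrow> complex) \<Rightarrow> bool" where
  "circle_conjugacy B T \<Phi> \<longleftrightarrow>
     (\<exists>\<Psi>. homeomorphism circle circle \<Phi> \<Psi>) \<and> (\<forall>z\<in>circle. \<Phi> (B z) = T (\<Phi> z))"


section \<open>Degrees over \<open>\<rat>(\<i>)\<close>\<close>

definition gaussian_rationals :: "complex set" where
  "gaussian_rationals = {z. Re z \<in> \<rat> \<and> Im z \<in> \<rat>}"

definition algebraic_over :: "complex set \<Rightarrow> complex \<Rightarrow> bool" where
  "algebraic_over K z \<longleftrightarrow> (\<exists>p. p \<noteq> 0 \<and> (\<forall>i. poly.coeff p i \<in> K) \<and> poly p z = 0)"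

text \<open>The degree of the minimal polynomial; meaningful only for algebraic \<open>z\<close>.\<close>

definition degree_over :: "complex set \<Rightarrow> complex \<Rightarrow> nat" where
  "degree_over K z =
     (LEAST d. \<exists>p. p \<noteq> 0 \<and> (\<forall>i. poly.coeff p i \<in> K) \<and> poly p z = 0 \<and> Polynomial.degree p = d)"

definition degree_le2_points :: "complex set" where
  "degree_le2_points =
     {z \<in> circle. algebraic_over gaussian_rationals z \<and> degree_over gaussian_rationals z \<le> 2}"


section \<open>The circle group\<close>

definition circle_group :: "complex monoid" where
  "circle_group = \<lparr>carrier = circle, monoid.mult = (*), one = 1\<rparr>"

definition circle_tor :: "complex set" where
  "circle_tor = {z \<in> carrier circle_group. \<exists>n>0. z [^]\<^bsub>circle_group\<^esub> (n::nat) = \<one>\<^bsub>circle_group\<^esub>}"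

definition circle_ptor :: "nat \<Rightarrow> complex set" where
  "circle_ptor p = {z \<in> carrier circle_group. \<exists>k. group.ord circle_group z = p ^ k}"

text \<open>\<open>D\<close> is the internal direct sum of the finite family \<open>H\<close> of subgroups of \<open>G\<close>: multiplication
  is an isomorphism from the external direct sum onto \<open>D\<close>.\<close>

definition internal_direct_sum ::
    "'a monoid \<Rightarrow> 'i set \<Rightarrow> ('i \<Rightarrow> 'a set) \<Rightarrow> 'a set \<Rightarrow> bool" where
  "internal_direct_sum G I H D \<longleftrightarrow>
     finite I \<and> (\<forall>i\<in>I. subgroup (H i) G) \<and> subgroup D G \<and>
     (\<lambda>x. finprod G x I) \<in> iso (sum_group I (\<lambda>i. G\<lparr>carrier := H i\<rparr>)) (G\<lparr>carrier := D\<rparr>)"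

text \<open>The summands \<open>\<langle>\<zeta>\<rangle>\<close> (index \<^term>\<open>None\<close>) and \<open>p\<close>-torsion (index \<^term>\<open>Some p\<close>).\<close>

definition torsion_summand :: "complex \<Rightarrow> nat option \<Rightarrow> complex set" where
  "torsion_summand \<zeta> i = (case i of None \<Rightarrow> generate circle_group {\<zeta>} | Some p \<Rightarrow> circle_ptor p)"


section \<open>Well-definedness\<close>

lemma comm_group_circle_group: "comm_group circle_group"
proof (rule comm_groupI)
  fix x assume x: "x \<in> carrier circle_group"
  show "\<exists>y\<in>carrier circle_group. y \<otimes>\<^bsub>circle_group\<^esub> x = \<one>\<^bsub>circle_group\<^esub>"
    by (rule bexI[of _ "inverse x"]) (use x in \<open>auto simp: circle_group_def norm_inverse intro!: left_inverse\<close>)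
qed (auto simp: circle_group_def norm_mult)

lemma circle_point_in_circle:
  assumes "pythagorean_triple t"
  shows "circle_point t \<in> circle"
proof -
  have p: "t$3 > 0" "(t$1)\<^sup>2 + (t$2)\<^sup>2 = (t$3)\<^sup>2"
    using assms by (auto simp: pythagorean_triple_def)
  have "of_int (t$1) + of_int (t$2) * \<i> = Complex (of_int (t$1)) (of_int (t$2))"
    by (simp add: complex_eq_iff)
  hence "cmod (of_int (t$1) + of_int (t$2) * \<i>) = sqrt (of_int ((t$1)\<^sup>2 + (t$2)\<^sup>2))"
    by (simp add: cmod_def)
  also have "\<dots> = of_int (t$3)" using p by simp
  finally show ?thesis using p by (simp add: circle_point_def norm_divide)
qed

lemma partition_arcs_partition:
  assumes U: "unimodular_partition m t" and z: "z \<in> circle"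
  shows "\<exists>!a. a < m \<and> z \<in> partition_arc m t a"
proof -
  define \<theta> where "\<theta> = (\<lambda>a. circle_point (t a))"
  define \<alpha> where "\<alpha> = (\<lambda>a. Arg2pi (\<theta> a / \<theta> 0))"
  define s where "s = Arg2pi (z / \<theta> 0)"
  have m: "m \<ge> 3" and \<theta>: "\<And>a. a < m \<Longrightarrow> \<theta> a \<in> circle"
    and mono: "\<And>a b. a < b \<Longrightarrow> b < m \<Longrightarrow> \<alpha> a < \<alpha> b"
    using U circle_point_in_circle
    by (auto simp: unimodular_partition_def ccw_ordered_def \<alpha>_def \<theta>_def strict_mono_on_def)
  have nz: "\<theta> a \<noteq> 0" if "a < m" for a using \<theta>[OF that] by auto
  have z0: "z \<noteq> 0" using z by auto
  have bounds: "0 \<le> s" "s < 2*pi" "\<And>a. 0 \<le> \<alpha> a" "\<And>a. \<alpha> a < 2*pi"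
    by (auto simp: s_def \<alpha>_def Arg2pi_ge_0 Arg2pi_lt_2pi)
  have \<alpha>0: "\<alpha> 0 = 0" using nz[of 0] m by (simp add: \<alpha>_def Arg2pi_of_real[of 1, simplified])
  have quot: "Arg2pi (y / \<theta> a) = (if \<alpha> a \<le> Arg2pi (y / \<theta> 0) then Arg2pi (y / \<theta> 0) - \<alpha> a
                 else Arg2pi (y / \<theta> 0) - \<alpha> a + 2*pi)" if "a < m" "y \<noteq> 0" for a y
  proof -
    have "y / \<theta> a = (y / \<theta> 0) / (\<theta> a / \<theta> 0)" using nz[of 0] m by simp
    thus ?thesis using Arg2pi_diff[of "y / \<theta> 0" "\<theta> a / \<theta> 0"]
        nz[OF that(1)] nz[of 0] that(2) m
      by (auto simp: \<alpha>_def split: if_splits)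
  qed
  have arc: "z \<in> partition_arc m t a \<longleftrightarrow> Arg2pi (z / \<theta> a) < Arg2pi (\<theta> (Suc a mod m) / \<theta> a)" for a
    using z by (simp add: partition_arc_def half_open_arc_def \<theta>_def)
  have qz: "Arg2pi (z / \<theta> a) = (if \<alpha> a \<le> s then s - \<alpha> a else s - \<alpha> a + 2*pi)" if "a < m" for a
    using quot[OF that z0] by (simp add: s_def)
  have mem: "z \<in> partition_arc m t a \<longleftrightarrow> \<alpha> a \<le> s \<and> (Suc a < m \<longrightarrow> s < \<alpha> (Suc a))" if a: "a < m" for a
  proof (cases "Suc a < m")
    case True
    have "Arg2pi (\<theta> (Suc a) / \<theta> a) = \<alpha> (Suc a) - \<alpha> a"
      using quot[OF a nz[OF True]] mono[of a "Suc a"] True by (simp add: \<alpha>_def)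
    thus ?thesis using True bounds(1) bounds(4)[of "Suc a"] unfolding arc qz[OF a] by auto
  next
    case False
    hence aa: "Suc a = m" "a > 0" using a m by auto
    have "\<alpha> a > 0" using mono[of 0 a] aa a \<alpha>0 by auto
    hence "Arg2pi (\<theta> 0 / \<theta> a) = 2*pi - \<alpha> a"
      using quot[OF a nz[of 0]] \<alpha>0 m by (simp add: \<alpha>_def)
    thus ?thesis using aa bounds(1,2) unfolding arc qz[OF a] by auto
  qed
  define a where "a = Max {a. a < m \<and> \<alpha> a \<le> s}"
  have fin: "finite {a. a < m \<and> \<alpha> a \<le> s}" and ne: "0 \<in> {a. a < m \<and> \<alpha> a \<le> s}"
    using m \<alpha>0 bounds by auto
  have a: "a < m" "\<alpha> a \<le> s" using Max_in[OF fin] ne unfolding a_def by blast+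
  have amax: "b \<le> a" if "b < m" "\<alpha> b \<le> s" for b
    unfolding a_def by (rule Max_ge[OF fin]) (use that in auto)
  show ?thesis
  proof (rule ex1I[of _ a])
    show "a < m \<and> z \<in> partition_arc m t a" using a amax[of "Suc a"] mem[of a] by force
  next
    fix b assume b: "b < m \<and> z \<in> partition_arc m t b"
    hence "\<alpha> b \<le> s" "Suc b < m \<longrightarrow> s < \<alpha> (Suc b)" using mem[of b] by auto
    moreover have "b \<le> a" using amax b calculation by auto
    moreover have "\<not> b < a"
    proof
      assume "b < a"
      hence "\<alpha> (Suc b) \<le> \<alpha> a" using mono[of "Suc b" a] a by (cases "Suc b = a") auto
      thus False using calculation a \<open>b < a\<close> by auto
    qed
    ultimately show "b = a" by auto
  qed
qed

lemma partition_map_on_arc: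
  assumes "unimodular_partition m t" "a < m" "z \<in> partition_arc m t a"
  shows "partition_map m t z =
           circle_reflection (circle_point (t a)) (circle_point (t (Suc a mod m))) z"
proof -
  have "z \<in> circle" using assms(3) by (auto simp: partition_arc_def half_open_arc_def)
  from partition_arcs_partition[OF assms(1) this] assms(2,3)
  have "(THE a. a < m \<and> z \<in> partition_arc m t a) = a" by blast
  thus ?thesis by (simp add: partition_map_def)
qed

end

theory Submission
  imports Defs
begin

text \<open>
  Existence: \<open>B\<close> lifts to a decreasing map \<open>F\<close> of the line with \<open>F (x + 2\<pi>) = F x - 2\<pi> (m - 1)\<close>, and
  \<open>\<phi> = lim (-1/(m - 1))\<^sup>n F\<^sup>n\<close> is monotone, continuous and conjugates \<open>F\<close> to multiplication by
  \<open>-(m - 1)\<close>. It separates the lifts of the vertices; since rational points are dense and all of them are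
  eventually mapped to vertices, it is injective. Uniqueness: a homeomorphism commuting with \<open>T\<close>
  and fixing 1 lifts to \<open>e x + h x\<close> with \<open>h\<close> bounded and \<open>h (-(m - 1) x) = -(m - 1) h x\<close>, so \<open>h = 0\<close>.

  Arithmetic: each \<open>A\<^sub>a\<close> is the reflection of the Lorentzian lattice \<open>\<int>\<^sup>3\<close> in the integral unit vector
  \<open>w\<close> of its arc. The pairing with the sum of the vertex vectors, which lies inside the ideal polygon, is
  decreased by \<open>B\<close>, so a rational point reaches a vertex. A point has degree at most 2 over \<open>\<rat>(\<i>)\<close> iff
  it is annihilated by a nonzero integral vector; moving that vector along the orbit gives
  preperiodicity, as in the theorem of Lagrange on continued fractions. Under \<open>\<Phi>\<close>, preperiodic points of
  \<open>B\<close> become torsion points, and preimages of fixed points become solutions of \<open>w ^ (m (m - 1)\<^sup>n) = 1\<close>.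
\<close>

section \<open>The torsion of the circle group\<close>

text \<open>Each reflection has derivative -1 at the two ends of its arc, so \<open>B\<close> is not
  uniformly expanding, and the limit \<phi> might a priori be constant on an interval. This is why
  strictness is obtained arithmetically: two rational points of such an interval arrive, at a common
  time, at different lifted vertices, and there \<phi> is known exactly, being
  \<open>2 * pi * (k - c) / m\<close> at \<open>angle k\<close>. The descent of rational points thus
  serves the existence of \<Phi> as well as the arithmetic. A dependence in the other direction
  concerns periodic points. Such a point is fixed by a Moebius map with coefficients in the Gaussian
  rationals, but the fixed-point equation could be trivial. The finiteness of the set of periodic
  points of given period, needed to exclude this, is read off from a conjugacy and from the roots of
  unity. In the exponent \<open>m * (m - 1) ^ n\<close> the factor \<open>m\<close> comes from the
  fixed points of \<open>T\<close>, which are the \<open>m\<close>-th roots of unity, and each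
  preimage under \<open>T\<close> contributes a factor \<open>m - 1\<close>. The two numbers are
  coprime, which makes the sum direct.\<close>

interpretation circle: comm_group circle_group
  by (rule comm_group_circle_group)

lemma carrier_circle_group [simp]: "carrier circle_group = circle"
  by (simp add: circle_group_def)

lemma mult_circle_group [simp]: "x \<otimes>\<^bsub>circle_group\<^esub> y = x * y"
  by (simp add: circle_group_def)

lemma one_circle_group [simp]: "\<one>\<^bsub>circle_group\<^esub> = 1"
  by (simp add: circle_group_def)

lemma pow_circle_group [simp]: "x [^]\<^bsub>circle_group\<^esub> (n::nat) = x ^ n"
  by (induction n) (auto simp: mult.commute)

lemma inv_circle_group: "x \<in> circle \<Longrightarrow> inv\<^bsub>circle_group\<^esub> x = inverse x"
  by (rule circle.inv_equality) (auto simp: norm_inverse intro!: left_inverse)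

lemma finprod_circle_group:
  assumes "finite I" "\<And>i. i \<in> I \<Longrightarrow> f i \<in> circle"
  shows "finprod circle_group f I = (\<Prod>i\<in>I. f i)"
  using assms by (induction I) (auto simp: Pi_def)

lemma circle_tor_eq: "circle_tor = {z. \<exists>n>0. z ^ n = 1}"
  by (auto simp: circle_tor_def dest: power_eq_1_iff)

lemma circle_ptor_eq:
  assumes "prime p"
  shows "circle_ptor p = {z. \<exists>k. z ^ (p ^ k) = 1}"
proof -
  have "z \<in> circle_ptor p \<longleftrightarrow> (\<exists>k. z ^ (p ^ k) = 1)" for z
  proof
    assume "z \<in> circle_ptor p"
    then obtain k where "z \<in> circle" "circle.ord z = p ^ k"
      by (auto simp: circle_ptor_def)
    then show "\<exists>k. z ^ (p ^ k) = 1"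
      using circle.pow_eq_id[of z "p ^ k"] by auto
  next
    assume "\<exists>k. z ^ (p ^ k) = 1"
    then obtain k where k: "z ^ (p ^ k) = 1" by blast
    have z: "z \<in> circle"
      using k assms power_eq_1_iff[OF k] by (auto simp: prime_gt_0_nat)
    then have "circle.ord z dvd p ^ k"
      using circle.pow_eq_id[of z "p ^ k"] k by auto
    then obtain j where "circle.ord z = p ^ j"
      using divides_primepow_nat[OF assms] by blast
    with z show "z \<in> circle_ptor p" by (auto simp: circle_ptor_def)
  qed
  then show ?thesis by auto
qed

lemma roots_of_unity_generated:
  assumes "m > 0" and \<zeta>: "\<zeta> = exp (2 * of_real pi * \<i> / of_nat m)"
  shows "{z::complex. z ^ m = 1} = (\<lambda>h. \<zeta> ^ h) ` {..<m}"
proof -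
  have "\<zeta> ^ h = cis (2 * pi * real h / real m)" for h
    by (simp add: \<zeta> cis_conv_exp flip: exp_of_nat_mult) (simp add: mult_ac)
  then show ?thesis
    using bij_betw_imp_surj_on[OF Complex.bij_betw_roots_unity[OF assms(1)]] by simp
qed

lemma generate_root_of_unity:
  assumes "m > 0" and \<zeta>: "\<zeta> = exp (2 * of_real pi * \<i> / of_nat m)"
  shows "generate circle_group {\<zeta>} = {z. z ^ m = 1}"
proof
  have \<zeta>m: "\<zeta> ^ m = 1"
    using roots_of_unity_generated[OF assms] assms(1)
    by (metis (mono_tags, lifting) \<zeta> exp_divide_power_eq exp_two_pi_i' mult.commute mult.left_commute)
  have "\<zeta> \<in> circle" using power_eq_1_iff[OF \<zeta>m] assms(1) by auto
  then have *: "generate circle_group {\<zeta>} = {\<zeta> [^]\<^bsub>circle_group\<^esub> (k::int) | k. k \<in> UNIV}"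
    using circle.generate_pow by simp
  have sub: "subgroup (generate circle_group {\<zeta>}) circle_group"
    using \<open>\<zeta> \<in> circle\<close> by (intro circle.generate_is_subgroup) auto
  have pow: "\<zeta> ^ h \<in> generate circle_group {\<zeta>}" for h
    unfolding * using int_pow_int[of circle_group \<zeta> h] by (auto intro!: exI[of _ "int h"])
  then show "{z. z ^ m = 1} \<subseteq> generate circle_group {\<zeta>}"
    using roots_of_unity_generated[OF assms] by auto
  show "generate circle_group {\<zeta>} \<subseteq> {z. z ^ m = 1}"
  proof
    fix z assume "z \<in> generate circle_group {\<zeta>}"
    then show "z \<in> {z. z ^ m = 1}"
    proof induction
      case (inv h)
      then show ?case using \<zeta>m \<open>\<zeta> \<in> circle\<close> by (auto simp: inv_circle_group power_inverse)
    qed (auto simp: \<zeta>m power_mult_distrib)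
  qed
qed

lemma subgroup_circle_groupI:
  assumes "H \<subseteq> circle" "1 \<in> H" "\<And>x y. x \<in> H \<Longrightarrow> y \<in> H \<Longrightarrow> x * y \<in> H"
    "\<And>x. x \<in> H \<Longrightarrow> inverse x \<in> H"
  shows "subgroup H circle_group"
  using assms by (intro subgroup.intro) (auto simp: inv_circle_group subset_eq)

text \<open>The divisibility chain makes the set an increasing union of groups of roots of unity, so
  two elements always lie in a common one.\<close>

lemma subgroup_directed_torsion:
  assumes "\<And>n. N n > (0::nat)" "\<And>i j. i \<le> j \<Longrightarrow> N i dvd N j"
  shows "subgroup {z. \<exists>n::nat. z ^ N n = 1} circle_group"
proof (rule subgroup_circle_groupI)
  show "{z. \<exists>n. z ^ N n = 1} \<subseteq> circle"
    using assms(1) by (auto dest!: power_eq_1_iff simp: gr0_conv_Suc) (metis assms(1) less_numeral_extra(3))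
  fix x y :: complex assume "x \<in> {z. \<exists>n. z ^ N n = 1}" "y \<in> {z. \<exists>n. z ^ N n = 1}"
  then obtain i j where ij: "x ^ N i = 1" "y ^ N j = 1" by auto
  have "x ^ N (max i j) = 1" "y ^ N (max i j) = 1"
    using assms(2)[of i "max i j"] assms(2)[of j "max i j"] ij
    by (metis dvd_def max.cobounded1 power_mult power_one, metis dvd_def max.cobounded2 power_mult power_one)
  then show "x * y \<in> {z. \<exists>n. z ^ N n = 1}"
    by (auto simp: power_mult_distrib intro!: exI[of _ "max i j"])
qed (auto simp: power_inverse)

section \<open>Roots of unity of coprime orders\<close>

lemma coprime_root_eq_1:
  fixes z :: complex
  assumes "z ^ a = 1" "z ^ b = 1" "coprime a b"
  shows "z = 1"
proof (cases "a = 0")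
  case True
  then show ?thesis using assms by auto
next
  case False
  then obtain x y where "a * x = b * y + 1"
    using bezout_nat[of a b] assms(3) by auto
  then have "z ^ (a * x) = z ^ (b * y) * z" by (simp add: power_add)
  then show ?thesis using assms by (simp add: power_mult)
qed

lemma coprime_root_split:
  fixes z :: complex
  assumes "z ^ (a * b) = 1" "coprime a b"
  obtains x y where "x ^ a = 1" "y ^ b = 1" "z = x * y"
proof (cases "a = 0 \<or> b = 0 \<or> z = 0")
  case True
  then show ?thesis
  proof (elim disjE)
    assume "a = 0"
    then show ?thesis using assms that[of z 1] by auto
  next
    assume "b = 0"
    then show ?thesis using assms that[of 1 z] by auto
  next
    assume "z = 0"
    then show ?thesis using assms that[of 1 0] that[of 0 1] by (auto simp: power_0_left split: if_splits)
  qed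
next
  case False
  then obtain x y where xy: "a * x = b * y + 1"
    using bezout_nat[of a b] assms(2) by auto
  have *: "z ^ (a * x) = z ^ (b * y) * z" using xy by (simp add: power_add)
  \<comment> \<open>By Bezout \<open>z\<close> is \<open>z ^ (a * x)\<close> divided by
    \<open>z ^ (b * y)\<close>. Since \<open>z ^ (a * b) = 1\<close>, the former is killed by
    \<open>b\<close> and the latter by \<open>a\<close>.\<close>
  show ?thesis
  proof (rule that[of "inverse (z ^ (b * y))" "z ^ (a * x)"])
    show "inverse (z ^ (b * y)) ^ a = 1"
      by (metis assms(1) inverse_1 mult.commute mult.left_commute power_inverse power_mult power_one)
    show "(z ^ (a * x)) ^ b = 1"
      by (metis assms(1) mult.commute mult.left_commute power_mult power_one)
    show "z = inverse (z ^ (b * y)) * z ^ (a * x)"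
      using False unfolding * by simp
  qed
qed

lemma coprime_roots_split:
  fixes z :: complex
  assumes "finite I" "\<And>i j. i \<in> I \<Longrightarrow> j \<in> I \<Longrightarrow> i \<noteq> j \<Longrightarrow> coprime (N i) (N j)"
    "z ^ (\<Prod>i\<in>I. N i) = 1"
  shows "\<exists>x. (\<forall>i\<in>I. x i ^ N i = 1) \<and> z = (\<Prod>i\<in>I. x i)"
  using assms
proof (induction I arbitrary: z)
  case (insert i I)
  have "coprime (N i) (\<Prod>j\<in>I. N j)"
    using insert by (intro prod_coprime_right) auto
  moreover have "z ^ (N i * (\<Prod>j\<in>I. N j)) = 1"
    using insert by simp
  ultimately obtain x y where xy: "x ^ N i = 1" "y ^ (\<Prod>j\<in>I. N j) = 1" "z = x * y"
    using coprime_root_split by blast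
  then obtain f where f: "\<forall>j\<in>I. f j ^ N j = 1" "y = (\<Prod>j\<in>I. f j)"
    using insert.IH[of y] insert.prems by auto
  have "(\<Prod>j\<in>I. (f(i := x)) j) = (\<Prod>j\<in>I. f j)"
    using insert by (intro prod.cong) auto
  then show ?case
    using insert xy f by (intro exI[of _ "f(i := x)"]) auto
qed auto

lemma coprime_roots_prod_eq_1:
  fixes x :: "'i \<Rightarrow> complex"
  assumes "finite I" "\<And>i j. i \<in> I \<Longrightarrow> j \<in> I \<Longrightarrow> i \<noteq> j \<Longrightarrow> coprime (N i) (N j)"
    "\<And>i. i \<in> I \<Longrightarrow> x i ^ N i = 1" "(\<Prod>i\<in>I. x i) = 1" "i \<in> I"
  shows "x i = 1"
proof -
  define M where "M = (\<Prod>j\<in>I-{i}. N j)"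
  have "(\<Prod>j\<in>I-{i}. x j) ^ M = (\<Prod>j\<in>I-{i}. x j ^ M)"
    by (simp add: prod_power_distrib)
  also have "\<dots> = 1"
  proof (rule prod.neutral, rule ballI)
    fix j assume j: "j \<in> I - {i}"
    then have "N j dvd M" unfolding M_def using assms(1) by (intro dvd_prodI) auto
    then show "x j ^ M = 1" using assms(3)[of j] j by (auto simp: dvd_def power_mult)
  qed
  finally have "(\<Prod>j\<in>I-{i}. x j) ^ M = 1" .
  moreover have "x i * (\<Prod>j\<in>I-{i}. x j) = 1"
    using assms prod.remove[of I i x] by simp
  ultimately have "x i ^ M = 1"
    by (metis mult.right_neutral power_mult_distrib power_one)
  moreover have "coprime (N i) M"
    unfolding M_def using assms by (intro prod_coprime_right) auto
  ultimately show ?thesis using coprime_root_eq_1 assms(3,5) by blast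
qed

text \<open>Existence of the decomposition is Bezout, uniqueness is coprimality of the orders.\<close>

lemma internal_direct_sum_coprime_torsion:
  fixes N :: "'i \<Rightarrow> nat \<Rightarrow> nat"
  assumes I: "finite I"
    and pos: "\<And>i n. i \<in> I \<Longrightarrow> N i n > 0"
    and mono: "\<And>i j k. i \<in> I \<Longrightarrow> j \<le> k \<Longrightarrow> N i j dvd N i k"
    and cop: "\<And>i j k. i \<in> I \<Longrightarrow> j \<in> I \<Longrightarrow> i \<noteq> j \<Longrightarrow> coprime (N i k) (N j k)"
    and H: "\<And>i. i \<in> I \<Longrightarrow> H i = {z. \<exists>n. z ^ N i n = 1}"
  shows "internal_direct_sum circle_group I H {z. \<exists>n. z ^ (\<Prod>i\<in>I. N i n) = 1}"
proof -
  let ?D = "{z::complex. \<exists>n. z ^ (\<Prod>i\<in>I. N i n) = 1}"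
  let ?G = "\<lambda>i. circle_group\<lparr>carrier := H i\<rparr>"
  have subH: "subgroup (H i) circle_group" if "i \<in> I" for i
    unfolding H[OF that] using pos[OF that] mono[OF that] by (rule subgroup_directed_torsion)
  have subD: "subgroup ?D circle_group"
    by (rule subgroup_directed_torsion) (auto simp: pos mono prod_pos intro!: prod_dvd_prod)
  have grp: "group (?G i)" if "i \<in> I" for i
    using subgroup.subgroup_is_group[OF subH[OF that]] circle.is_group by blast
  have Hc: "H i \<subseteq> circle" if "i \<in> I" for i
    using subgroup.subset[OF subH[OF that]] by simp
  have car: "carrier (sum_group I ?G) = (\<Pi>\<^sub>E i\<in>I. H i)"
    using I by (subst carrier_sum_group[OF grp]) auto
  have fp: "finprod circle_group x I = (\<Prod>i\<in>I. x i)" if "x \<in> (\<Pi>\<^sub>E i\<in>I. H i)" for x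
    using that Hc by (intro finprod_circle_group[OF I]) (meson PiE_mem subsetD)
  \<comment> \<open>The index set is finite, so the largest of the individual levels works for the
    whole family.\<close>
  have level: "\<exists>n. \<forall>i\<in>I. x i ^ N i n = 1" if "x \<in> (\<Pi>\<^sub>E i\<in>I. H i)" for x
  proof -
    have "\<forall>i\<in>I. \<exists>n. x i ^ N i n = 1" using that H by (auto simp: PiE_iff)
    then obtain n where n: "\<And>i. i \<in> I \<Longrightarrow> x i ^ N i (n i) = 1" by metis
    have "x i ^ N i (Max (n ` I)) = 1" if "i \<in> I" for i
    proof -
      have "N i (n i) dvd N i (Max (n ` I))"
        using that I by (intro mono) auto
      then show ?thesis using n[OF that] by (auto simp: dvd_def power_mult)
    qed
    then show ?thesis by blast
  qed
  have inj: "inj_on (\<lambda>x. finprod circle_group x I) (carrier (sum_group I ?G))"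
  proof (rule inj_onI)
    fix x y assume xy: "x \<in> carrier (sum_group I ?G)" "y \<in> carrier (sum_group I ?G)"
      "finprod circle_group x I = finprod circle_group y I"
    \<comment> \<open>The componentwise quotient lies in the same product of subgroups and
      multiplies to 1, so coprimality of the exponents makes every component 1.\<close>
    define q where "q = (\<lambda>i\<in>I. x i * inverse (y i))"
    have y0: "y i \<noteq> 0" if "i \<in> I" for i using xy(2) Hc[OF that] that unfolding car PiE_iff by force
    have q: "q \<in> (\<Pi>\<^sub>E i\<in>I. H i)"
    proof -
      have "x i * inverse (y i) \<in> H i" if "i \<in> I" for i
      proof -
        have "x i \<in> H i" "y i \<in> H i" using xy that unfolding car by auto
        then show ?thesis
          using subgroup.m_closed[OF subH[OF that]] subgroup.m_inv_closed[OF subH[OF that]]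
            Hc[OF that] inv_circle_group by (metis mult_circle_group subsetD)
      qed
      then show ?thesis by (auto simp: q_def)
    qed
    have "(\<Prod>i\<in>I. q i) = (\<Prod>i\<in>I. x i) * inverse (\<Prod>i\<in>I. y i)"
      by (simp add: q_def prod.distrib prod_inversef[symmetric] o_def)
    also have "\<dots> = 1"
      using xy y0 fp I unfolding car by (simp add: right_inverse)
    finally have q1: "(\<Prod>i\<in>I. q i) = 1" .
    obtain n where n: "\<forall>i\<in>I. q i ^ N i n = 1" using level[OF q] by blast
    have "q i = 1" if "i \<in> I" for i
      using coprime_roots_prod_eq_1[OF I, of "\<lambda>i. N i n" q i] cop n q1 that by blast
    then have "x i = y i" if "i \<in> I" for i
      using that y0[OF that] by (force simp: q_def field_simps)
    then show "x = y"
      using xy(1,2) unfolding car by (auto intro: PiE_ext)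
  qed
  have surj: "(\<lambda>x. finprod circle_group x I) ` carrier (sum_group I ?G) = ?D"
  proof (intro equalityI subsetI)
    fix z assume "z \<in> (\<lambda>x. finprod circle_group x I) ` carrier (sum_group I ?G)"
    then obtain x where x: "x \<in> (\<Pi>\<^sub>E i\<in>I. H i)" "z = (\<Prod>i\<in>I. x i)" unfolding car using fp by auto
    obtain n where n: "\<forall>i\<in>I. x i ^ N i n = 1" using level[OF x(1)] by blast
    have "z ^ (\<Prod>i\<in>I. N i n) = (\<Prod>i\<in>I. x i ^ (\<Prod>i\<in>I. N i n))"
      by (simp add: x prod_power_distrib)
    also have "\<dots> = 1"
    proof (rule prod.neutral, rule ballI)
      fix i assume i: "i \<in> I"
      then have "N i n dvd (\<Prod>i\<in>I. N i n)" using I by (intro dvd_prodI) auto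
      then show "x i ^ (\<Prod>i\<in>I. N i n) = 1" using n i by (auto simp: dvd_def power_mult)
    qed
    finally show "z \<in> ?D" by blast
  next
    fix z assume "z \<in> ?D"
    then obtain n where "z ^ (\<Prod>i\<in>I. N i n) = 1" by blast
    then obtain x where x: "\<forall>i\<in>I. x i ^ N i n = 1" "z = (\<Prod>i\<in>I. x i)"
      using coprime_roots_split[OF I, of "\<lambda>i. N i n" z] cop by blast
    have "restrict x I \<in> (\<Pi>\<^sub>E i\<in>I. H i)" using x H by auto
    moreover have "z = (\<Prod>i\<in>I. restrict x I i)" using x by simp
    ultimately show "z \<in> (\<lambda>x. finprod circle_group x I) ` carrier (sum_group I ?G)"
      unfolding car using fp by (metis (no_types, lifting) image_eqI)
  qed
  have hom: "(\<lambda>x. finprod circle_group x I) \<in> hom (sum_group I ?G) (circle_group\<lparr>carrier := ?D\<rparr>)"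
  proof (rule homI)
    fix x assume "x \<in> carrier (sum_group I ?G)"
    then show "finprod circle_group x I \<in> carrier (circle_group\<lparr>carrier := ?D\<rparr>)"
      using surj by auto
  next
    fix x y assume xy: "x \<in> carrier (sum_group I ?G)" "y \<in> carrier (sum_group I ?G)"
    then have "(\<lambda>i\<in>I. x i * y i) \<in> (\<Pi>\<^sub>E i\<in>I. H i)"
      unfolding car using subgroup.m_closed[OF subH] by (auto simp: PiE_iff)
    then show "finprod circle_group (x \<otimes>\<^bsub>sum_group I ?G\<^esub> y) I =
        finprod circle_group x I \<otimes>\<^bsub>circle_group\<lparr>carrier := ?D\<rparr>\<^esub> finprod circle_group y I"
      using xy fp unfolding car by (simp add: prod.distrib)
  qed
  show ?thesis
    unfolding internal_direct_sum_def iso_def bij_betw_def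
    using I subH subD hom inj surj by auto
qed

lemma internal_direct_sum_torsion_summand:
  assumes m: "m \<ge> 3" and \<zeta>: "\<zeta> = exp (2 * of_real pi * \<i> / of_nat m)"
  shows "internal_direct_sum circle_group (insert None (Some ` {p. prime p \<and> p dvd m - 1}))
    (torsion_summand \<zeta>) {z. \<exists>n. z ^ (m * (m - 1) ^ n) = 1}"
proof -
  define P where "P = {p. prime p \<and> p dvd m - 1}"
  \<comment> \<open>At level \<open>n\<close> the index \<open>Some p\<close> gets the whole
    \<open>p\<close>-part of \<open>(m - 1) ^ n\<close>, while \<open>None\<close> stays at
    \<open>m\<close>; the product over all indices is then exactly
    \<open>m * (m - 1) ^ n\<close>.\<close>
  define N where "N = (\<lambda>i n. case i of None \<Rightarrow> m | Some p \<Rightarrow> p ^ (multiplicity p (m - 1) * n))"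
  have P: "P = prime_factors (m - 1)"
    using m by (auto simp: P_def prime_factors_dvd)
  have prod: "(\<Prod>i\<in>insert None (Some ` P). N i n) = m * (m - 1) ^ n" for n
  proof -
    have "(\<Prod>i\<in>insert None (Some ` P). N i n) = m * (\<Prod>p\<in>P. (p ^ multiplicity p (m - 1)) ^ n)"
      by (simp add: P N_def prod.reindex power_mult)
    also have "\<dots> = m * (m - 1) ^ n"
      using m prod_prime_factors[of "m - 1"] by (simp add: P flip: prod_power_distrib)
    finally show ?thesis .
  qed
  have "internal_direct_sum circle_group (insert None (Some ` P)) (torsion_summand \<zeta>)
    {z. \<exists>n. z ^ (\<Prod>i\<in>insert None (Some ` P). N i n) = 1}"
  proof (rule internal_direct_sum_coprime_torsion)
    show "finite (insert None (Some ` P))" by (simp add: P)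
  next
    fix i n assume "i \<in> insert None (Some ` P)"
    then show "N i n > 0" using m by (auto simp: N_def P_def prime_gt_0_nat)
  next
    fix i and j k :: nat assume "j \<le> k"
    then show "N i j dvd N i k"
      by (auto simp: N_def split: option.splits intro!: le_imp_power_dvd)
  next
    fix i j k assume ij: "i \<in> insert None (Some ` P)" "j \<in> insert None (Some ` P)" "i \<noteq> j"
    have 1: "coprime m p" if "p \<in> P" for p
    proof -
      have "coprime (m - 1) m" using m by (metis One_nat_def Suc_pred coprime_Suc_right_nat coprime_commute le_numeral_extra(4) less_le_trans zero_less_numeral)
      then show ?thesis using that by (metis (no_types, lifting) P_def coprime_commute coprime_divisors dvd_refl mem_Collect_eq)
    qed
    have 2: "p = q" if "p \<in> P" "q \<in> P" "\<not> coprime p q" for p q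
      using that primes_coprime[of p q] by (auto simp: P_def)
    show "coprime (N i k) (N j k)"
      using ij 1 by (auto simp: N_def coprime_commute dest: 2)
  next
    fix i assume i: "i \<in> insert None (Some ` P)"
    show "torsion_summand \<zeta> i = {z. \<exists>n. z ^ N i n = 1}"
    proof (cases i)
      case None
      then show ?thesis using m generate_root_of_unity[OF _ \<zeta>]
        by (simp add: torsion_summand_def N_def)
    next
      case (Some p)
      then have p: "prime p" "p dvd m - 1" using i by (auto simp: P_def)
      let ?e = "multiplicity p (m - 1)"
      have e: "?e > 0" using p m by (simp add: prime_multiplicity_gt_zero_iff)
      have "(\<exists>n. z ^ (p ^ (?e * n)) = 1) \<longleftrightarrow> (\<exists>k. z ^ (p ^ k) = 1)" for z :: complex
      proof
        assume "\<exists>k. z ^ (p ^ k) = 1"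
        then obtain k where "z ^ (p ^ k) = 1" by blast
        moreover have "p ^ k dvd p ^ (?e * k)" using e by (intro le_imp_power_dvd) auto
        ultimately show "\<exists>n. z ^ (p ^ (?e * n)) = 1" by (metis dvd_def power_mult power_one)
      qed blast
      then show ?thesis using Some circle_ptor_eq[OF p(1)]
        by (simp add: torsion_summand_def N_def)
    qed
  qed
  then show ?thesis unfolding prod by (simp add: P_def)
qed

section \<open>Lifting circle maps to the line\<close>

lemma circle_cis: "z \<in> circle \<Longrightarrow> \<exists>x. z = cis x"
  by (rule exI[of _ "Arg z"]) (use rcis_cmod_Arg[of z] in \<open>simp add: rcis_def\<close>)

lemma cis_in_circle [simp]: "cis x \<in> circle"
  by simp

lemma cis_eq_iff_int: "cis x = cis y \<longleftrightarrow> (\<exists>n::int. x = y + 2 * pi * n)"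
  using sin_cos_eq_iff[of x y] by (auto simp: complex_eq_iff)

text \<open>The line is contractible, so a zero-free continuous function on it has a continuous
  logarithm, whose real part vanishes because the values have modulus 1.\<close>

lemma circle_lift:
  fixes f :: "real \<Rightarrow> complex"
  assumes "continuous_on UNIV f" "\<And>x. f x \<in> circle"
  obtains F where "continuous_on UNIV F" "\<And>x. cis (F x) = f x"
proof -
  have "f x \<noteq> 0" for x using assms(2)[of x] by auto
  then obtain g where g: "continuous_on UNIV g" "\<And>x. f x = exp (g x)"
    using continuous_logarithm_on_contractible[of UNIV f] assms(1)
    by (auto simp: convex_imp_contractible)
  have "Re (g x) = 0" for x
    using assms(2)[of x] g(2)[of x] by simp
  then have "cis (Im (g x)) = f x" for x
    by (simp add: g(2) exp_eq_polar[of "g x"])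
  moreover have "continuous_on UNIV (\<lambda>x. Im (g x))" by (intro continuous_intros g)
  ultimately show ?thesis using that by blast
qed

lemma continuous_int_valued_const:
  fixes h :: "real \<Rightarrow> real"
  assumes "connected S" "continuous_on S h" "\<And>x. x \<in> S \<Longrightarrow> \<exists>n::int. h x = c * n" "a \<in> S" "b \<in> S"
  shows "h a = h b"
proof (cases "c = 0")
  case True
  then show ?thesis using assms(3)[OF assms(4)] assms(3)[OF assms(5)] by auto
next
  case False
  have "(\<lambda>x. h x / c) constant_on S"
  proof (rule continuous_discrete_range_constant[OF assms(1)])
    show "continuous_on S (\<lambda>x. h x / c)" using False by (intro continuous_intros assms(2)) auto
    fix x assume "x \<in> S"
    show "\<exists>e>0. \<forall>y. y \<in> S \<and> h y / c \<noteq> h x / c \<longrightarrow> e \<le> norm (h y / c - h x / c)"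
    proof (intro exI[of _ 1] conjI allI impI)
      fix y assume y: "y \<in> S \<and> h y / c \<noteq> h x / c"
      obtain n k :: int where nk: "h x = c * n" "h y = c * k" using assms(3) y \<open>x \<in> S\<close> by meson
      then have "k \<noteq> n" using y by auto
      then have "\<bar>k - n\<bar> \<ge> 1" by linarith
      then have "\<bar>real_of_int k - real_of_int n\<bar> \<ge> 1" by linarith
      then show "1 \<le> norm (h y / c - h x / c)" using nk False by simp
    qed simp
  qed
  then show ?thesis using assms(4,5) False unfolding constant_on_def by (metis divide_cancel_right)
qed

text \<open>The difference of two lifts is continuous with values in the multiples of
  \<open>2 * pi\<close>. Functional equations on the circle are transferred to lifts in this way, up
  to a constant that is settled at one base point.\<close>

lemma lifts_differ_by_const:
  fixes F G :: "real \<Rightarrow> real"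
  assumes "connected S" "continuous_on S F" "continuous_on S G"
    "\<And>x. x \<in> S \<Longrightarrow> cis (F x) = cis (G x)" "a \<in> S" "b \<in> S"
  shows "F b - F a = G b - G a"
proof -
  have "F a - G a = F b - G b"
  proof (rule continuous_int_valued_const[of S "\<lambda>x. F x - G x" "2 * pi"])
    fix x assume "x \<in> S"
    then show "\<exists>n::int. F x - G x = 2 * pi * n"
      using assms(4)[of x] unfolding cis_eq_iff_int by auto
  qed (use assms in \<open>auto intro!: continuous_intros\<close>)
  then show ?thesis by simp
qed

lemma quasiperiodic_int_shift:
  fixes h :: "real \<Rightarrow> real"
  assumes "\<And>x. h (x + c) = h x + e"
  shows "h (x + c * of_int n) = h x + e * of_int n"
proof -
  have nat: "h (x + c * real n) = h x + e * real n" for x and n :: nat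
  proof (induction n)
    case (Suc n)
    then show ?case using assms[of "x + c * real n"] by (simp add: algebra_simps)
  qed simp
  show ?thesis
  proof (cases "n \<ge> 0")
    case True
    then show ?thesis using nat[of x "nat n"] by simp
  next
    case False
    then show ?thesis using nat[of "x + c * of_int n" "nat (- n)"] by (simp add: algebra_simps)
  qed
qed

lemma periodic_bounded:
  fixes h :: "real \<Rightarrow> real"
  assumes "continuous_on UNIV h" "\<And>x. h (x + 2 * pi) = h x"
  obtains M where "M \<ge> 0" "\<And>x. \<bar>h x\<bar> \<le> M"
proof -
  have "compact (h ` {0..2*pi})"
    using assms(1) by (intro compact_continuous_image) (auto intro: continuous_on_subset)
  then obtain M where M: "\<And>y. y \<in> h ` {0..2*pi} \<Longrightarrow> \<bar>y\<bar> \<le> M"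
    by (metis compact_imp_bounded bounded_iff real_norm_def)
  have per: "h (x + 2 * pi * of_int n) = h x" for x and n :: int
    using quasiperiodic_int_shift[of h "2 * pi" 0 x n] assms(2) by simp
  have "\<bar>h x\<bar> \<le> M" for x
  proof -
    define n where "n = \<lfloor>x / (2 * pi)\<rfloor>"
    have "of_int n \<le> x / (2 * pi)" "x / (2 * pi) < of_int n + 1" unfolding n_def by linarith+
    then have "x - 2 * pi * of_int n \<in> {0..2*pi}" by (auto simp: field_simps)
    then have "\<bar>h (x - 2 * pi * of_int n)\<bar> \<le> M" using M by blast
    then show ?thesis using per[of "x - 2 * pi * of_int n" n] by simp
  qed
  moreover have "M \<ge> 0" using calculation[of 0] by linarith
  ultimately show ?thesis using that by blast
qed

section \<open>Homeomorphisms commuting with a power map\<close>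

lemma commuting_with_power_map_fixing_1:
  fixes g :: "complex \<Rightarrow> complex"
  assumes cont: "continuous_on circle g" and into: "g \<in> circle \<rightarrow> circle" and inj: "inj_on g circle"
    and d: "d \<ge> 2" and g1: "g 1 = 1"
    and comm: "\<And>z. z \<in> circle \<Longrightarrow> g (z powi - int d) = g z powi - int d"
  shows "\<exists>e\<in>{-1,1::int}. \<forall>z\<in>circle. g z = z powi e"
proof -
  have "continuous_on UNIV (\<lambda>x. g (cis x))"
    by (rule continuous_on_compose2[OF cont]) (auto intro!: continuous_intros)
  then obtain G0 where G0: "continuous_on UNIV G0" "\<And>x. cis (G0 x) = g (cis x)"
    using circle_lift into by (metis cis_in_circle Pi_mem)
  define G where "G = (\<lambda>x. G0 x - G0 0)"
  have G: "continuous_on UNIV G" "\<And>x. cis (G x) = g (cis x)" "G 0 = 0"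
    using G0 g1 by (auto simp: G_def intro!: continuous_intros simp flip: cis_divide)
  have Gd: "G (- (real d * x)) = - real d * G x" for x
  proof -
    have "- (real d * G x) - - (real d * G 0) = G (- (real d * x)) - G (- (real d * 0))"
    proof (rule lifts_differ_by_const[of UNIV])
      show "continuous_on UNIV (\<lambda>x. G (- (real d * x)))"
        by (rule continuous_on_compose2[OF G(1)]) (auto intro!: continuous_intros)
      fix x
      have "cis (- (real d * y)) = cis y powi - int d" for y
        by (simp add: cis_power_int)
      then show "cis (- (real d * G x)) = cis (G (- (real d * x)))"
        using comm[of "cis x"] by (simp add: G)
    qed (auto intro!: continuous_intros G(1))
    then show ?thesis by (simp add: G(3))
  qed
  obtain e :: int where e0: "G (2 * pi) = 2 * pi * e"
    using G(2)[of "2 * pi"] g1 cis_eq_iff_int[of "G (2*pi)" 0] by auto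
  have e: "G (x + 2 * pi) = G x + 2 * pi * e" for x
  proof -
    have "G (x + 2 * pi) - G (0 + 2 * pi) = G x - G 0"
    proof (rule lifts_differ_by_const[of UNIV])
      show "continuous_on UNIV (\<lambda>x. G (x + 2 * pi))"
        by (rule continuous_on_compose2[OF G(1)]) (auto intro!: continuous_intros)
    qed (auto simp: G cis_mult[symmetric])
    then show ?thesis by (simp add: G(3) e0)
  qed
  define h where "h = (\<lambda>x. G x - of_int e * x)"
  obtain M where M: "M \<ge> 0" "\<And>x. \<bar>h x\<bar> \<le> M"
  proof (rule periodic_bounded[of h])
    show "continuous_on UNIV h" unfolding h_def by (intro continuous_intros G(1))
    show "h (x + 2 * pi) = h x" for x using e[of x] by (simp add: h_def algebra_simps)
  qed auto
  have hd: "h (- (real d * x)) = - real d * h x" for x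
    using Gd[of x] by (simp add: h_def algebra_simps)
  have pow: "real d ^ n * \<bar>h x\<bar> \<le> M" for n x
  proof (induction n arbitrary: x)
    case (Suc n)
    have "real d ^ Suc n * \<bar>h x\<bar> = real d ^ n * \<bar>h (- (real d * x))\<bar>"
      unfolding hd by (simp add: abs_mult)
    also have "\<dots> \<le> M" by (rule Suc)
    finally show ?case .
  qed (use M in auto)
  have h0: "h x = 0" for x
  proof (rule ccontr)
    assume "h x \<noteq> 0"
    obtain n where "M / \<bar>h x\<bar> < real d ^ n" using d real_arch_pow[of "real d"] by auto
    then show False using pow[of n x] \<open>h x \<noteq> 0\<close> by (auto simp: field_simps)
  qed
  have gz: "g z = z powi e" if "z \<in> circle" for z
  proof -
    obtain x where "z = cis x" using circle_cis \<open>z \<in> circle\<close> by blast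
    then show ?thesis using G(2)[of x] h0[of x] by (simp add: h_def cis_power_int)
  qed
  have "e = 1 \<or> e = -1"
  proof (rule ccontr)
    assume ne: "\<not> (e = 1 \<or> e = -1)"
    \<comment> \<open>For every \<open>e\<close> other than 1 and -1 this \<open>cis x\<close>
      differs from 1 but is sent to 1 by the power \<open>e\<close>: it is -1 for
      \<open>e = 0\<close> and a primitive root of unity otherwise. This contradicts
      injectivity.\<close>
    define x where "x = (if e = 0 then pi else 2 * pi / e)"
    have "g (cis x) = g 1"
      using ne by (auto simp: x_def gz cis_power_int g1)
    then have "cis x = cis 0" using inj by (simp add: inj_on_def)
    then obtain n :: int where n: "x = 2 * pi * n" unfolding cis_eq_iff_int by auto
    show False
    proof (cases "e = 0")
      case True
      then have "2 * real_of_int n = 1" using n by (simp add: x_def)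
      then have "2 * n = 1" by linarith
      then show False by presburger
    next
      case False
      then have "real_of_int (e * n) = 1" using n by (simp add: x_def field_simps)
      then have "e * n = 1" by linarith
      then show False using ne by (metis zmult_eq_1_iff)
    qed
  qed
  then show ?thesis using gz by auto
qed

text \<open>The \<open>m\<close>-th roots of unity are fixed by \<open>T\<close>. As
  \<open>T\<close> is multiplicative, multiplication by one of them commutes with
  \<open>T\<close>.\<close>

lemma root_of_unity_powi:
  assumes "\<xi> ^ m = (1::complex)" "m > 0"
  shows "\<xi> powi - int (m - 1) = \<xi>"
proof -
  have "\<xi> \<noteq> 0" using assms by (auto simp: power_0_left split: if_splits)
  moreover have "\<xi> ^ (m - 1) * \<xi> = 1" using assms by (metis power_minus_mult)
  ultimately show ?thesis by (simp add: power_int_minus field_simps)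
qed

text \<open>\<open>g 1\<close> is a fixed point of the power map, hence an \<open>m\<close>-th root
  of unity; dividing by it gives a map that still commutes and fixes 1.\<close>

lemma commuting_with_power_map:
  fixes g :: "complex \<Rightarrow> complex"
  assumes cont: "continuous_on circle g" and into: "g \<in> circle \<rightarrow> circle" and inj: "inj_on g circle"
    and m: "m \<ge> 3"
    and comm: "\<And>z. z \<in> circle \<Longrightarrow> g (z powi - int (m - 1)) = g z powi - int (m - 1)"
  shows "\<exists>\<xi>. \<xi> ^ m = 1 \<and> (\<exists>e\<in>{-1,1::int}. \<forall>z\<in>circle. g z = \<xi> * z powi e)"
proof -
  define \<xi> where "\<xi> = g 1"
  have \<xi>: "\<xi> \<in> circle" using into by (auto simp: \<xi>_def)
  then have nz: "\<xi> \<noteq> 0" by auto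
  have fx: "\<xi> = \<xi> powi - int (m - 1)" using comm[of 1] by (simp add: \<xi>_def)
  have "\<xi> ^ m = \<xi> ^ (m - 1) * \<xi>" using m by (metis power_minus_mult not_numeral_le_zero gr0I)
  also have "\<dots> = 1" using fx nz by (simp add: power_int_minus field_simps)
  finally have \<xi>m: "\<xi> ^ m = 1" .
  have "\<exists>e\<in>{-1,1::int}. \<forall>z\<in>circle. g z / \<xi> = z powi e"
  proof (rule commuting_with_power_map_fixing_1[of _ "m - 1"])
    show "continuous_on circle (\<lambda>z. g z / \<xi>)" using nz by (intro continuous_intros cont) auto
    show "(\<lambda>z. g z / \<xi>) \<in> circle \<rightarrow> circle" using into \<xi> by (auto simp: norm_divide)
    show "inj_on (\<lambda>z. g z / \<xi>) circle" using inj nz by (auto simp: inj_on_def)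
    show "g 1 / \<xi> = 1" using nz by (simp add: \<xi>_def)
    fix z :: complex assume "z \<in> circle"
    then show "g (z powi - int (m - 1)) / \<xi> = (g z / \<xi>) powi - int (m - 1)"
      using comm fx by (simp add: power_int_divide_distrib)
  qed (use m in auto)
  then show ?thesis using \<xi>m nz by (auto simp: field_simps intro!: exI[of _ \<xi>])
qed

section \<open>Semiconjugacy of a lift to multiplication by its degree\<close>

text \<open>\<open>\<phi>\<close> is the uniform limit of \<open>(-1/d)\<^sup>n F\<^sup>n\<close>, whose successive differences are bounded by a
  geometric series because \<open>F x + d x\<close> is periodic.\<close>

lemma semiconjugacy_of_lift:
  fixes F :: "real \<Rightarrow> real" and d :: nat
  assumes cont: "continuous_on UNIV F" and per: "\<And>x. F (x + 2 * pi) = F x - 2 * pi * real d"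
    and anti: "antimono F" and d: "d \<ge> 2"
  obtains \<phi> where "continuous_on UNIV \<phi>" "mono \<phi>" "\<And>x. \<phi> (x + 2 * pi) = \<phi> x + 2 * pi"
    "\<And>x. \<phi> (F x) = - real d * \<phi> x"
proof -
  define s where "s = (\<lambda>n x. (- 1 / real d) ^ n * (F ^^ n) x)"
  have s0: "s 0 x = x" for x by (simp add: s_def)
  have sS: "s (Suc n) x = (- 1 / real d) * s n (F x)" for n x
    by (simp add: s_def funpow_swap1)
  obtain K where K: "K \<ge> 0" "\<And>x. \<bar>F x + real d * x\<bar> \<le> K"
  proof (rule periodic_bounded[of "\<lambda>x. F x + real d * x"])
    show "continuous_on UNIV (\<lambda>x. F x + real d * x)" by (intro continuous_intros cont)
    show "F (x + 2 * pi) + real d * (x + 2 * pi) = F x + real d * x" for x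
      using per[of x] by (simp add: algebra_simps)
  qed auto
  define D where "D = (\<lambda>n x. s (Suc n) x - s n x)"
  have D_bound: "norm (D n x) \<le> K * (1 / d) ^ Suc n" for n x
  proof -
    define y where "y = (F ^^ n) x"
    have "D n x = (- 1 / real d) ^ Suc n * (F y + real d * y)"
      using d by (simp add: D_def s_def y_def algebra_simps)
    also have "\<bar>\<dots>\<bar> = (1 / d) ^ Suc n * \<bar>F y + real d * y\<bar>"
      by (simp add: abs_mult power_abs)
    also have "\<dots> \<le> (1 / d) ^ Suc n * K" by (intro mult_left_mono K) auto
    finally show ?thesis by (simp add: mult_ac)
  qed
  have s_sum: "s n x = x + (\<Sum>i<n. D i x)" for n x
    unfolding D_def by (subst sum_lessThan_telescope) (simp add: s0)
  define \<phi> where "\<phi> = (\<lambda>x. x + suminf (\<lambda>i. D i x))"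
  have "summable (\<lambda>n. K * (1 / real d) ^ Suc n)"
    using d by (intro summable_mult summable_Suc_iff[THEN iffD2] summable_geometric) auto
  then have ul: "uniform_limit UNIV (\<lambda>n x. \<Sum>i<n. D i x) (\<lambda>x. suminf (\<lambda>i. D i x)) sequentially"
    by (rule Weierstrass_m_test[OF D_bound])
  have "uniform_limit UNIV (\<lambda>n x. x + (\<Sum>i<n. D i x)) \<phi> sequentially"
    unfolding \<phi>_def by (intro uniform_limit_intros ul)
  then have us: "uniform_limit UNIV s \<phi> sequentially" by (simp add: s_sum[abs_def])
  have lim: "(\<lambda>n. s n x) \<longlonglongrightarrow> \<phi> x" for x
    using tendsto_uniform_limitI[OF us] by simp
  have s_cont: "continuous_on UNIV (s n)" for n
  proof (induction n)
    case (Suc n)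
    show ?case unfolding sS[abs_def]
      by (intro continuous_intros continuous_on_compose2[OF Suc cont]) auto
  qed (simp add: s0[abs_def])
  \<comment> \<open>The order reversal of \<open>F\<close> is undone by the negative factor
    \<open>- 1 / d\<close>, so every approximant is increasing.\<close>
  have s_mono: "mono (s n)" for n
  proof (induction n)
    case (Suc n)
    show ?case
    proof
      fix x y :: real assume "x \<le> y"
      then have "s n (F y) \<le> s n (F x)" using Suc anti by (simp add: monoD antimonoD)
      then show "s (Suc n) x \<le> s (Suc n) y" using d by (simp add: sS divide_right_mono)
    qed
  qed (simp add: s0[abs_def] mono_def)
  \<comment> \<open>All integral shifts are needed in the induction, since \<open>F\<close> turns a
    shift by \<open>k\<close> periods into one by \<open>- d * k\<close> periods.\<close>
  have s_shift: "s n (x + 2 * pi * of_int k) = s n x + 2 * pi * of_int k" for n x k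
  proof (induction n arbitrary: x k)
    case (Suc n)
    have "F (x + 2 * pi * of_int k) = F x + 2 * pi * of_int (- int d * k)"
      using quasiperiodic_int_shift[of F "2 * pi" "- 2 * pi * real d"] per by simp
    then have "s (Suc n) (x + 2 * pi * of_int k) = (- 1 / real d) * (s n (F x) + 2 * pi * of_int (- int d * k))"
      unfolding sS by (simp only: Suc.IH)
    also have "\<dots> = s (Suc n) x + 2 * pi * of_int k" using d by (simp add: sS field_simps)
    finally show ?case .
  qed (simp add: s0)
  show ?thesis
  proof (rule that[of \<phi>])
    show "continuous_on UNIV \<phi>"
      by (rule uniform_limit_theorem[OF _ us]) (use s_cont in auto)
    show "mono \<phi>"
    proof
      fix x y :: real assume "x \<le> y"
      then show "\<phi> x \<le> \<phi> y" using s_mono by (intro LIMSEQ_le[OF lim lim]) (auto dest: monoD)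
    qed
    show "\<phi> (x + 2 * pi) = \<phi> x + 2 * pi" for x
    proof (rule LIMSEQ_unique[OF lim])
      show "(\<lambda>n. s n (x + 2 * pi)) \<longlonglongrightarrow> \<phi> x + 2 * pi"
        using s_shift[of _ x 1] by (simp add: tendsto_add[OF lim tendsto_const])
    qed
    show "\<phi> (F x) = - real d * \<phi> x" for x
    proof (rule LIMSEQ_unique[OF lim])
      have "s n (F x) = - real d * s (Suc n) x" for n using d by (simp add: sS)
      then show "(\<lambda>n. s n (F x)) \<longlonglongrightarrow> - real d * \<phi> x"
        using tendsto_mult[OF tendsto_const LIMSEQ_Suc[OF lim[of x]], of "- real d"] by simp
    qed
  qed
qed

lemma cis_Arg_circle: "z \<in> circle \<Longrightarrow> cis (Arg z) = z"
  using rcis_cmod_Arg[of z] by (simp add: rcis_def)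

lemma circle_homeomorphism_of_lift:
  fixes \<phi> :: "real \<Rightarrow> real"
  assumes cont: "continuous_on UNIV \<phi>" and mono: "strict_mono \<phi>"
    and per: "\<And>x. \<phi> (x + 2 * pi) = \<phi> x + 2 * pi"
  obtains \<Phi> \<Psi> where "homeomorphism circle circle \<Phi> \<Psi>" "\<And>x. \<Phi> (cis x) = cis (\<phi> x)"
proof -
  define \<Phi> where "\<Phi> = (\<lambda>z. cis (\<phi> (Arg z)))"
  have shift: "\<phi> (x + 2 * pi * of_int n) = \<phi> x + 2 * pi * of_int n" for x n
    using quasiperiodic_int_shift[of \<phi>] per by blast
  have \<Phi>: "\<Phi> (cis x) = cis (\<phi> x)" for x
  proof -
    have "cis (Arg (cis x)) = cis x" by (simp add: cis_Arg_circle)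
    then obtain n :: int where "Arg (cis x) = x + 2 * pi * n" using cis_eq_iff_int by blast
    then show ?thesis by (simp add: \<Phi>_def shift cis_eq_iff_int)
  qed
  have cont\<Phi>: "continuous_on circle \<Phi>"
  proof (clarsimp simp: continuous_on_eq_continuous_within)
    fix z0 :: complex assume "cmod z0 = 1"
    then obtain x0 where x0: "z0 = cis x0" using circle_cis by auto
    \<comment> \<open>\<open>Arg\<close> jumps on the negative axis, so near \<open>z0\<close> it is
      replaced by the branch \<open>x0 + Arg (z / z0)\<close>, which is continuous at
      \<open>z0\<close> because \<open>Arg\<close> is continuous at 1.\<close>
    have eq: "\<Phi> z = cis (\<phi> (x0 + Arg (z / z0)))" if "z \<in> circle" for z
    proof -
      have "z / z0 \<in> circle" using that \<open>cmod z0 = 1\<close> by (simp add: norm_divide)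
      then have "cis (Arg (z / z0)) = z / z0" by (rule cis_Arg_circle)
      then have "z = cis (x0 + Arg (z / z0))" using x0 by (simp flip: cis_mult)
      then show ?thesis using \<Phi> by metis
    qed
    have "isCont (\<lambda>z. cis (\<phi> (x0 + Arg (z / z0)))) z0"
    proof -
      have "z0 \<noteq> 0" using x0 by simp
      then have "isCont (\<lambda>z. z / z0) z0" "isCont Arg (z0 / z0)"
        by (auto intro!: continuous_intros continuous_at_Arg)
      then have "isCont (\<lambda>z. Arg (z / z0)) z0" by (rule isCont_o2)
      then have *: "isCont (\<lambda>z. x0 + Arg (z / z0)) z0" by (intro continuous_intros)
      have "isCont \<phi> y" for y using cont by (simp add: continuous_on_eq_continuous_at)
      then have "isCont (\<lambda>z. \<phi> (x0 + Arg (z / z0))) z0"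
        using isCont_o2[OF *] by blast
      then show ?thesis unfolding cis_conv_exp by (intro continuous_intros)
    qed
    then have "continuous (at z0 within circle) (\<lambda>z. cis (\<phi> (x0 + Arg (z / z0))))"
      using continuous_at_imp_continuous_within by blast
    then show "continuous (at z0 within circle) \<Phi>"
      by (rule continuous_transform_within[of _ _ _ 1]) (use \<open>cmod z0 = 1\<close> in \<open>auto simp: eq\<close>)
  qed
  have inj: "inj_on \<Phi> circle"
  proof (rule inj_onI)
    fix z w assume "z \<in> circle" "w \<in> circle" "\<Phi> z = \<Phi> w"
    then obtain x y where xy: "z = cis x" "w = cis y" "cis (\<phi> x) = cis (\<phi> y)"
      using circle_cis \<Phi> by metis
    then obtain n :: int where "\<phi> x = \<phi> (y + 2 * pi * n)" using shift cis_eq_iff_int by metis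
    then show "z = w" using strict_mono_eq[OF mono] xy cis_eq_iff_int by metis
  qed
  have surj: "\<Phi> ` circle = circle"
  proof (intro equalityI subsetI)
    fix w :: complex assume "w \<in> circle"
    then obtain y where y: "w = cis y" using circle_cis by blast
    define n where "n = \<lceil>\<bar>y - \<phi> 0\<bar> / (2 * pi)\<rceil>"
    have "\<bar>y - \<phi> 0\<bar> / (2 * pi) \<le> of_int n" unfolding n_def by linarith
    then have n: "\<bar>y - \<phi> 0\<bar> \<le> 2 * pi * of_int n" by (simp add: field_simps)
    have "\<phi> (- (2 * pi * of_int n)) \<le> y" "y \<le> \<phi> (2 * pi * of_int n)"
      using n shift[of 0 "- n"] shift[of 0 n] by auto
    moreover have "- (2 * pi * of_int n) \<le> 2 * pi * of_int n"
      using n abs_ge_zero[of "y - \<phi> 0"] by linarith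
    ultimately obtain x where "\<phi> x = y"
      using IVT'[of \<phi> "- (2 * pi * of_int n)" y "2 * pi * of_int n"] continuous_on_subset[OF cont] by blast
    then show "w \<in> \<Phi> ` circle" using \<Phi>[of x] y by (metis cis_in_circle imageI)
  qed (auto simp: \<Phi>_def)
  obtain \<Psi> where "homeomorphism circle circle \<Phi> \<Psi>"
    using homeomorphism_compact[OF _ cont\<Phi> surj inj] by auto
  then show ?thesis using that \<Phi> by blast
qed

section \<open>The Lorentz form and reflections\<close>

text \<open>A vector of \<open>\<real>\<^sup>3\<close> is written as a pair \<open>(x\<^sub>1 + x\<^sub>2 \<i>, x\<^sub>3)\<close>, so that a point \<open>z\<close> of the circle spans
  the isotropic line of \<open>(z, 1)\<close>.\<close>

definition lform :: "complex \<times> real \<Rightarrow> complex \<times> real \<Rightarrow> real" where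
  "lform x y = fst x \<bullet> fst y - snd x * snd y"

definition hat :: "complex \<Rightarrow> complex \<times> real" where
  "hat z = (z, 1)"

definition lreflect :: "complex \<times> real \<Rightarrow> complex \<times> real \<Rightarrow> complex \<times> real" where
  "lreflect w x = x - (2 * lform x w) *\<^sub>R w"

definition int_lattice :: "(complex \<times> real) set" where
  "int_lattice = {x. Re (fst x) \<in> \<int> \<and> Im (fst x) \<in> \<int> \<and> snd x \<in> \<int>}"

text \<open>The unit normal \<open>(L v \<times> L u) / \<langle>v, u\<rangle>\<close> of the plane spanned by \<open>(u, 1)\<close> and \<open>(v, 1)\<close>.\<close>

definition edge :: "complex \<Rightarrow> complex \<Rightarrow> complex \<times> real" where
  "edge u v = (2 / (cmod (u - v))\<^sup>2) *\<^sub>R (\<i> * (u - v), Im (cnj u * v))"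

lemma lform_commute: "lform x y = lform y x"
  by (simp add: lform_def inner_commute mult.commute)

lemma lform_simps [simp]:
  "lform (x + y) z = lform x z + lform y z"
  "lform (x - y) z = lform x z - lform y z"
  "lform (c *\<^sub>R x) z = c * lform x z"
  "lform z (x + y) = lform z x + lform z y"
  "lform z (x - y) = lform z x - lform z y"
  "lform z (c *\<^sub>R x) = c * lform z x"
  "lform 0 z = 0" "lform z 0 = 0"
  by (auto simp: lform_def inner_simps algebra_simps)

lemma lform_sum_right: "lform x (\<Sum>i\<in>I. f i) = (\<Sum>i\<in>I. lform x (f i))"
  by (induction I rule: infinite_finite_induct) auto

lemma lform_hat_self_iff: "lform (hat z) (hat z) = 0 \<longleftrightarrow> z \<in> circle"
  by (simp add: lform_def hat_def norm_eq_1)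

lemma lform_lattice: "x \<in> int_lattice \<Longrightarrow> y \<in> int_lattice \<Longrightarrow> lform x y \<in> \<int>"
  by (auto simp: int_lattice_def lform_def inner_complex_def)

lemma lreflect_lattice: "w \<in> int_lattice \<Longrightarrow> x \<in> int_lattice \<Longrightarrow> lreflect w x \<in> int_lattice"
  using lform_lattice[of x w] by (auto simp: lreflect_def int_lattice_def)

lemma int_lattice_sum: "(\<And>i. i \<in> I \<Longrightarrow> f i \<in> int_lattice) \<Longrightarrow> (\<Sum>i\<in>I. f i) \<in> int_lattice"
  by (induction I rule: infinite_finite_induct) (auto simp: int_lattice_def)

lemma lform_lreflect:
  assumes "lform w w = 1"
  shows "lform (lreflect w x) (lreflect w y) = lform x y"
  using assms by (simp add: lreflect_def lform_commute[of w y] algebra_simps)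

lemma lform_lreflect_right: "lform (lreflect w x) y = lform x y - 2 * lform x w * lform w y"
  by (simp add: lreflect_def)

lemma norm_diff_square:
  assumes "u \<in> circle" "v \<in> circle"
  shows "(cmod (u - v))\<^sup>2 = 2 - 2 * (Re u * Re v + Im u * Im v)"
proof -
  have "(Re u)\<^sup>2 + (Im u)\<^sup>2 = 1" "(Re v)\<^sup>2 + (Im v)\<^sup>2 = 1"
    using assms by (auto simp: cmod_def)
  then show ?thesis unfolding cmod_power2 by (simp add: power2_diff)
qed

lemma lform_hat_hat:
  "u \<in> circle \<Longrightarrow> v \<in> circle \<Longrightarrow> lform (hat u) (hat v) = - (cmod (u - v))\<^sup>2 / 2"
  by (simp add: norm_diff_square lform_def hat_def inner_complex_def)

lemma lform_complex:
  "complex_of_real (lform x y) =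
    (fst x * cnj (fst y) + cnj (fst x) * fst y) / 2 - of_real (snd x * snd y)"
  by (simp add: lform_def inner_complex_def complex_eq_iff)

lemma cnj_circle:
  assumes "z \<in> circle"
  shows "cnj z = 1 / z"
proof -
  have "z * cnj z = 1" using complex_norm_square[of z] assms by simp
  moreover have "z \<noteq> 0" using assms by auto
  ultimately show ?thesis by (simp add: field_simps)
qed

text \<open>The left side is a product of two determinants, with rows \<open>x\<close>,
  \<open>U\<close>, \<open>V\<close> and \<open>y\<close>, \<open>U\<close>, \<open>V\<close> for
  \<open>U = (a, b, 1)\<close> and \<open>V = (c, d, 1)\<close>. The right side is minus the Gram
  determinant of their Lorentz pairings, expanded along the row of \<open>x\<close>; the sign is the
  determinant of \<open>L\<close>.\<close>

lemma gram_identity: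
  fixes a b c d :: real
  shows "(x1 * (b - d) - x2 * (a - c) + x3 * (a * d - b * c)) * (y1 * (b - d) - y2 * (a - c) + y3 * (a * d - b * c)) =
    (x1 * y1 + x2 * y2 - x3 * y3) * ((a * c + b * d - 1)\<^sup>2 - (a\<^sup>2 + b\<^sup>2 - 1) * (c\<^sup>2 + d\<^sup>2 - 1))
    + (x1 * a + x2 * b - x3) * ((a * y1 + b * y2 - y3) * (c\<^sup>2 + d\<^sup>2 - 1) - (a * c + b * d - 1) * (c * y1 + d * y2 - y3))
    - (x1 * c + x2 * d - x3) * ((a * y1 + b * y2 - y3) * (a * c + b * d - 1) - (a\<^sup>2 + b\<^sup>2 - 1) * (c * y1 + d * y2 - y3))"
  by (simp add: algebra_simps power2_eq_square)

context
  fixes u v :: complex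
  assumes u: "u \<in> circle" and v: "v \<in> circle" and uv: "u \<noteq> v"
begin

private lemma nonzero: "u \<noteq> 0" "v \<noteq> 0" "u - v \<noteq> 0"
  using u v uv by auto

text \<open>Conjugation is inversion on the circle. This turns the norm, and with it both components
  of \<open>edge u v\<close>, into rational functions of \<open>u\<close> and \<open>v\<close>, so
  that the following identities become field arithmetic.\<close>

private lemma norm_complex: "complex_of_real ((cmod (u - v))\<^sup>2) = - (u - v)\<^sup>2 / (u * v)"
  unfolding complex_norm_square complex_cnj_diff cnj_circle[OF u] cnj_circle[OF v]
  using nonzero by (simp add: field_simps power2_eq_square)

private lemma edge_fst: "fst (edge u v) = - 2 * \<i> * u * v / (u - v)"
proof -
  have "fst (edge u v) = 2 / complex_of_real ((cmod (u - v))\<^sup>2) * (\<i> * (u - v))"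
    by (simp add: edge_def scaleR_conv_of_real)
  also have "\<dots> = - 2 * \<i> * u * v / (u - v)"
    unfolding norm_complex using nonzero by (simp add: power2_eq_square)
  finally show ?thesis .
qed

private lemma edge_snd: "complex_of_real (snd (edge u v)) = - \<i> * (u + v) / (u - v)"
proof -
  have "complex_of_real (Im (cnj u * v)) = (cnj u * v - u * cnj v) / (2 * \<i>)"
    by (simp add: complex_eq_iff) (simp add: field_simps)
  also have "\<dots> = \<i> * (u - v) * (u + v) / (2 * u * v)"
    unfolding cnj_circle[OF u] cnj_circle[OF v] using nonzero by (simp add: field_simps)
  finally have "complex_of_real (Im (cnj u * v)) = \<i> * (u - v) * (u + v) / (2 * u * v)" .
  then have "complex_of_real (snd (edge u v)) =
      2 / complex_of_real ((cmod (u - v))\<^sup>2) * (\<i> * (u - v) * (u + v) / (2 * u * v))"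
    by (simp only: edge_def snd_scaleR snd_conv real_scaleR_def of_real_mult of_real_divide of_real_numeral)
  also have "\<dots> = - \<i> * (u + v) / (u - v)"
    unfolding norm_complex using nonzero by (simp add: power2_eq_square)
  finally show ?thesis .
qed

private lemma edge_fst_cnj: "cnj (fst (edge u v)) = - 2 * \<i> / (u - v)"
proof -
  have "cnj (u - v) = - (u - v) / (u * v)"
    unfolding complex_cnj_diff cnj_circle[OF u] cnj_circle[OF v] using nonzero by (simp add: field_simps)
  then have "cnj (fst (edge u v)) = 2 * \<i> * (1 / u * (1 / v)) / (- (u - v) / (u * v))"
    unfolding edge_fst by (simp add: cnj_circle[OF u] cnj_circle[OF v])
  also have "\<dots> = - 2 * \<i> / (u - v)"
    using nonzero by (simp add: field_simps)
  finally show ?thesis .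
qed

private lemma lform_hat_edge:
  assumes z: "z \<in> circle"
  shows "complex_of_real (lform (hat z) (edge u v)) = - \<i> * (z - u) * (z - v) / ((u - v) * z)"
proof -
  have "z \<noteq> 0" using z by auto
  then show ?thesis
    unfolding lform_complex edge_fst_cnj
    unfolding hat_def fst_conv snd_conv mult_1 edge_snd edge_fst cnj_circle[OF z]
    using nonzero(3) by (simp add: divide_simps) (simp add: algebra_simps)
qed

lemma lform_hat_edge_left: "lform (hat u) (edge u v) = 0"
  using lform_hat_edge[OF u] by simp

lemma lform_hat_edge_right: "lform (hat v) (edge u v) = 0"
  using lform_hat_edge[OF v] by simp

lemma lform_edge_self: "lform (edge u v) (edge u v) = 1"
proof -
  have "complex_of_real (lform (edge u v) (edge u v)) = 1"
    unfolding lform_complex of_real_mult edge_snd edge_fst_cnj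
    unfolding edge_fst
    using nonzero(3) by (simp add: divide_simps) (simp add: algebra_simps)
  then show ?thesis by simp
qed

text \<open>\<open>hat u\<close> and \<open>hat v\<close> are isotropic and \<open>edge u v\<close>
  is a unit vector orthogonal to both; this is the form written in that basis. It follows from
  \<open>gram_identity\<close>, where the self-pairings of \<open>hat u\<close> and
  \<open>hat v\<close> vanish.\<close>

lemma lform_decomposition:
  "lform x y = (lform x (hat u) * lform y (hat v) + lform x (hat v) * lform y (hat u)) / lform (hat u) (hat v)
     + lform x (edge u v) * lform y (edge u v)"
proof -
  define e where "e = (\<i> * (u - v), Im (cnj u * v))"
  define g where "g = lform (hat u) (hat v)"
  have g: "g = - (cmod (u - v))\<^sup>2 / 2" "g \<noteq> 0"
    using uv lform_hat_hat[OF u v] by (auto simp: g_def)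
  have e: "edge u v = (- 1 / g) *\<^sub>R e" using g by (simp add: edge_def e_def)
  have unit: "(Re u)\<^sup>2 + (Im u)\<^sup>2 = 1" "(Re v)\<^sup>2 + (Im v)\<^sup>2 = 1"
    using u v by (auto simp: cmod_def)
  \<comment> \<open>Pairing with \<open>e\<close> is minus the determinant with rows
    \<open>x\<close>, \<open>hat u\<close>, \<open>hat v\<close>, which is the factor occurring in
    \<open>gram_identity\<close>.\<close>
  have le: "lform x e = - (Re (fst x) * (Im u - Im v) - Im (fst x) * (Re u - Re v) + snd x * (Re u * Im v - Im u * Re v))" for x
    by (simp add: lform_def e_def inner_complex_def algebra_simps)
  have lu: "lform x (hat w) = Re (fst x) * Re w + Im (fst x) * Im w - snd x" for x w
    by (simp add: lform_def hat_def inner_complex_def)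
  have gg: "g = Re u * Re v + Im u * Im v - 1" by (simp add: g_def lu) (simp add: hat_def)
  have "lform x e * lform y e = lform x y * g\<^sup>2 - g * (lform x (hat u) * lform y (hat v) + lform x (hat v) * lform y (hat u))"
    unfolding le minus_mult_minus gram_identity unit
    by (simp add: lu gg lform_def[of x y] inner_complex_def algebra_simps)
  then have "lform x y = (g * (lform x (hat u) * lform y (hat v) + lform x (hat v) * lform y (hat u)) + lform x e * lform y e) / g\<^sup>2"
    using g(2) by (simp add: field_simps)
  also have "\<dots> = (lform x (hat u) * lform y (hat v) + lform x (hat v) * lform y (hat u)) / g
     + lform x (edge u v) * lform y (edge u v)"
    using g(2) unfolding e lform_simps by (simp add: add_divide_distrib power2_eq_square)
  finally show ?thesis by (simp add: g_def)
qed

lemma circle_reflection_denominator: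
  assumes z: "z \<in> circle"
  shows "2 * z - (u + v) \<noteq> 0"
proof
  assume "2 * z - (u + v) = 0"
  then have z2: "z = (u + v) / 2" by (simp add: mult.commute)
  have "z \<noteq> 0" using z by auto
  have "1 = complex_of_real ((cmod z)\<^sup>2)" using z by simp
  also have "\<dots> = (u + v)\<^sup>2 / (4 * u * v)"
    unfolding complex_norm_square z2 complex_cnj_divide complex_cnj_add cnj_circle[OF u] cnj_circle[OF v]
    using nonzero by (simp add: field_simps power2_eq_square)
  finally have "(u - v)\<^sup>2 = 0" using nonzero by (simp add: field_simps power2_eq_square)
  then show False using uv by simp
qed

text \<open>The linear reflection acts on the isotropic lines as the reflection acts on the circle.
  The factor is made explicit because its positivity preserves the signs of pairings along an
  orbit.\<close>

lemma lreflect_hat: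
  assumes z: "z \<in> circle"
  shows "lreflect (edge u v) (hat z) =
    ((cmod (2 * z - (u + v)))\<^sup>2 / (cmod (u - v))\<^sup>2) *\<^sub>R hat (circle_reflection u v z)"
proof -
  define \<mu> where "\<mu> = (cmod (2 * z - (u + v)))\<^sup>2 / (cmod (u - v))\<^sup>2"
  have z0: "z \<noteq> 0" using z by auto
  have den: "2 * z - (u + v) \<noteq> 0" by (rule circle_reflection_denominator[OF z])
  have "complex_of_real \<mu> = complex_of_real ((cmod (2 * z - (u + v)))\<^sup>2) / complex_of_real ((cmod (u - v))\<^sup>2)"
    by (simp add: \<mu>_def)
  also have "complex_of_real ((cmod (2 * z - (u + v)))\<^sup>2) = (2 * z - (u + v)) * (2 / z - (1 / u + 1 / v))"
    unfolding complex_norm_square by (simp add: cnj_circle[OF u] cnj_circle[OF v] cnj_circle[OF z])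
  also have "\<dots> = (2 * z - (u + v)) * (2 * u * v - (u + v) * z) / (u * v * z)"
    using nonzero z0 by (simp add: field_simps)
  finally have \<mu>: "complex_of_real \<mu> = (2 * z - (u + v)) * ((u + v) * z - 2 * u * v) / (z * (u - v)\<^sup>2)"
    unfolding norm_complex using nonzero z0 by (simp add: divide_simps) (simp add: algebra_simps)
  have "fst (lreflect (edge u v) (hat z)) =
      z - 2 * (- \<i> * (z - u) * (z - v) / ((u - v) * z)) * (- 2 * \<i> * u * v / (u - v))"
    by (simp only: lreflect_def fst_diff fst_scaleR scaleR_conv_of_real of_real_mult lform_hat_edge[OF z] edge_fst)
      (simp add: hat_def)
  also have "\<dots> = ((u - v)\<^sup>2 * z\<^sup>2 + 4 * u * v * (z - u) * (z - v)) / (z * (u - v)\<^sup>2)"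
    using nonzero(3) z0 by (simp add: divide_simps power2_eq_square)
  also have "(u - v)\<^sup>2 * z\<^sup>2 + 4 * u * v * (z - u) * (z - v) = ((u + v) * z - 2 * u * v)\<^sup>2"
    by (simp add: power2_eq_square algebra_simps)
  also have "\<dots> / (z * (u - v)\<^sup>2) = complex_of_real \<mu> * circle_reflection u v z"
    unfolding \<mu> circle_reflection_def using den by (simp add: power2_eq_square)
  finally have 1: "fst (lreflect (edge u v) (hat z)) = complex_of_real \<mu> * circle_reflection u v z" .
  have "complex_of_real (snd (lreflect (edge u v) (hat z))) =
      1 - 2 * (- \<i> * (z - u) * (z - v) / ((u - v) * z)) * (- \<i> * (u + v) / (u - v))"
    by (simp only: lreflect_def snd_diff snd_scaleR real_scaleR_def of_real_diff of_real_mult lform_hat_edge[OF z] edge_snd)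
      (simp add: hat_def)
  also have "\<dots> = ((u - v)\<^sup>2 * z + 2 * (u + v) * (z - u) * (z - v)) / (z * (u - v)\<^sup>2)"
    using nonzero(3) z0 by (simp add: divide_simps power2_eq_square) (simp add: algebra_simps)
  also have "(u - v)\<^sup>2 * z + 2 * (u + v) * (z - u) * (z - v) = (2 * z - (u + v)) * ((u + v) * z - 2 * u * v)"
    by (simp add: power2_eq_square algebra_simps)
  finally have 2: "snd (lreflect (edge u v) (hat z)) = \<mu>"
    unfolding \<mu>[symmetric] of_real_eq_iff .
  show ?thesis
    using 1 2 by (intro prod_eqI) (simp_all add: hat_def scaleR_conv_of_real flip: \<mu>_def)
qed

lemma circle_reflection_in_circle:
  assumes z: "z \<in> circle"
  shows "circle_reflection u v z \<in> circle"
proof -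
  have "lform (lreflect (edge u v) (hat z)) (lreflect (edge u v) (hat z)) = 0"
    using lform_lreflect[OF lform_edge_self] lform_hat_self_iff z by simp
  then show ?thesis
    unfolding lreflect_hat[OF z] using circle_reflection_denominator[OF z] uv
    by (simp add: lform_hat_self_iff)
qed

lemma circle_reflection_involution:
  assumes z: "z \<in> circle"
  shows "circle_reflection u v (circle_reflection u v z) = z"
proof -
  define D w where "D = 2 * z - (u + v)" and "w = (u + v) * z - 2 * u * v"
  have D: "D \<noteq> 0" unfolding D_def by (rule circle_reflection_denominator[OF z])
  have "circle_reflection u v (circle_reflection u v z) = ((u + v) * (w / D) - 2 * u * v) / (2 * (w / D) - (u + v))"
    by (simp only: circle_reflection_def D_def w_def)
  also have "(u + v) * (w / D) - 2 * u * v = ((u + v) * w - 2 * u * v * D) / D"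
    using D by (simp add: diff_divide_distrib)
  also have "2 * (w / D) - (u + v) = (2 * w - (u + v) * D) / D"
    using D by (simp add: diff_divide_distrib)
  also have "(u + v) * w - 2 * u * v * D = (u - v)\<^sup>2 * z"
    by (simp add: D_def w_def power2_eq_square algebra_simps)
  also have "2 * w - (u + v) * D = (u - v)\<^sup>2"
    by (simp add: D_def w_def power2_eq_square algebra_simps)
  finally show ?thesis using uv D by simp
qed

lemma circle_reflection_fixed_iff:
  assumes z: "z \<in> circle"
  shows "circle_reflection u v z = z \<longleftrightarrow> z = u \<or> z = v"
proof -
  have *: "(u + v) * z - 2 * u * v - z * (2 * z - (u + v)) = - 2 * ((z - u) * (z - v))"
    by (simp add: algebra_simps)
  have "circle_reflection u v z = z \<longleftrightarrow> (u + v) * z - 2 * u * v = z * (2 * z - (u + v))"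
    using circle_reflection_denominator[OF z] by (simp add: circle_reflection_def divide_eq_eq)
  also have "\<dots> \<longleftrightarrow> (z - u) * (z - v) = 0" by (subst eq_iff_diff_eq_0) (simp add: *)
  finally show ?thesis by simp
qed

end

text \<open>In this factored form the pairing is visibly positive on the open arc from
  \<open>cis \<alpha>\<close> to \<open>cis \<beta>\<close>, zero at its ends and negative on the
  rest of the circle.\<close>

lemma lform_hat_cis_edge:
  assumes "\<alpha> < \<beta>" "\<beta> < \<alpha> + 2 * pi"
  shows "lform (hat (cis s)) (edge (cis \<alpha>) (cis \<beta>)) =
    2 * sin ((s - \<alpha>) / 2) * sin ((\<beta> - s) / 2) / sin ((\<beta> - \<alpha>) / 2)"
proof -
  define p q where "p = (s - \<alpha>) / 2" and "q = (\<beta> - s) / 2"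
  have pq: "s - \<alpha> = 2 * p" "\<beta> - s = 2 * q" "\<beta> - \<alpha> = 2 * (p + q)" "(\<beta> - \<alpha>) / 2 = p + q"
    by (auto simp: p_def q_def field_simps)
  have pos: "sin (p + q) > 0" using assms by (intro sin_gt_zero) (auto simp: p_def q_def field_simps)
  have "cis s \<bullet> (\<i> * (cis \<alpha> - cis \<beta>)) - Im (cnj (cis \<alpha>) * cis \<beta>) = sin (s - \<alpha>) + sin (\<beta> - s) - sin (\<beta> - \<alpha>)"
    by (simp add: inner_complex_def sin_diff algebra_simps)
  also have "\<dots> = 2 * sin p * cos p * (1 - cos (2 * q)) + 2 * sin q * cos q * (1 - cos (2 * p))"
    unfolding pq distrib_left sin_add unfolding sin_double by (simp add: algebra_simps)
  also have "\<dots> = 4 * sin p * sin q * sin (p + q)"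
    unfolding cos_double_sin sin_add by (simp add: power2_eq_square algebra_simps)
  finally have l: "cis s \<bullet> (\<i> * (cis \<alpha> - cis \<beta>)) - Im (cnj (cis \<alpha>) * cis \<beta>) = 4 * sin p * sin q * sin (p + q)" .
  have "(cmod (cis \<alpha> - cis \<beta>))\<^sup>2 = 2 - 2 * cos (\<beta> - \<alpha>)"
    by (subst norm_diff_square) (auto simp: cos_diff)
  also have "\<dots> = 4 * (sin (p + q))\<^sup>2"
    unfolding pq cos_double_sin by simp
  finally have N: "(cmod (cis \<alpha> - cis \<beta>))\<^sup>2 = 4 * (sin (p + q))\<^sup>2" .
  have "lform (hat (cis s)) (edge (cis \<alpha>) (cis \<beta>)) = 2 / (4 * (sin (p + q))\<^sup>2) * (4 * sin p * sin q * sin (p + q))"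
    unfolding l[symmetric] N[symmetric] by (simp add: lform_def hat_def edge_def right_diff_distrib)
  also have "\<dots> = 2 * sin p * sin q / sin (p + q)"
    using pos by (simp add: power2_eq_square field_simps)
  finally show ?thesis unfolding pq(4) p_def q_def .
qed

text \<open>Here unimodularity enters. The vector in \<open>unimodular_arc\<close> is homogeneous of
  degree 0 in each of the two triples, so the heights cancel and the vector is
  \<open>edge u v\<close>.\<close>

lemma edge_in_lattice:
  assumes t: "pythagorean_triple t" "pythagorean_triple t'" and ne: "circle_point t \<noteq> circle_point t'"
    and U: "unimodular_arc t t'"
  shows "edge (circle_point t) (circle_point t') \<in> int_lattice"
proof -
  define u v where "u = circle_point t" and "v = circle_point t'"
  have c: "u \<in> circle" "v \<in> circle" using t circle_point_in_circle by (auto simp: u_def v_def)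
  have pos: "real_of_int (vec_nth t 3) > 0" "real_of_int (vec_nth t' 3) > 0" using t by (auto simp: pythagorean_triple_def)
  have cp: "Re (circle_point s) = vec_nth s 1 / vec_nth s 3" "Im (circle_point s) = vec_nth s 2 / vec_nth s 3" for s
    unfolding circle_point_def of_real_of_int_eq[where 'a = complex, symmetric]
    by (simp_all only: Re_divide_of_real Im_divide_of_real) simp_all
  have ri: "real_of_int (vec_nth t 1) = vec_nth t 3 * Re u" "real_of_int (vec_nth t 2) = vec_nth t 3 * Im u"
    "real_of_int (vec_nth t' 1) = vec_nth t' 3 * Re v" "real_of_int (vec_nth t' 2) = vec_nth t' 3 * Im v"
    using pos by (simp_all add: u_def v_def cp)
  define g where "g = Re u * Re v + Im u * Im v - 1"
  have g: "(cmod (u - v))\<^sup>2 = - 2 * g" using norm_diff_square[OF c] by (simp add: g_def)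
  then have g0: "g \<noteq> 0" using ne by (auto simp: u_def v_def)
  define w where "w = (1 / lorentz_form (real_vec t') (real_vec t)) *\<^sub>R
                cross3 (lorentz_matrix *v real_vec t') (lorentz_matrix *v real_vec t)"
  have w: "vec_nth w 1 \<in> \<int>" "vec_nth w 2 \<in> \<int>" "vec_nth w 3 \<in> \<int>" using U by (auto simp: unimodular_arc_def w_def Let_def)
  have L: "lorentz_matrix *v x = vector [vec_nth x 1, vec_nth x 2, - vec_nth x 3]" for x
    by (simp add: vec_eq_iff forall_3 lorentz_matrix_def matrix_vector_mult_def sum_3 vector_3)
  have lf: "lorentz_form (real_vec t') (real_vec t) = vec_nth t' 3 * vec_nth t 3 * g"
    unfolding lorentz_form_def L
    by (simp add: inner_vec_def sum_3 vector_3 real_vec_def ri g_def algebra_simps)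
  have "vec_nth w 1 = (Im u - Im v) / g" "vec_nth w 2 = (Re v - Re u) / g" "vec_nth w 3 = (Re v * Im u - Im v * Re u) / g"
    unfolding w_def lf L
    using pos g0 by (simp_all add: cross3_def vector_3 real_vec_def ri) (simp_all add: field_simps)
  moreover have "fst (edge u v) = Complex ((Im u - Im v) / g) ((Re v - Re u) / g)"
    "snd (edge u v) = (Re v * Im u - Im v * Re u) / g"
    using g0 by (simp_all add: edge_def g complex_eq_iff field_simps)
  ultimately show ?thesis using w by (simp add: int_lattice_def flip: u_def v_def)
qed

section \<open>Lifting a reflection of the circle\<close>

lemma cis_double_tan:
  assumes "cos \<sigma> \<noteq> 0"
  shows "cis (2 * \<sigma>) * (1 - \<i> * tan \<sigma>) = 1 + \<i> * tan \<sigma>"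
proof -
  have c: "cis \<sigma> = cos \<sigma> * (1 + \<i> * tan \<sigma>)" "cis (- \<sigma>) = cos \<sigma> * (1 - \<i> * tan \<sigma>)"
    using assms by (simp_all add: complex_eq_iff tan_def)
  have "cis (2 * \<sigma>) * cis (- \<sigma>) = cis \<sigma>" by (simp add: cis_mult)
  then have "cos \<sigma> * (cis (2 * \<sigma>) * (1 - \<i> * tan \<sigma>)) = cos \<sigma> * (1 + \<i> * tan \<sigma>)"
    unfolding c by (simp add: mult_ac)
  then show ?thesis using assms by simp
qed

lemma one_plus_i_times_real_nonzero: "1 + \<i> * complex_of_real r \<noteq> 0" "1 - \<i> * complex_of_real r \<noteq> 0"
  by (simp_all add: complex_eq_iff)

lemma cis_double_arctan:
  "cis (2 * arctan r) = (1 + \<i> * complex_of_real r) / (1 - \<i> * complex_of_real r)"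
  using cis_double_tan[of "arctan r"] one_plus_i_times_real_nonzero[of r]
  by (simp add: tan_arctan field_simps)

text \<open>\<open>tan \<sigma>\<close> is the stereographic coordinate from the point opposite to
  the midpoint \<open>cis c\<close> of the arc. The ends have coordinates \<tau> and -\<tau> with
  \<open>\<tau> = tan (\<delta> / 2)\<close>, and the reflection is
  \<open>x \<mapsto> \<tau>\<^sup>2 / x\<close>. Passing to the complementary angle of the
  arctangent removes the pole at the midpoint.\<close>

lemma circle_reflection_cis:
  fixes c \<delta> \<sigma> :: real
  assumes \<delta>: "0 < \<delta>" "\<delta> < pi" and \<sigma>: "cos \<sigma> \<noteq> 0"
  shows "circle_reflection (cis (c - \<delta>)) (cis (c + \<delta>)) (cis (c + 2 * \<sigma>)) =
    cis (c + pi - 2 * arctan (tan \<sigma> / (tan (\<delta> / 2))\<^sup>2))"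
proof -
  define \<tau> where "\<tau> = tan (\<delta> / 2)"
  define p q where "p = tan \<sigma>" and "q = p / \<tau>\<^sup>2"
  have c\<delta>: "cos (\<delta> / 2) > 0" "sin (\<delta> / 2) > 0"
    using \<delta> by (auto intro!: cos_gt_zero_pi sin_gt_zero)
  then have \<tau>: "\<tau> > 0" by (simp add: \<tau>_def tan_def)
  then have p: "p = q * \<tau>\<^sup>2" by (simp add: q_def)
  have cos\<delta>: "cos \<delta> = (1 - \<tau>\<^sup>2) / (1 + \<tau>\<^sup>2)"
  proof -
    have "cos \<delta> = (cos (\<delta> / 2))\<^sup>2 - (sin (\<delta> / 2))\<^sup>2" using cos_double[of "\<delta> / 2"] by simp
    also have "\<dots> = (cos (\<delta> / 2))\<^sup>2 * (1 - \<tau>\<^sup>2)"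
      using c\<delta> by (simp add: \<tau>_def tan_def power_divide field_simps)
    also have "(cos (\<delta> / 2))\<^sup>2 = 1 / (1 + \<tau>\<^sup>2)"
      using c\<delta> tan_sec[of "\<delta> / 2"] unfolding \<tau>_def by (metis divide_inverse inverse_inverse_eq less_irrefl mult_1 power_inverse)
    finally show ?thesis by simp
  qed
  note nz = one_plus_i_times_real_nonzero
  have t1: "1 + (complex_of_real \<tau>)\<^sup>2 \<noteq> 0"
  proof -
    have "1 + \<tau>\<^sup>2 \<noteq> 0" using zero_le_power2[of \<tau>] by linarith
    then have "complex_of_real (1 + \<tau>\<^sup>2) \<noteq> 0" unfolding of_real_eq_0_iff .
    then show ?thesis by simp
  qed
  have E: "cis (2 * \<sigma>) = (1 + \<i> * p) / (1 - \<i> * p)"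
    using cis_double_tan[OF \<sigma>] nz[of p] by (simp add: p_def field_simps)
  have F: "cis (- (2 * arctan q)) = (1 - \<i> * q) / (1 + \<i> * q)"
    unfolding cis_inverse[symmetric] cis_double_arctan by simp
  have co: "complex_of_real (cos \<delta>) = (1 - (complex_of_real \<tau>)\<^sup>2) / (1 + (complex_of_real \<tau>)\<^sup>2)"
    by (simp add: cos\<delta>)
  have key: "- cis (- (2 * arctan q)) * (cis (2 * \<sigma>) - cos \<delta>) = cos \<delta> * cis (2 * \<sigma>) - 1"
  proof -
    have "(1 - \<i> * p) * (1 + (complex_of_real \<tau>)\<^sup>2) * (cis (2 * \<sigma>) - cos \<delta>) =
        (1 + \<i> * p) * (1 + (complex_of_real \<tau>)\<^sup>2) - (1 - (complex_of_real \<tau>)\<^sup>2) * (1 - \<i> * p)"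
      unfolding E co right_diff_distrib using nz[of p] t1 by (simp add: divide_simps) (simp add: algebra_simps)
    also have "\<dots> = 2 * (complex_of_real \<tau>)\<^sup>2 * (1 + \<i> * q)"
      unfolding p by (simp add: algebra_simps)
    finally have 1: "(1 - \<i> * p) * (1 + (complex_of_real \<tau>)\<^sup>2) * (cis (2 * \<sigma>) - cos \<delta>) = 2 * (complex_of_real \<tau>)\<^sup>2 * (1 + \<i> * q)" .
    have "(1 - \<i> * p) * (1 + (complex_of_real \<tau>)\<^sup>2) * (cos \<delta> * cis (2 * \<sigma>) - 1) =
        (1 - (complex_of_real \<tau>)\<^sup>2) * (1 + \<i> * p) - (1 - \<i> * p) * (1 + (complex_of_real \<tau>)\<^sup>2)"
      unfolding E co right_diff_distrib using nz[of p] t1 by (simp add: divide_simps)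
    also have "\<dots> = - (2 * (complex_of_real \<tau>)\<^sup>2 * (1 - \<i> * q))"
      unfolding p by (simp add: algebra_simps)
    also have "\<dots> = - cis (- (2 * arctan q)) * (2 * (complex_of_real \<tau>)\<^sup>2 * (1 + \<i> * q))"
      unfolding F using nz[of q] by simp
    also have "\<dots> = (1 - \<i> * p) * (1 + (complex_of_real \<tau>)\<^sup>2) * (- cis (- (2 * arctan q)) * (cis (2 * \<sigma>) - cos \<delta>))"
      unfolding 1[symmetric] by (simp add: mult_ac)
    finally show ?thesis using nz[of p] t1 by (metis mult_cancel_left mult_eq_0_iff)
  qed
  have S: "cis (c - \<delta>) + cis (c + \<delta>) = 2 * cos \<delta> * cis c"
    by (simp add: complex_eq_iff cos_add sin_add cos_diff sin_diff)
  have P: "cis (c - \<delta>) * cis (c + \<delta>) = cis c * cis c" by (simp add: cis_mult)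
  have den: "cis (2 * \<sigma>) - cos \<delta> \<noteq> 0"
  proof
    assume "cis (2 * \<sigma>) - complex_of_real (cos \<delta>) = 0"
    then have "cmod (cis (2 * \<sigma>)) = \<bar>cos \<delta>\<bar>" by (metis norm_of_real right_minus_eq)
    moreover have "(cos \<delta>)\<^sup>2 < 1"
      using zero_less_power[OF sin_gt_zero[OF \<delta>], of 2] sin_cos_squared_add[of \<delta>] by linarith
    then have "\<bar>cos \<delta>\<bar> < 1" by (simp add: abs_square_less_1)
    ultimately show False by simp
  qed
  have "circle_reflection (cis (c - \<delta>)) (cis (c + \<delta>)) (cis (c + 2 * \<sigma>)) =
      (2 * cos \<delta> * cis c * (cis c * cis (2 * \<sigma>)) - 2 * (cis c * cis c)) /
      (2 * (cis c * cis (2 * \<sigma>)) - 2 * cos \<delta> * cis c)"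
    unfolding circle_reflection_def S mult.assoc P by (simp add: cis_mult)
  also have "\<dots> = (2 * cis c * cis c * (cos \<delta> * cis (2 * \<sigma>) - 1)) / (2 * cis c * (cis (2 * \<sigma>) - cos \<delta>))"
    by (simp add: algebra_simps)
  also have "\<dots> = cis c * (- cis (- (2 * arctan q)))"
    unfolding key[symmetric] using den by simp
  also have "\<dots> = cis (c + pi - 2 * arctan q)"
    by (simp add: cis_mult[symmetric] diff_conv_add_uminus del: add_uminus_conv_diff)
  finally show ?thesis by (simp add: q_def p_def \<tau>_def)
qed

text \<open>The reflection carries the arc to its complement traversed backwards. The complement has
  length \<open>2 * pi - (\<beta> - \<alpha>)\<close>, and this is the drop of
  \<open>G\<close>.\<close>

lemma circle_reflection_lift:
  fixes \<alpha> \<beta> :: real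
  assumes "\<alpha> < \<beta>" "\<beta> < \<alpha> + 2 * pi"
  obtains G where "continuous_on {\<alpha>..\<beta>} G"
    "\<And>x y. \<alpha> \<le> x \<Longrightarrow> x < y \<Longrightarrow> y \<le> \<beta> \<Longrightarrow> G y < G x"
    "\<And>x. x \<in> {\<alpha>..\<beta>} \<Longrightarrow> cis (G x) = circle_reflection (cis \<alpha>) (cis \<beta>) (cis x)"
    "G \<beta> - G \<alpha> = \<beta> - \<alpha> - 2 * pi"
proof -
  define c \<delta> where "c = (\<alpha> + \<beta>) / 2" and "\<delta> = (\<beta> - \<alpha>) / 2"
  have \<delta>: "0 < \<delta>" "\<delta> < pi" using assms by (auto simp: \<delta>_def)
  have ab: "\<alpha> = c - \<delta>" "\<beta> = c + \<delta>" by (auto simp: c_def \<delta>_def field_simps)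
  define \<tau> where "\<tau> = tan (\<delta> / 2)"
  have \<tau>: "\<tau> > 0" unfolding \<tau>_def using \<delta> by (intro tan_gt_zero) auto
  define G where "G = (\<lambda>x. c + pi - 2 * arctan (tan ((x - c) / 2) / \<tau>\<^sup>2))"
  have range: "- (pi / 2) < (x - c) / 2" "(x - c) / 2 < pi / 2" if "x \<in> {\<alpha>..\<beta>}" for x
    using that \<delta> by (auto simp: ab)
  have cos: "cos ((x - c) / 2) \<noteq> 0" if "x \<in> {\<alpha>..\<beta>}" for x
    using cos_gt_zero_pi[OF range[OF that]] by simp
  show ?thesis
  proof (rule that[of G])
    show "continuous_on {\<alpha>..\<beta>} G"
      unfolding G_def using cos \<tau> by (intro continuous_intros) auto
    show "G y < G x" if xy: "\<alpha> \<le> x" "x < y" "y \<le> \<beta>" for x y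
    proof -
      have "tan ((x - c) / 2) < tan ((y - c) / 2)"
        using xy range[of x] range[of y] by (intro tan_monotone) auto
      then show ?thesis using \<tau> by (simp add: G_def arctan_less_iff divide_strict_right_mono)
    qed
    show "cis (G x) = circle_reflection (cis \<alpha>) (cis \<beta>) (cis x)" if "x \<in> {\<alpha>..\<beta>}" for x
    proof -
      have "c + 2 * ((x - c) / 2) = x" by (simp add: field_simps)
      then show ?thesis
        using circle_reflection_cis[OF \<delta> cos[OF that], of c] by (simp only: G_def ab \<tau>_def)
    qed
    have inv: "arctan (1 / \<tau>) = pi / 2 - \<delta> / 2"
    proof (rule arctan_unique)
      show "tan (pi / 2 - \<delta> / 2) = 1 / \<tau>"
        by (simp add: \<tau>_def tan_cot inverse_eq_divide)
    qed (use \<delta> in auto)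
    have "tan \<delta>' / \<tau>\<^sup>2 = 1 / \<tau>" "tan (- \<delta>') / \<tau>\<^sup>2 = - (1 / \<tau>)" if "\<delta>' = \<delta> / 2" for \<delta>'
      using \<tau> by (simp_all add: that flip: \<tau>_def) (simp_all add: power2_eq_square)
    then have "G \<beta> = c + pi - 2 * arctan (1 / \<tau>)" "G \<alpha> = c + pi - 2 * arctan (- (1 / \<tau>))"
      unfolding G_def ab by simp_all
    then show "G \<beta> - G \<alpha> = \<beta> - \<alpha> - 2 * pi"
      unfolding arctan_minus inv by (simp add: ab)
  qed
qed

lemma half_open_arc_cis:
  assumes "\<alpha> < \<beta>" "\<beta> < \<alpha> + 2 * pi"
  shows "half_open_arc (cis \<alpha>) (cis \<beta>) = cis ` {\<alpha>..<\<beta>}"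
proof -
  have A: "Arg2pi (cis x / cis \<alpha>) = x - \<alpha>" if "\<alpha> \<le> x" "x < \<alpha> + 2 * pi" for x
  proof (rule Arg2pi_unique)
    show "complex_of_real 1 * exp (\<i> * complex_of_real (x - \<alpha>)) = cis x / cis \<alpha>"
      unfolding cis_divide by (simp add: cis_conv_exp)
  qed (use that in auto)
  show ?thesis
  proof (intro equalityI subsetI)
    fix z assume z: "z \<in> half_open_arc (cis \<alpha>) (cis \<beta>)"
    then have "z \<in> circle" by (simp add: half_open_arc_def)
    then have "z / cis \<alpha> = cis (Arg2pi (z / cis \<alpha>))"
      using Arg2pi_eq[of "z / cis \<alpha>"] by (simp add: norm_divide cis_conv_exp)
    then have zz: "z = cis (\<alpha> + Arg2pi (z / cis \<alpha>))"
      unfolding cis_mult[symmetric] by (simp add: field_simps)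
    have "Arg2pi (z / cis \<alpha>) < \<beta> - \<alpha>" using z A[of \<beta>] assms by (simp add: half_open_arc_def)
    then show "z \<in> cis ` {\<alpha>..<\<beta>}"
      by (subst zz) (use Arg2pi_ge_0 in \<open>auto intro!: imageI\<close>)
  next
    fix z assume "z \<in> cis ` {\<alpha>..<\<beta>}"
    then show "z \<in> half_open_arc (cis \<alpha>) (cis \<beta>)"
      using A assms by (auto simp: half_open_arc_def)
  qed
qed

section \<open>The geometry of a unimodular partition\<close>

lemma strict_mono_int:
  fixes f :: "int \<Rightarrow> 'a::order"
  assumes "\<And>k. f k < f (k + 1)"
  shows "strict_mono f"
proof (rule strict_monoI)
  fix i j :: int assume "i < j"
  then show "f i < f j"
  proof (induction j rule: int_gr_induct)
    case base
    show ?case by (rule assms)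
  next
    case (step j)
    then show ?case using assms[of j] by order
  qed
qed

locale unimodular_circle =
  fixes m :: nat and t :: "nat \<Rightarrow> int^3"
  assumes partition: "unimodular_partition m t"
begin

abbreviation B :: "complex \<Rightarrow> complex" where
  "B \<equiv> partition_map m t"

text \<open>The vertices are indexed cyclically by the integers, and \<open>angle\<close> is an increasing choice of
  their arguments.\<close>

definition vertex :: "int \<Rightarrow> complex" where
  "vertex k = circle_point (t (nat (k mod int m)))"

definition angle :: "int \<Rightarrow> real" where
  "angle k = Arg (vertex 0) + Arg2pi (vertex k / vertex 0) + 2 * pi * of_int (k div int m)"

lemma m_ge_3: "m \<ge> 3"
  using partition by (simp add: unimodular_partition_def)

lemma index_bounds: "nat (k mod int m) < m"
  using m_ge_3 by (simp add: nat_less_iff)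

lemma pythagorean: "pythagorean_triple (t (nat (k mod int m)))"
  using partition index_bounds by (simp add: unimodular_partition_def)

lemma vertex_in_circle: "vertex k \<in> circle"
  unfolding vertex_def by (rule circle_point_in_circle[OF pythagorean])

lemma cmod_vertex [simp]: "cmod (vertex k) = 1"
  using vertex_in_circle by simp

lemma vertex_nonzero [simp]: "vertex k \<noteq> 0"
  using cmod_vertex[of k] by (metis norm_zero zero_neq_one)

lemma vertex_periodic: "vertex (k + int m * j) = vertex k"
  by (simp add: vertex_def)

lemma angle_periodic: "angle (k + int m * j) = angle k + 2 * pi * of_int j"
  using m_ge_3 unfolding angle_def vertex_periodic by (simp add: algebra_simps)

lemma cis_angle: "cis (angle k) = vertex k"
proof -
  have "cis (Arg (vertex 0)) = vertex 0" by (rule cis_Arg_circle[OF vertex_in_circle])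
  moreover have "cis (Arg2pi (vertex k / vertex 0)) = vertex k / vertex 0"
    using Arg2pi_eq[of "vertex k / vertex 0"] by (simp add: norm_divide cis_conv_exp)
  moreover have "cis (2 * pi * of_int (k div int m)) = 1"
    using cis_eq_iff_int[of "2 * pi * of_int (k div int m)" 0] by auto
  ultimately show ?thesis unfolding angle_def cis_mult[symmetric] by simp
qed

lemma index_Suc: "nat ((k + 1) mod int m) = Suc (nat (k mod int m)) mod m"
proof -
  have "(k + 1) mod int m = (k mod int m + 1) mod int m" by (simp add: mod_add_left_eq)
  also have "\<dots> = int (Suc (nat (k mod int m)) mod m)" using m_ge_3 by (simp add: zmod_int add.commute)
  finally show ?thesis by simp
qed

lemma angle_less_Suc: "angle k < angle (k + 1)"
proof (cases "Suc (nat (k mod int m)) < m")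
  case True
  have q: "int m * (k div int m) + k mod int m = k" by simp
  have r: "0 \<le> k mod int m" "k mod int m + 1 < int m" using True m_ge_3 by auto
  have "(k + 1) div int m = k div int m"
    by (rule int_div_pos_eq[of _ _ _ "k mod int m + 1"]) (use q r in auto)
  moreover have "Arg2pi (vertex k / vertex 0) < Arg2pi (vertex (k + 1) / vertex 0)"
  proof -
    have "strict_mono_on {..<m} (\<lambda>a. Arg2pi (circle_point (t a) / circle_point (t 0)))"
      using partition by (simp add: unimodular_partition_def ccw_ordered_def)
    then show ?thesis
      using True index_bounds[of k] unfolding vertex_def index_Suc by (auto simp: strict_mono_on_def)
  qed
  ultimately show ?thesis by (simp add: angle_def)
next
  \<comment> \<open>At the last vertex of a turn \<open>Arg2pi\<close> falls back to 0 while
    \<open>k div int m\<close> rises by one; since \<open>Arg2pi\<close> stays below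
    \<open>2 * pi\<close>, the angle still increases.\<close>
  case False
  then have r: "k mod int m = int m - 1" using index_bounds[of k] m_ge_3 by auto
  have "int m * (k div int m) + k mod int m = k" by simp
  then have k: "k + 1 = 0 + int m * (k div int m + 1)" using r by (simp add: algebra_simps)
  have "vertex (k + 1) = vertex 0" using vertex_periodic[of 0] by (simp only: k)
  moreover have "(k + 1) div int m = k div int m + 1"
    using m_ge_3 by (subst k) simp
  moreover have "Arg2pi (1::complex) = 0" using Arg2pi_of_real[of 1] by simp
  ultimately show ?thesis
    using Arg2pi_lt_2pi[of "vertex k / vertex 0"] by (simp add: angle_def algebra_simps)
qed

lemma strict_mono_angle: "strict_mono angle"
  by (rule strict_mono_int) (rule angle_less_Suc)

lemma angle_less_iff [simp]: "angle i < angle j \<longleftrightarrow> i < j"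
  by (rule strict_mono_less[OF strict_mono_angle])

lemma angle_Suc_less: "angle (k + 1) < angle k + 2 * pi"
  using angle_periodic[of k 1] angle_less_iff[of "k + 1" "k + int m"] m_ge_3 by simp

lemma angle_arc_exists: "\<exists>k. x \<in> {angle k..<angle (k + 1)}"
proof -
  define j where "j = \<lfloor>(x - angle 0) / (2 * pi)\<rfloor>"
  have "of_int j \<le> (x - angle 0) / (2 * pi)" "(x - angle 0) / (2 * pi) < of_int j + 1"
    unfolding j_def by linarith+
  then have "angle 0 + 2 * pi * of_int j \<le> x" "x < angle 0 + 2 * pi * of_int (j + 1)"
    by (simp_all add: field_simps)
  then have lo: "angle (int m * j) \<le> x" and hi: "x < angle (int m * j + int m)"
    using angle_periodic[of 0 j] angle_periodic[of 0 "j + 1"] by (simp_all add: algebra_simps)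
  define n where "n = (LEAST n. x < angle (int m * j + int n))"
  have n: "x < angle (int m * j + int n)" unfolding n_def by (rule LeastI) (rule hi)
  then have "n \<noteq> 0" using lo by (intro notI) simp
  moreover have "\<not> x < angle (int m * j + int (n - 1))"
    using not_less_Least[of "n - 1" "\<lambda>n. x < angle (int m * j + int n)"] \<open>n \<noteq> 0\<close> by (auto simp: n_def)
  ultimately show ?thesis
    using n by (intro exI[of _ "int m * j + int (n - 1)"]) (auto simp: of_nat_diff algebra_simps)
qed

lemma vertex_Suc_neq: "vertex k \<noteq> vertex (k + 1)"
proof
  assume "vertex k = vertex (k + 1)"
  then have "cis (angle (k + 1)) = cis (angle k)" by (simp add: cis_angle)
  then obtain n :: int where n: "angle (k + 1) = angle k + 2 * pi * n" using cis_eq_iff_int by blast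
  then have "0 < 2 * pi * real_of_int n" "2 * pi * real_of_int n < 2 * pi * 1"
    using angle_less_Suc[of k] angle_Suc_less[of k] by auto
  then have "0 < n" "real_of_int n < 1" using pi_gt_zero by (auto simp: zero_less_mult_iff)
  then show False by linarith
qed

text \<open>At the right end of the arc \<open>B\<close> is defined by the next reflection, but both
  reflections fix the common vertex. The closed arcs are what the proof of continuity glues
  together.\<close>

lemma partition_map_cis:
  assumes "x \<in> {angle k..angle (k + 1)}"
  shows "B (cis x) = circle_reflection (vertex k) (vertex (k + 1)) (cis x)"
proof -
  have half_open: "B (cis x) = circle_reflection (vertex k) (vertex (k + 1)) (cis x)"
    if "x \<in> {angle k..<angle (k + 1)}" for k x
  proof -
    have e: "vertex (k + 1) = circle_point (t (Suc (nat (k mod int m)) mod m))"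
      "vertex k = circle_point (t (nat (k mod int m)))"
      unfolding vertex_def index_Suc by auto
    have "partition_arc m t (nat (k mod int m)) = cis ` {angle k..<angle (k + 1)}"
      unfolding partition_arc_def e[symmetric]
      using half_open_arc_cis[OF angle_less_Suc angle_Suc_less] by (simp add: cis_angle)
    then have "cis x \<in> partition_arc m t (nat (k mod int m))" using that by blast
    then show ?thesis using partition_map_on_arc[OF partition index_bounds] e by metis
  qed
  show ?thesis
  proof (cases "x = angle (k + 1)")
    case True
    have "B (vertex (k + 1)) = vertex (k + 1)"
      using half_open[of "angle (k + 1)" "k + 1"] angle_less_Suc[of "k + 1"]
        circle_reflection_fixed_iff[OF vertex_in_circle vertex_in_circle vertex_Suc_neq, of "vertex (k + 1)" "k + 1"]
      by (simp add: cis_angle)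
    moreover have "circle_reflection (vertex k) (vertex (k + 1)) (vertex (k + 1)) = vertex (k + 1)"
      using circle_reflection_fixed_iff[OF vertex_in_circle vertex_in_circle vertex_Suc_neq, of "vertex (k + 1)" k]
      by simp
    ultimately show ?thesis using True by (simp add: cis_angle)
  next
    case False
    then show ?thesis using assms half_open by auto
  qed
qed

lemma circle_arc_cases:
  assumes "z \<in> circle"
  obtains k x where "x \<in> {angle k..<angle (k + 1)}" "z = cis x"
    "B z = circle_reflection (vertex k) (vertex (k + 1)) z"
proof -
  obtain x where x: "z = cis x" using circle_cis[OF assms] by blast
  obtain k where k: "x \<in> {angle k..<angle (k + 1)}" using angle_arc_exists by blast
  show ?thesis using that[OF k x] partition_map_cis[of x k] k x by simp
qed

lemma partition_map_in_circle:
  assumes "z \<in> circle"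
  shows "B z \<in> circle"
proof -
  obtain k where "B z = circle_reflection (vertex k) (vertex (k + 1)) z"
    using circle_arc_cases[OF assms] by metis
  then show ?thesis
    using circle_reflection_in_circle[OF vertex_in_circle vertex_in_circle vertex_Suc_neq assms] by metis
qed

lemma funpow_in_circle: "z \<in> circle \<Longrightarrow> (B ^^ n) z \<in> circle"
  by (induction n) (use partition_map_in_circle in auto)

lemma partition_map_fixed_iff:
  assumes "z \<in> circle"
  shows "B z = z \<longleftrightarrow> z \<in> range vertex"
proof
  assume "B z = z"
  then show "z \<in> range vertex"
    using circle_arc_cases[OF assms]
      circle_reflection_fixed_iff[OF vertex_in_circle vertex_in_circle vertex_Suc_neq assms] by (metis rangeI)
next
  assume "z \<in> range vertex"
  then obtain k where "z = vertex k" by auto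
  then show "B z = z"
    using partition_map_cis[of "angle k" k] angle_less_Suc[of k]
      circle_reflection_fixed_iff[OF vertex_in_circle vertex_in_circle vertex_Suc_neq, of "vertex k" k]
    by (simp add: cis_angle)
qed

lemma continuous_on_partition_map: "continuous_on circle B"
proof -
  define C where "C = (\<lambda>a::nat. cis ` {angle (int a)..angle (int a + 1)})"
  have "circle = (\<Union>a\<in>{..<m}. C a)"
  proof (intro equalityI subsetI)
    fix z :: complex assume "z \<in> circle"
    then obtain k x where kx: "x \<in> {angle k..<angle (k + 1)}" "z = cis x"
      using circle_arc_cases by metis
    define q where "q = k div int m"
    have k: "int (nat (k mod int m)) = k + int m * (- q)"
      using m_ge_3 by (simp add: q_def minus_mult_div_eq_mod)
    have "z = cis (x + 2 * pi * of_int (- q))"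
      unfolding kx(2) cis_eq_iff_int by (intro exI[of _ q]) simp
    moreover have "x + 2 * pi * of_int (- q) \<in> {angle (int (nat (k mod int m)))..angle (int (nat (k mod int m)) + 1)}"
      using kx(1) angle_periodic[of k "- q"] angle_periodic[of "k + 1" "- q"] unfolding k
      by (simp add: algebra_simps)
    ultimately have "z \<in> C (nat (k mod int m))" unfolding C_def by blast
    then show "z \<in> (\<Union>a\<in>{..<m}. C a)" using index_bounds by blast
  qed (auto simp: C_def)
  moreover have "continuous_on (\<Union>a\<in>{..<m}. C a) B"
  proof (rule continuous_on_closed_Union)
    fix a assume "a \<in> {..<m}"
    show "closed (C a)" unfolding C_def
      by (intro compact_imp_closed compact_continuous_image continuous_intros) auto
    have "continuous_on (C a) (circle_reflection (vertex (int a)) (vertex (int a + 1)))"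
      unfolding circle_reflection_def
      by (intro continuous_intros ballI circle_reflection_denominator[OF vertex_in_circle vertex_in_circle vertex_Suc_neq])
        (auto simp: C_def)
    then show "continuous_on (C a) B"
      by (rule continuous_on_eq) (auto simp: C_def partition_map_cis)
  qed auto
  ultimately show ?thesis by simp
qed

lemma continuous_on_funpow: "continuous_on circle (B ^^ n)"
proof (induction n)
  case (Suc n)
  show ?case unfolding funpow.simps comp_def
    by (rule continuous_on_compose2[OF continuous_on_partition_map Suc]) (use funpow_in_circle in blast)
qed (auto simp: continuous_on_id)

section \<open>Integral normals of the arcs and the signs of pairings with them\<close>

definition arc_normal :: "int \<Rightarrow> complex \<times> real" where
  "arc_normal k = edge (vertex k) (vertex (k + 1))"

text \<open>This is the pythagorean triple itself,
  \<open>(t\<^sub>1 + t\<^sub>2 \<i>, t\<^sub>3)\<close>. Written as a positive multiple of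
  \<open>hat (vertex k)\<close>, it has pairings of the same sign as that vector, and it is integral
  as well.\<close>

definition vertex_vec :: "int \<Rightarrow> complex \<times> real" where
  "vertex_vec k = real_of_int (vec_nth (t (nat (k mod int m))) 3) *\<^sub>R hat (vertex k)"

lemma height_pos: "real_of_int (vec_nth (t (nat (k mod int m))) 3) > 0"
  using pythagorean[of k] by (simp add: pythagorean_triple_def)

lemma arc_normal_in_int_lattice: "arc_normal k \<in> int_lattice"
proof -
  have e: "vertex (k + 1) = circle_point (t (Suc (nat (k mod int m)) mod m))"
      "vertex k = circle_point (t (nat (k mod int m)))"
    unfolding vertex_def index_Suc by auto
  have "unimodular_arc (t (nat (k mod int m))) (t (Suc (nat (k mod int m)) mod m))"
    using partition index_bounds[of k] by (simp add: unimodular_partition_def)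
  then show ?thesis unfolding arc_normal_def e
    using vertex_Suc_neq[of k] pythagorean[of k] pythagorean[of "k + 1"] unfolding e index_Suc
    by (intro edge_in_lattice)
qed

lemma vertex_vec_in_int_lattice: "vertex_vec k \<in> int_lattice"
proof -
  define s where "s = t (nat (k mod int m))"
  have "vec_nth s 3 > 0" using height_pos[of k] by (simp add: s_def)
  then have "vertex_vec k = (of_int (vec_nth s 1) + of_int (vec_nth s 2) * \<i>, of_int (vec_nth s 3))"
    unfolding vertex_vec_def hat_def vertex_def circle_point_def s_def[symmetric]
    by (simp add: scaleR_conv_of_real)
  then show ?thesis by (simp add: int_lattice_def)
qed

lemma arc_normal_unit: "lform (arc_normal k) (arc_normal k) = 1"
  unfolding arc_normal_def by (rule lform_edge_self[OF vertex_in_circle vertex_in_circle vertex_Suc_neq])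

lemma lform_hat_neg: "z \<in> circle \<Longrightarrow> w \<in> circle \<Longrightarrow> z \<noteq> w \<Longrightarrow> lform (hat z) (hat w) < 0"
  by (simp add: lform_hat_hat)

lemma lform_hat_nonpos: "z \<in> circle \<Longrightarrow> w \<in> circle \<Longrightarrow> lform (hat z) (hat w) \<le> 0"
  by (simp add: lform_hat_hat)

lemma lform_cis_arc_normal_pos:
  assumes "angle k < x" "x < angle (k + 1)"
  shows "lform (hat (cis x)) (arc_normal k) > 0"
  unfolding arc_normal_def cis_angle[symmetric] lform_hat_cis_edge[OF angle_less_Suc angle_Suc_less]
  using assms angle_Suc_less[of k] by (intro divide_pos_pos mult_pos_pos sin_gt_zero) auto

lemma lform_cis_arc_normal_neg:
  assumes "angle (k + 1) < x" "x < angle k + 2 * pi"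
  shows "lform (hat (cis x)) (arc_normal k) < 0"
proof -
  have *: "angle k < x" "x - angle (k + 1) < 2 * pi" using assms angle_less_Suc[of k] by linarith+
  have "2 * sin ((x - angle k) / 2) * sin ((x - angle (k + 1)) / 2) / sin ((angle (k + 1) - angle k) / 2) > 0"
    using * assms angle_Suc_less[of k] by (intro divide_pos_pos mult_pos_pos sin_gt_zero) auto
  moreover have eq: "sin ((angle (k + 1) - x) / 2) = - sin ((x - angle (k + 1)) / 2)"
    by (metis minus_diff_eq minus_divide_left sin_minus)
  ultimately show ?thesis
    unfolding arc_normal_def cis_angle[symmetric] lform_hat_cis_edge[OF angle_less_Suc angle_Suc_less] eq by simp
qed

lemma lform_vertex_arc_normal:
  "lform (hat (vertex k)) (arc_normal k) = 0" "lform (hat (vertex (k + 1))) (arc_normal k) = 0"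
  unfolding arc_normal_def
  using lform_hat_edge_left[OF vertex_in_circle vertex_in_circle vertex_Suc_neq]
    lform_hat_edge_right[OF vertex_in_circle vertex_in_circle vertex_Suc_neq] by auto

lemma lform_vertex_arc_normal_nonpos: "lform (hat (vertex j)) (arc_normal k) \<le> 0"
proof -
  \<comment> \<open>The representative of \<open>j\<close> modulo \<open>m\<close> from
    \<open>k\<close> to \<open>k + m - 1\<close>; its angle lies in the full turn that starts at
    \<open>angle k\<close>.\<close>
  define i where "i = k + (j - k) mod int m"
  have i: "k \<le> i" "i < k + int m" using m_ge_3 by (auto simp: i_def)
  have "j = i + int m * ((j - k) div int m)" by (simp add: i_def)
  then have ji: "vertex j = vertex i" using vertex_periodic by metis
  show ?thesis
  proof (cases "i \<le> k + 1")
    case True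
    then have "i = k \<or> i = k + 1" using i by linarith
    then show ?thesis unfolding ji using lform_vertex_arc_normal[of k] by auto
  next
    case False
    have "angle i < angle k + 2 * pi" using angle_periodic[of k 1] angle_less_iff[of i "k + int m"] i by simp
    then show ?thesis using False lform_cis_arc_normal_neg[of k "angle i"] by (simp add: ji cis_angle)
  qed
qed

text \<open>Since \<open>m\<close> is at least 3, the vertex \<open>k + 2\<close> is neither end of
  the arc. This one strict inequality puts \<open>center\<close> strictly on the negative side of
  every arc normal.\<close>

lemma lform_vertex_arc_normal_neg: "lform (hat (vertex (k + 2))) (arc_normal k) < 0"
  using lform_cis_arc_normal_neg[of k "angle (k + 2)"] angle_periodic[of k 1] angle_less_iff[of "k + 2" "k + int m"] m_ge_3
  by (simp add: cis_angle)

text \<open>The sign of the pairing identifies the arc without reference to angles. The condition is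
  open, so one reflection describes \<open>B\<close> near such a point.\<close>

lemma partition_map_of_pos:
  assumes "z \<in> circle" "lform (hat z) (arc_normal k) > 0"
  shows "B z = circle_reflection (vertex k) (vertex (k + 1)) z"
proof -
  obtain y where y: "z = cis y" using circle_cis assms(1) by blast
  define n where "n = \<lfloor>(y - angle k) / (2 * pi)\<rfloor>"
  define x where "x = y - 2 * pi * of_int n"
  have "of_int n \<le> (y - angle k) / (2 * pi)" "(y - angle k) / (2 * pi) < of_int n + 1"
    unfolding n_def by linarith+
  then have x: "angle k \<le> x" "x < angle k + 2 * pi" by (simp_all add: x_def field_simps)
  have z: "z = cis x" unfolding y cis_eq_iff_int x_def by (intro exI[of _ n]) simp
  have "x \<le> angle (k + 1)"
    using lform_cis_arc_normal_neg[of k x] x(2) assms(2) z by force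
  then show ?thesis using partition_map_cis[of x k] x z by simp
qed

lemma nonvertex_arc:
  assumes z: "z \<in> circle" and nv: "z \<notin> range vertex"
  obtains k where "lform (hat z) (arc_normal k) > 0"
proof -
  obtain k x where kx: "x \<in> {angle k..<angle (k + 1)}" "z = cis x" using circle_arc_cases[OF z] by metis
  then have "x \<noteq> angle k" using nv by (auto simp: cis_angle)
  then show ?thesis using that lform_cis_arc_normal_pos[of k x] kx by auto
qed

lemma lreflect_arc_normal:
  assumes z: "z \<in> circle" and k: "B z = circle_reflection (vertex k) (vertex (k + 1)) z"
  obtains \<mu> where "\<mu> > 0" "lreflect (arc_normal k) (hat z) = \<mu> *\<^sub>R hat (B z)"
proof -
  let ?\<mu> = "(cmod (2 * z - (vertex k + vertex (k + 1))))\<^sup>2 / (cmod (vertex k - vertex (k + 1)))\<^sup>2"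
  have "?\<mu> > 0"
    using circle_reflection_denominator[OF vertex_in_circle vertex_in_circle vertex_Suc_neq z] vertex_Suc_neq[of k]
    by (intro divide_pos_pos zero_less_power) auto
  then show ?thesis
    using that lreflect_hat[OF vertex_in_circle vertex_in_circle vertex_Suc_neq z] unfolding arc_normal_def k by metis
qed

text \<open>A vector inside the cone over the ideal polygon: it lies on the same side of every edge, so
  reflecting from an arc into the complementary one decreases the pairing with it.\<close>

definition center :: "complex \<times> real" where
  "center = (\<Sum>a<m. vertex_vec (int a))"

lemma center_in_int_lattice: "center \<in> int_lattice"
  unfolding center_def by (rule int_lattice_sum) (rule vertex_vec_in_int_lattice)

lemma lform_vertex_vec: "lform x (vertex_vec k) = real_of_int (vec_nth (t (nat (k mod int m))) 3) * lform x (hat (vertex k))"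
  by (simp add: vertex_vec_def)

lemma vertex_vec_mod: "vertex_vec (int (nat (k mod int m))) = vertex_vec k"
  using m_ge_3 by (simp add: vertex_vec_def vertex_def)

lemma lform_arc_normal_center: "lform (arc_normal k) center < 0"
proof -
  have np: "lform (arc_normal k) (vertex_vec j) \<le> 0" for j
    unfolding lform_vertex_vec using height_pos[of j] lform_vertex_arc_normal_nonpos[of j k]
    by (simp add: lform_commute mult_nonneg_nonpos)
  let ?a = "nat ((k + 2) mod int m)"
  have "lform (arc_normal k) (vertex_vec (int ?a)) < 0"
    unfolding vertex_vec_mod lform_vertex_vec using height_pos[of "k + 2"] lform_vertex_arc_normal_neg[of k]
    by (simp add: lform_commute mult_pos_neg)
  then have "(\<Sum>a<m. lform (arc_normal k) (vertex_vec (int a))) < (\<Sum>a<m. 0)"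
    using np index_bounds[of "k + 2"] by (intro sum_strict_mono_ex1 bexI[of _ ?a]) auto
  then show ?thesis unfolding center_def lform_sum_right by simp
qed

end

section \<open>Gaussian rationals and quadratic points\<close>

lemma gaussian_rationals_of_int [simp]: "of_int n \<in> gaussian_rationals"
  by (simp add: gaussian_rationals_def)

lemma gaussian_rationals_simps [simp]:
  "0 \<in> gaussian_rationals" "1 \<in> gaussian_rationals" "\<i> \<in> gaussian_rationals"
  "numeral k \<in> gaussian_rationals"
  by (auto simp: gaussian_rationals_def)

lemma gaussian_rationals_intros [intro]:
  assumes "a \<in> gaussian_rationals" "b \<in> gaussian_rationals"
  shows "a + b \<in> gaussian_rationals" "a - b \<in> gaussian_rationals" "a * b \<in> gaussian_rationals"
    "a / b \<in> gaussian_rationals"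
  using assms by (auto simp: gaussian_rationals_def Re_divide Im_divide intro!: Rats_divide Rats_add Rats_diff Rats_mult Rats_power)

lemma gaussian_rationals_cnj: "a \<in> gaussian_rationals \<Longrightarrow> cnj a \<in> gaussian_rationals"
  by (auto simp: gaussian_rationals_def)

lemma circle_point_gaussian: "circle_point s \<in> gaussian_rationals"
  unfolding circle_point_def by (intro gaussian_rationals_intros gaussian_rationals_of_int gaussian_rationals_simps)

lemma Ints_imp_gaussian:
  assumes "x \<in> int_lattice"
  shows "fst x \<in> gaussian_rationals" "complex_of_real (snd x) \<in> gaussian_rationals"
  using assms Ints_subset_Rats by (auto simp: int_lattice_def gaussian_rationals_def)

lemma common_denominator3:
  assumes "p \<in> \<rat>" "q \<in> \<rat>" "r \<in> \<rat>"
  obtains d :: real where "d > 0" "d * p \<in> \<int>" "d * q \<in> \<int>" "d * r \<in> \<int>"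
proof -
  obtain a1 b1 :: int where 1: "b1 > 0" "p = of_int a1 / of_int b1" using Rats_cases'[OF assms(1)] by metis
  obtain a2 b2 :: int where 2: "b2 > 0" "q = of_int a2 / of_int b2" using Rats_cases'[OF assms(2)] by metis
  obtain a3 b3 :: int where 3: "b3 > 0" "r = of_int a3 / of_int b3" using Rats_cases'[OF assms(3)] by metis
  define d :: real where "d = of_int b1 * of_int b2 * of_int b3"
  have "d * p = of_int (a1 * b2 * b3)" "d * q = of_int (b1 * a2 * b3)" "d * r = of_int (b1 * b2 * a3)"
    using 1 2 3 by (simp_all add: d_def)
  then have "d * p \<in> \<int>" "d * q \<in> \<int>" "d * r \<in> \<int>" by (metis Ints_of_int)+
  moreover have "d > 0" using 1 2 3 by (simp add: d_def)
  ultimately show ?thesis using that by blast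
qed

lemma gaussian_imp_lattice_ray:
  assumes "z \<in> gaussian_rationals"
  obtains r where "r > 0" "r *\<^sub>R hat z \<in> int_lattice"
proof -
  obtain d where d: "d > 0" "d * Re z \<in> \<int>" "d * Im z \<in> \<int>" "d * 1 \<in> \<int>"
    using common_denominator3[of "Re z" "Im z" 1] assms by (auto simp: gaussian_rationals_def)
  then have "d *\<^sub>R hat z \<in> int_lattice" by (simp add: int_lattice_def hat_def)
  then show ?thesis using that d(1) by blast
qed

text \<open>This is a rational linear relation between \<open>Re z\<close>, \<open>Im z\<close> and \<open>1\<close>.\<close>

definition annihilates :: "complex \<times> real \<Rightarrow> complex \<Rightarrow> bool" where
  "annihilates n z \<longleftrightarrow> n \<in> int_lattice \<and> n \<noteq> 0 \<and> lform n (hat z) = 0"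

text \<open>Since \<open>cnj z = 1 / z\<close> on the circle, the real linear relation becomes this
  equation after multiplication by \<open>2 * z\<close>.\<close>

lemma annihilates_quadratic:
  assumes "z \<in> circle" "lform n (hat z) = 0"
  shows "cnj (fst n) * z\<^sup>2 - 2 * of_real (snd n) * z + fst n = 0"
proof -
  have z: "z \<noteq> 0" using assms(1) by auto
  have "0 = complex_of_real (lform n (hat z))" using assms by simp
  also have "\<dots> = (fst n * (1 / z) + cnj (fst n) * z) / 2 - of_real (snd n)"
    unfolding lform_complex by (simp add: hat_def cnj_circle[OF assms(1)])
  finally have "(fst n * (1 / z) + cnj (fst n) * z) = 2 * of_real (snd n)" by simp
  then have "(fst n * (1 / z) + cnj (fst n) * z) * z = 2 * of_real (snd n) * z" by simp
  then show ?thesis using z by (simp add: algebra_simps power2_eq_square)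
qed

lemma annihilates_fst_nonzero:
  assumes "z \<in> circle" "annihilates n z"
  shows "fst n \<noteq> 0"
proof
  assume "fst n = 0"
  then have "snd n = 0" using assms(2) by (simp add: annihilates_def lform_def hat_def)
  with \<open>fst n = 0\<close> have "n = 0" by (simp add: prod_eq_iff)
  then show False using assms(2) by (simp add: annihilates_def)
qed

lemma finite_annihilated: "finite {z \<in> circle. annihilates n z}"
proof (cases "\<exists>w \<in> circle. annihilates n w")
  case True
  then have nz: "fst n \<noteq> 0" using annihilates_fst_nonzero by blast
  have "finite {z. poly [:fst n, - 2 * of_real (snd n), cnj (fst n):] z = 0}"
    using nz by (intro poly_roots_finite) auto
  moreover have "{z \<in> circle. annihilates n z} \<subseteq> {z. poly [:fst n, - 2 * of_real (snd n), cnj (fst n):] z = 0}"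
  proof
    fix z assume "z \<in> {z \<in> circle. annihilates n z}"
    then have "cnj (fst n) * z\<^sup>2 - 2 * of_real (snd n) * z + fst n = 0"
      by (intro annihilates_quadratic) (auto simp: annihilates_def)
    moreover have "poly [:fst n, - 2 * of_real (snd n), cnj (fst n):] z =
        cnj (fst n) * z\<^sup>2 - 2 * of_real (snd n) * z + fst n"
      by (simp add: power2_eq_square algebra_simps)
    ultimately show "z \<in> {z. poly [:fst n, - 2 * of_real (snd n), cnj (fst n):] z = 0}" by simp
  qed
  ultimately show ?thesis by (rule rev_finite_subset)
next
  case False
  then have "{z \<in> circle. annihilates n z} = {}" by blast
  then show ?thesis by (simp only: finite.emptyI)
qed

text \<open>The two endpoints of a rational geodesic have a rational sum.\<close>

lemma annihilates_two_points:
  assumes z: "z \<in> circle" and v: "v \<in> circle" and n: "annihilates n z" "annihilates n v"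
    and vg: "v \<in> gaussian_rationals"
  shows "z \<in> gaussian_rationals"
proof (cases "z = v")
  case False
  have nz: "cnj (fst n) \<noteq> 0" using annihilates_fst_nonzero[OF z n(1)] by simp
  have "cnj (fst n) * z\<^sup>2 - 2 * of_real (snd n) * z + fst n = 0"
    "cnj (fst n) * v\<^sup>2 - 2 * of_real (snd n) * v + fst n = 0"
    using annihilates_quadratic z v n by (auto simp: annihilates_def)
  moreover have "(z - v) * (cnj (fst n) * (z + v) - 2 * of_real (snd n)) =
      (cnj (fst n) * z\<^sup>2 - 2 * of_real (snd n) * z + fst n) - (cnj (fst n) * v\<^sup>2 - 2 * of_real (snd n) * v + fst n)"
    by (simp add: algebra_simps power2_eq_square)
  ultimately have "(z - v) * (cnj (fst n) * (z + v) - 2 * of_real (snd n)) = 0" by simp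
  then have "cnj (fst n) * (z + v) = 2 * of_real (snd n)" using False by simp
  then have "z = 2 * of_real (snd n) / cnj (fst n) - v" using nz by (simp add: field_simps)
  moreover have "n \<in> int_lattice" using n by (simp add: annihilates_def)
  ultimately show ?thesis
    using Ints_imp_gaussian[of n] vg gaussian_rationals_cnj gaussian_rationals_simps
    by (metis gaussian_rationals_intros(2,3,4))
qed (use vg in simp)

lemma degree_le2_points_iff_poly:
  "z \<in> degree_le2_points \<longleftrightarrow> z \<in> circle \<and>
     (\<exists>p. p \<noteq> 0 \<and> (\<forall>i. poly.coeff p i \<in> gaussian_rationals) \<and> poly p z = 0 \<and> Polynomial.degree p \<le> 2)"
proof -
  define P where "P = (\<lambda>d. \<exists>p. p \<noteq> 0 \<and> (\<forall>i. poly.coeff p i \<in> gaussian_rationals) \<and> poly p z = 0 \<and> Polynomial.degree p = d)"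
  have deg: "degree_over gaussian_rationals z = (LEAST d. P d)" by (simp add: degree_over_def P_def)
  have alg: "algebraic_over gaussian_rationals z \<longleftrightarrow> (\<exists>d. P d)" by (auto simp: algebraic_over_def P_def)
  have "algebraic_over gaussian_rationals z \<and> degree_over gaussian_rationals z \<le> 2 \<longleftrightarrow> (\<exists>d\<le>2. P d)"
    unfolding deg alg
  proof (intro iffI conjI)
    assume "(\<exists>d. P d) \<and> (LEAST d. P d) \<le> 2"
    then show "\<exists>d\<le>2. P d" using LeastI_ex[of P] by blast
  next
    assume "\<exists>d\<le>2. P d"
    then obtain d where "d \<le> 2" "P d" by blast
    then show "(LEAST d. P d) \<le> 2" using Least_le[of P d] by linarith
  qed blast
  also have "\<dots> \<longleftrightarrow> (\<exists>p. p \<noteq> 0 \<and> (\<forall>i. poly.coeff p i \<in> gaussian_rationals) \<and> poly p z = 0 \<and> Polynomial.degree p \<le> 2)"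
    unfolding P_def by metis
  finally show ?thesis unfolding degree_le2_points_def by blast
qed

lemma degree_le2_pointsI:
  assumes "z \<in> circle" "a \<in> gaussian_rationals" "b \<in> gaussian_rationals" "c \<in> gaussian_rationals"
    "a \<noteq> 0 \<or> b \<noteq> 0 \<or> c \<noteq> 0" "a * z\<^sup>2 + b * z + c = 0"
  shows "z \<in> degree_le2_points"
  unfolding degree_le2_points_iff_poly
proof (intro conjI exI[of _ "[:c, b, a:]"])
  show "\<forall>i. poly.coeff [:c, b, a:] i \<in> gaussian_rationals"
    using assms by (auto simp: coeff_pCons split: nat.splits)
  show "poly [:c, b, a:] z = 0" using assms(6) by (simp add: algebra_simps power2_eq_square)
qed (use assms in auto)

text \<open>One direction is \<open>annihilates_quadratic\<close>. For the other, an equation of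
  degree at most 2 is split into real and imaginary part, and a nontrivial one of the two, cleared
  of denominators, is the required integral vector.\<close>

lemma degree_le2_points_iff:
  "z \<in> degree_le2_points \<longleftrightarrow> z \<in> circle \<and> (\<exists>n. annihilates n z)"
proof
  assume "z \<in> circle \<and> (\<exists>n. annihilates n z)"
  then obtain n where n: "z \<in> circle" "annihilates n z" by blast
  then have "n \<in> int_lattice" by (simp add: annihilates_def)
  note g = Ints_imp_gaussian[OF this]
  show "z \<in> degree_le2_points"
  proof (rule degree_le2_pointsI[OF n(1)])
    show "cnj (fst n) \<in> gaussian_rationals" using g gaussian_rationals_cnj by blast
    have "0 - 2 * complex_of_real (snd n) \<in> gaussian_rationals"
      by (intro gaussian_rationals_intros gaussian_rationals_simps g)
    then show "- 2 * complex_of_real (snd n) \<in> gaussian_rationals" by simp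
    show "fst n \<in> gaussian_rationals" by (rule g)
    show "cnj (fst n) * z\<^sup>2 + - 2 * complex_of_real (snd n) * z + fst n = 0"
      using annihilates_quadratic[OF n(1)] n(2) by (simp add: annihilates_def)
  qed (use annihilates_fst_nonzero[OF n] in simp)
next
  assume "z \<in> degree_le2_points"
  then obtain p where z: "z \<in> circle" and p: "p \<noteq> 0" "\<And>i. poly.coeff p i \<in> gaussian_rationals" "poly p z = 0"
    "Polynomial.degree p \<le> 2" unfolding degree_le2_points_iff_poly by blast
  define a b c where "a = poly.coeff p 2" and "b = poly.coeff p 1" and "c = poly.coeff p 0"
  have "p = [:c, b, a:]"
  proof (rule poly_eqI)
    fix i :: nat
    consider "i = 0" | "i = 1" | "i = 2" | "i > 2" by linarith
    then show "poly.coeff p i = poly.coeff [:c, b, a:] i"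
      using p(4) by cases (auto simp: a_def b_def c_def coeff_eq_0 numeral_2_eq_2 coeff_pCons split: nat.splits)
  qed
  then have eq: "a * z\<^sup>2 + b * z + c = 0" and nz: "a \<noteq> 0 \<or> b \<noteq> 0 \<or> c \<noteq> 0"
    using p(1,3) by (auto simp: algebra_simps power2_eq_square)
  have rat: "Re a \<in> \<rat>" "Im a \<in> \<rat>" "Re b \<in> \<rat>" "Im b \<in> \<rat>" "Re c \<in> \<rat>" "Im c \<in> \<rat>"
    using p(2) by (auto simp: a_def b_def c_def gaussian_rationals_def)
  have z0: "z \<noteq> 0" using z by auto
  \<comment> \<open>Dividing by \<open>z\<close> turns the quadratic equation into two rational linear relations.\<close>
  have "a * z + b + c * cnj z = (a * z\<^sup>2 + b * z + c) / z"
    using z0 by (simp add: cnj_circle[OF z] field_simps power2_eq_square)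
  then have lin: "a * z + b + c * cnj z = 0" using eq by simp
  have re: "(Re a + Re c) * Re z + (Im c - Im a) * Im z + Re b = 0"
    using arg_cong[OF lin, of Re] by (simp add: algebra_simps)
  have im: "(Im a + Im c) * Re z + (Re a - Re c) * Im z + Im b = 0"
    using arg_cong[OF lin, of Im] by (simp add: algebra_simps)
  have build: "\<exists>n. annihilates n z"
    if pqr: "p \<in> \<rat>" "q \<in> \<rat>" "r \<in> \<rat>" "p * Re z + q * Im z + r = 0" "p \<noteq> 0 \<or> q \<noteq> 0 \<or> r \<noteq> 0" for p q r
  proof -
    obtain d where d: "d > 0" "d * p \<in> \<int>" "d * q \<in> \<int>" "d * r \<in> \<int>"
      using common_denominator3 pqr(1-3) by metis
    have "d * p * Re z + d * q * Im z + d * r = d * (p * Re z + q * Im z + r)" by (simp add: algebra_simps)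
    then have "annihilates (Complex (d * p) (d * q), - (d * r)) z"
      using d pqr(4,5) by (auto simp: annihilates_def int_lattice_def lform_def hat_def inner_complex_def prod_eq_iff complex_eq_iff)
    then show ?thesis by blast
  qed
  \<comment> \<open>If both relations were trivial, the sums and differences of the parts of
    \<open>a\<close> and \<open>c\<close> would vanish together with \<open>b\<close>, hence all
    three coefficients.\<close>
  have "(Re a + Re c \<noteq> 0 \<or> Im c - Im a \<noteq> 0 \<or> Re b \<noteq> 0) \<or> (Im a + Im c \<noteq> 0 \<or> Re a - Re c \<noteq> 0 \<or> Im b \<noteq> 0)"
    using nz by (auto simp: complex_eq_iff)
  then have "\<exists>n. annihilates n z"
  proof
    assume "Re a + Re c \<noteq> 0 \<or> Im c - Im a \<noteq> 0 \<or> Re b \<noteq> 0"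
    with rat show ?thesis by (intro build[OF _ _ _ re]) auto
  next
    assume "Im a + Im c \<noteq> 0 \<or> Re a - Re c \<noteq> 0 \<or> Im b \<noteq> 0"
    with rat show ?thesis by (intro build[OF _ _ _ im]) auto
  qed
  then show "z \<in> circle \<and> (\<exists>n. annihilates n z)" using z by blast
qed

lemma lform_nondegenerate:
  assumes "\<And>y. lform x y = lform x' y"
  shows "x = x'"
proof -
  define d where "d = x - x'"
  \<comment> \<open>Flipping the last coordinate turns the pairing into the squared Euclidean length
    of \<open>d\<close>.\<close>
  have "lform d (fst d, - snd d) = 0" using assms by (simp add: d_def)
  then have "fst d \<bullet> fst d + snd d * snd d = 0" by (simp add: lform_def)
  moreover have "fst d \<bullet> fst d \<ge> 0" "snd d * snd d \<ge> 0" by auto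
  ultimately have "fst d \<bullet> fst d = 0" "snd d * snd d = 0" by linarith+
  then show ?thesis by (simp add: d_def prod_eq_iff)
qed

lemma lform_lreflect_adjoint: "lform (lreflect w x) y = lform x (lreflect w y)"
  by (simp add: lreflect_def lform_commute[of w y])

lemma lreflect_involution: "lform w w = 1 \<Longrightarrow> lreflect w (lreflect w x) = x"
  by (simp add: lreflect_def scaleR_diff_left[symmetric] algebra_simps)

lemma Ints_le_minus_1:
  fixes x y :: real
  assumes "x \<in> \<int>" "y \<in> \<int>" "x < y"
  shows "x \<le> y - 1"
proof -
  obtain i j where "x = of_int i" "y = of_int j" using assms(1,2) by (auto elim!: Ints_cases)
  then show ?thesis using assms(3) by simp
qed

section \<open>Descent\<close>

context unimodular_circle
begin

lemma vertex_gaussian: "vertex k \<in> gaussian_rationals"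
  unfolding vertex_def by (rule circle_point_gaussian)

lemma partition_map_gaussian_iff:
  assumes z: "z \<in> circle"
  shows "B z \<in> gaussian_rationals \<longleftrightarrow> z \<in> gaussian_rationals"
proof -
  obtain k where k: "B z = circle_reflection (vertex k) (vertex (k + 1)) z" using circle_arc_cases[OF z] by metis
  have refl: "circle_reflection (vertex k) (vertex (k + 1)) y \<in> gaussian_rationals" if "y \<in> gaussian_rationals" for y
    unfolding circle_reflection_def using that
    by (intro gaussian_rationals_intros vertex_gaussian gaussian_rationals_simps)
  have "z = circle_reflection (vertex k) (vertex (k + 1)) (B z)"
    unfolding k using circle_reflection_involution[OF vertex_in_circle vertex_in_circle vertex_Suc_neq z] by simp
  then show ?thesis using refl k by metis
qed

lemma funpow_gaussian_iff: "z \<in> circle \<Longrightarrow> (B ^^ n) z \<in> gaussian_rationals \<longleftrightarrow> z \<in> gaussian_rationals"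
  by (induction n) (simp_all add: partition_map_gaussian_iff[OF funpow_in_circle])

lemma lform_hat_center_nonpos: "z \<in> circle \<Longrightarrow> lform (hat z) center \<le> 0"
  unfolding center_def lform_sum_right lform_vertex_vec
  using lform_hat_nonpos[OF _ vertex_in_circle] height_pos
  by (intro sum_nonpos mult_nonneg_nonpos less_imp_le[OF height_pos]) auto

lemma gaussian_reaches_vertex:
  assumes "z \<in> circle" "z \<in> gaussian_rationals"
  shows "\<exists>n. (B ^^ n) z \<in> range vertex"
proof -
  \<comment> \<open>Induction on a bound for the nonnegative quantity
    \<open>- lform (r *\<^sub>R hat z) center\<close>. The scale \<open>r\<close> is multiplied by
    the factor \<mu> of each reflection, which keeps the vector integral; the quantity is then an
    integer, so each drop is at least 1.\<close>
  have descent: "\<exists>n. (B ^^ n) z \<in> range vertex"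
    if "z \<in> circle" "r > 0" "r *\<^sub>R hat z \<in> int_lattice" "- lform (r *\<^sub>R hat z) center < real N" for z r N
    using that
  proof (induction N arbitrary: z r)
    case 0
    then have "r * lform (hat z) center \<le> 0"
      by (intro mult_nonneg_nonpos lform_hat_center_nonpos) auto
    then show ?case using 0 by simp
  next
    case (Suc N)
    show ?case
    proof (cases "z \<in> range vertex")
      case True
      then show ?thesis by (intro exI[of _ 0]) simp
    next
      case False
      then obtain k where k: "lform (hat z) (arc_normal k) > 0" using nonvertex_arc Suc.prems(1) by metis
      obtain \<mu> where \<mu>: "\<mu> > 0" "lreflect (arc_normal k) (hat z) = \<mu> *\<^sub>R hat (B z)"
        using lreflect_arc_normal[OF Suc.prems(1) partition_map_of_pos[OF Suc.prems(1) k]] by metis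
      let ?x = "r *\<^sub>R hat z" and ?x' = "(r * \<mu>) *\<^sub>R hat (B z)"
      have x': "?x' = lreflect (arc_normal k) ?x"
      proof -
        have "?x' = r *\<^sub>R lreflect (arc_normal k) (hat z)" by (simp add: \<mu>(2))
        also have "\<dots> = lreflect (arc_normal k) ?x" by (simp add: lreflect_def scaleR_diff_right mult_ac)
        finally show ?thesis .
      qed
      have lat: "?x' \<in> int_lattice"
        unfolding x' by (intro lreflect_lattice arc_normal_in_int_lattice Suc.prems(3))
      have "lform ?x' center = lform ?x center - 2 * lform ?x (arc_normal k) * lform (arc_normal k) center"
        unfolding x' by (rule lform_lreflect_right)
      moreover have "lform ?x (arc_normal k) * lform (arc_normal k) center < 0"
        using k Suc.prems(2) lform_arc_normal_center[of k] by (simp add: mult_pos_neg)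
      ultimately have "lform ?x center < lform ?x' center" by linarith
      then have "lform ?x center \<le> lform ?x' center - 1"
        by (intro Ints_le_minus_1 lform_lattice center_in_int_lattice lat Suc.prems(3))
      then have "- lform ?x' center < real N" using Suc.prems(4) by simp
      then obtain n where "(B ^^ n) (B z) \<in> range vertex"
        using Suc.IH[of "B z" "r * \<mu>"] partition_map_in_circle Suc.prems \<mu>(1) lat by auto
      then have "(B ^^ Suc n) z \<in> range vertex" by (simp add: funpow_swap1)
      then show ?thesis by blast
    qed
  qed
  obtain r where r: "r > 0" "r *\<^sub>R hat z \<in> int_lattice" using gaussian_imp_lattice_ray assms(2) by metis
  obtain N :: nat where "- lform (r *\<^sub>R hat z) center < real N" using reals_Archimedean2 by blast
  then show ?thesis using descent assms(1) r by blast
qed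

lemma gaussian_iff_reaches_vertex:
  assumes "z \<in> circle"
  shows "z \<in> gaussian_rationals \<longleftrightarrow> (\<exists>n. (B ^^ n) z \<in> range vertex)"
proof
  assume "\<exists>n. (B ^^ n) z \<in> range vertex"
  then obtain n k where "(B ^^ n) z = vertex k" by blast
  then show "z \<in> gaussian_rationals" using funpow_gaussian_iff[OF assms, of n] vertex_gaussian[of k] by simp
qed (rule gaussian_reaches_vertex[OF assms])

lemma annihilates_step:
  assumes z: "z \<in> circle" and n: "annihilates n z" and k: "B z = circle_reflection (vertex k) (vertex (k + 1)) z"
  shows "annihilates (lreflect (arc_normal k) n) (B z)"
proof -
  obtain \<mu> where \<mu>: "\<mu> > 0" "lreflect (arc_normal k) (hat z) = \<mu> *\<^sub>R hat (B z)"
    using lreflect_arc_normal[OF z k] by metis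
  have "\<mu> * lform (lreflect (arc_normal k) n) (hat (B z)) = lform (lreflect (arc_normal k) n) (lreflect (arc_normal k) (hat z))"
    by (simp add: \<mu>)
  also have "\<dots> = 0" using n by (simp add: lform_lreflect[OF arc_normal_unit] annihilates_def)
  finally have "lform (lreflect (arc_normal k) n) (hat (B z)) = 0" using \<mu>(1) by simp
  moreover have "lreflect (arc_normal k) n \<noteq> 0"
  proof
    assume "lreflect (arc_normal k) n = 0"
    then have "n = lreflect (arc_normal k) 0" using lreflect_involution[OF arc_normal_unit] by metis
    then show False using n by (simp add: lreflect_def annihilates_def)
  qed
  ultimately show ?thesis
    using n lreflect_lattice[OF arc_normal_in_int_lattice] by (simp add: annihilates_def)
qed

text \<open>The reflection is self-adjoint for the form, so it also pulls normals back. This passes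
  quadraticity from a periodic point to the points whose orbits reach it.\<close>

lemma annihilates_back:
  assumes z: "z \<in> circle" and n: "annihilates n (B z)"
  shows "\<exists>n'. annihilates n' z"
proof -
  obtain k where k: "B z = circle_reflection (vertex k) (vertex (k + 1)) z" using circle_arc_cases[OF z] by metis
  have "lform (lreflect (arc_normal k) n) (hat z) = 0"
    unfolding lform_lreflect_adjoint using lreflect_arc_normal[OF z k] n by (metis annihilates_def lform_simps(6) mult_zero_right)
  moreover have "lreflect (arc_normal k) n \<noteq> 0"
  proof
    assume "lreflect (arc_normal k) n = 0"
    then have "n = lreflect (arc_normal k) 0" using lreflect_involution[OF arc_normal_unit] by metis
    then show False using n by (simp add: lreflect_def annihilates_def)
  qed
  ultimately show ?thesis
    using n lreflect_lattice[OF arc_normal_in_int_lattice] unfolding annihilates_def by blast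
qed

lemma annihilates_back_funpow:
  assumes "z \<in> circle" "annihilates n ((B ^^ i) z)"
  shows "\<exists>n'. annihilates n' z"
  using assms
proof (induction i arbitrary: n)
  case (Suc i)
  then show ?case using annihilates_back[OF funpow_in_circle[OF Suc.prems(1)]] by (metis comp_apply funpow.simps(2))
qed auto

end

section \<open>Quadratic points are preperiodic\<close>

text \<open>The argument of Lagrange: the integral normal \<open>n\<close> of the geodesic through a quadratic point is
  carried along its orbit by the reflections, with \<open>\<langle>n, n\<rangle>\<close> preserved. Once the geodesic separates the
  vertices it does so forever, and then \<open>n\<close> ranges over a finite set.\<close>

context unimodular_circle
begin

definition separates :: "complex \<times> real \<Rightarrow> bool" where
  "separates n \<longleftrightarrow> (\<exists>i j. lform n (hat (vertex i)) < 0 \<and> lform n (hat (vertex j)) > 0)"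

text \<open>If a geodesic with integral normal ended at a vertex, which is rational, its other end
  would be rational too.\<close>

lemma annihilates_vertex_nonzero:
  assumes "z \<in> circle" "z \<notin> gaussian_rationals" "annihilates n z"
  shows "lform n (hat (vertex j)) \<noteq> 0"
proof
  assume "lform n (hat (vertex j)) = 0"
  then have "annihilates n (vertex j)" using assms(3) by (simp add: annihilates_def)
  then show False
    using annihilates_two_points[OF assms(1) vertex_in_circle assms(3) _ vertex_gaussian] assms(2) by blast
qed

lemma annihilates_neg: "annihilates n z \<Longrightarrow> annihilates ((- 1) *\<^sub>R n) z"
  unfolding annihilates_def lform_simps by (auto simp: int_lattice_def)

lemma irrational_arc:
  assumes "z \<in> circle" "z \<notin> gaussian_rationals"
  obtains k where "lform (hat z) (arc_normal k) > 0" "B z = circle_reflection (vertex k) (vertex (k + 1)) z"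
proof -
  have "z \<notin> range vertex" using assms(2) vertex_gaussian by auto
  then show ?thesis using nonvertex_arc[OF assms(1)] partition_map_of_pos[OF assms(1)] that by metis
qed

lemma lform_arc_decomposition:
  "lform x y = (lform x (hat (vertex k)) * lform y (hat (vertex (k + 1))) + lform x (hat (vertex (k + 1))) * lform y (hat (vertex k)))
      / lform (hat (vertex k)) (hat (vertex (k + 1))) + lform x (arc_normal k) * lform y (arc_normal k)"
  unfolding arc_normal_def by (rule lform_decomposition[OF vertex_in_circle vertex_in_circle vertex_Suc_neq])

text \<open>A geodesic that ends inside the arc and has both ends of the arc on one side stays
  beyond the polygon edge under that arc, so no vertex lies on its other side. In
  \<open>lform_arc_decomposition\<close> the pairing of \<open>n\<close> with \<open>hat z\<close>
  is 0 and the first summand is positive, which fixes the sign of the second.\<close>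

lemma same_side:
  assumes z: "z \<in> circle" and n: "annihilates n z" and k: "lform (hat z) (arc_normal k) > 0"
    and pos: "lform n (hat (vertex k)) > 0" "lform n (hat (vertex (k + 1))) > 0"
  shows "lform n (arc_normal k) < 0" "lform n (hat (vertex j)) \<ge> 0"
proof -
  let ?g = "lform (hat (vertex k)) (hat (vertex (k + 1)))"
  have g: "?g < 0" by (rule lform_hat_neg[OF vertex_in_circle vertex_in_circle vertex_Suc_neq])
  have "z \<noteq> vertex k" "z \<noteq> vertex (k + 1)" using k lform_vertex_arc_normal[of k] by auto
  then have zn: "lform (hat z) (hat (vertex k)) < 0" "lform (hat z) (hat (vertex (k + 1))) < 0"
    using lform_hat_neg[OF z vertex_in_circle] by auto
  have "(lform n (hat (vertex k)) * lform (hat z) (hat (vertex (k + 1))) + lform n (hat (vertex (k + 1))) * lform (hat z) (hat (vertex k))) / ?g > 0"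
    using pos zn g by (intro divide_neg_neg add_neg_neg mult_pos_neg) auto
  moreover have "lform n (hat z) = 0" using n by (simp add: annihilates_def)
  ultimately have "lform n (arc_normal k) * lform (hat z) (arc_normal k) < 0"
    using lform_arc_decomposition[of n "hat z" k] by linarith
  then show neg: "lform n (arc_normal k) < 0" using k by (simp add: mult_less_0_iff)
  have "(lform n (hat (vertex k)) * lform (hat (vertex j)) (hat (vertex (k + 1))) + lform n (hat (vertex (k + 1))) * lform (hat (vertex j)) (hat (vertex k))) / ?g \<ge> 0"
    using pos g lform_hat_nonpos[OF vertex_in_circle vertex_in_circle]
    by (intro divide_nonpos_neg add_nonpos_nonpos mult_nonneg_nonpos) auto
  moreover have "lform n (arc_normal k) * lform (hat (vertex j)) (arc_normal k) \<ge> 0"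
    using neg lform_vertex_arc_normal_nonpos[of j k] by (intro mult_nonpos_nonpos) auto
  ultimately show "lform n (hat (vertex j)) \<ge> 0"
    using lform_arc_decomposition[of n "hat (vertex j)" k] by linarith
qed

lemma lform_lreflect_vertex:
  "lform (lreflect (arc_normal k) n) (hat (vertex k)) = lform n (hat (vertex k))"
  "lform (lreflect (arc_normal k) n) (hat (vertex (k + 1))) = lform n (hat (vertex (k + 1)))"
  unfolding lform_lreflect_right using lform_vertex_arc_normal[of k] by (simp_all add: lform_commute)

lemma irrational_step: "z \<in> circle \<Longrightarrow> z \<notin> gaussian_rationals \<Longrightarrow> B z \<in> circle \<and> B z \<notin> gaussian_rationals"
  using partition_map_gaussian_iff partition_map_in_circle by blast

text \<open>While all vertices lie on the positive side, \<open>lform n center\<close> is a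
  nonnegative integer, and a reflection that keeps them there lowers it by at least 1. Hence the
  geodesic must at some time separate the vertices.\<close>

lemma separation_reached_positive:
  assumes "z \<in> circle" "z \<notin> gaussian_rationals" "annihilates n z"
    "\<And>j. lform n (hat (vertex j)) > 0" "lform n center < real N"
  shows "\<exists>q n'. annihilates n' ((B ^^ q) z) \<and> lform n' n' = lform n n \<and> separates n'"
  using assms
proof (induction N arbitrary: z n)
  case 0
  have "lform n center \<ge> 0"
    unfolding center_def lform_sum_right lform_vertex_vec
    by (intro sum_nonneg mult_nonneg_nonneg less_imp_le[OF height_pos] less_imp_le[OF 0(4)])
  then show ?case using 0 by simp
next
  case (Suc N)
  obtain k where k: "lform (hat z) (arc_normal k) > 0" "B z = circle_reflection (vertex k) (vertex (k + 1)) z"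
    using irrational_arc[OF Suc.prems(1,2)] by metis
  define n' where "n' = lreflect (arc_normal k) n"
  have n': "annihilates n' (B z)" unfolding n'_def by (rule annihilates_step[OF Suc.prems(1,3) k(2)])
  have D: "lform n' n' = lform n n" unfolding n'_def by (rule lform_lreflect[OF arc_normal_unit])
  have nz: "lform n' (hat (vertex j)) \<noteq> 0" for j
    using annihilates_vertex_nonzero irrational_step[OF Suc.prems(1,2)] n' by blast
  show ?case
  proof (cases "\<exists>i. lform n' (hat (vertex i)) < 0")
    case True
    moreover have "lform n' (hat (vertex k)) > 0" unfolding n'_def lform_lreflect_vertex by (rule Suc.prems(4))
    ultimately have "separates n'" by (auto simp: separates_def)
    then show ?thesis using n' D by (intro exI[of _ 1] exI[of _ n']) simp
  next
    case False
    then have pos: "lform n' (hat (vertex j)) > 0" for j using nz[of j] by (meson linorder_neqE)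
    have "lform n (arc_normal k) < 0" using same_side(1)[OF Suc.prems(1,3) k(1)] Suc.prems(4) by blast
    then have "lform n (arc_normal k) * lform (arc_normal k) center > 0"
      using lform_arc_normal_center[of k] by (rule mult_neg_neg)
    then have "lform n' center < lform n center" unfolding n'_def lform_lreflect_right by linarith
    then have "lform n' center \<le> lform n center - 1"
      using n' Suc.prems(3) by (intro Ints_le_minus_1 lform_lattice center_in_int_lattice) (auto simp: annihilates_def)
    then have "lform n' center < real N" using Suc.prems(5) by simp
    then obtain q n'' where "annihilates n'' ((B ^^ q) (B z))" "lform n'' n'' = lform n' n'" "separates n''"
      using Suc.IH[OF _ _ n' pos] irrational_step[OF Suc.prems(1,2)] by metis
    then show ?thesis using D by (intro exI[of _ "Suc q"] exI[of _ n'']) (simp add: funpow_swap1)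
  qed
qed

lemma separation_reached:
  assumes z: "z \<in> circle" "z \<notin> gaussian_rationals" and n: "annihilates n z"
  shows "\<exists>q n'. annihilates n' ((B ^^ q) z) \<and> separates n'"
proof -
  note nz = annihilates_vertex_nonzero[OF z n]
  obtain N :: nat where N: "lform n center < real N" using reals_Archimedean2 by blast
  obtain N' :: nat where N': "lform ((- 1) *\<^sub>R n) center < real N'" using reals_Archimedean2 by blast
  consider "separates n" | "\<And>j. lform n (hat (vertex j)) > 0" | "\<And>j. lform ((- 1) *\<^sub>R n) (hat (vertex j)) > 0"
    unfolding separates_def lform_simps using nz by (smt (verit))
  then show ?thesis
  proof cases
    case 1
    then show ?thesis using n by (intro exI[of _ "0::nat"] exI[of _ n]) auto
  next
    case 2
    then show ?thesis using separation_reached_positive[OF z n _ N] by blast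
  next
    case 3
    then show ?thesis using separation_reached_positive[OF z annihilates_neg[OF n] _ N'] by blast
  qed
qed

text \<open>By \<open>same_side\<close>, applied to \<open>n\<close> and to its negative, the ends
  of the arc containing \<open>z\<close> lie on different sides. The reflection in this arc fixes
  both ends, so the new vector separates the same two neighbours, as \<open>reduced\<close>
  demands.\<close>

lemma separates_step:
  assumes z: "z \<in> circle" "z \<notin> gaussian_rationals" and n: "annihilates n z" "separates n"
  shows "\<exists>n' k. annihilates n' (B z) \<and> lform n' n' = lform n n \<and>
    lform n' (hat (vertex k)) * lform n' (hat (vertex (k + 1))) < 0"
proof -
  obtain k where k: "lform (hat z) (arc_normal k) > 0" "B z = circle_reflection (vertex k) (vertex (k + 1)) z"
    using irrational_arc[OF z] by metis
  obtain i j where ij: "lform n (hat (vertex i)) < 0" "lform n (hat (vertex j)) > 0"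
    using n(2) by (auto simp: separates_def)
  note nz = annihilates_vertex_nonzero[OF z n(1)]
  have "\<not> (lform n (hat (vertex k)) > 0 \<and> lform n (hat (vertex (k + 1))) > 0)"
    using same_side(2)[OF z(1) n(1) k(1), of i] ij by auto
  moreover have "\<not> (lform n (hat (vertex k)) < 0 \<and> lform n (hat (vertex (k + 1))) < 0)"
    using same_side(2)[OF z(1) annihilates_neg[OF n(1)] k(1), of j] ij unfolding lform_simps by auto
  ultimately have "lform n (hat (vertex k)) * lform n (hat (vertex (k + 1))) < 0"
    using nz[of k] nz[of "k + 1"] by (auto simp: mult_less_0_iff)
  then show ?thesis
    using annihilates_step[OF z(1) n(1) k(2)] lform_lreflect[OF arc_normal_unit]
    by (intro exI[of _ "lreflect (arc_normal k) n"] exI[of _ k]) (simp add: lform_lreflect_vertex)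
qed

section \<open>Finiteness of the integral vectors of given norm that separate two neighbouring
  vertices\<close>

lemma finite_bounded_Ints: "finite {x::real. x \<in> \<int> \<and> \<bar>x\<bar> \<le> C}"
proof (rule finite_subset)
  show "{x. x \<in> \<int> \<and> \<bar>x\<bar> \<le> C} \<subseteq> real_of_int ` {- \<lceil>C\<rceil>..\<lceil>C\<rceil>}"
  proof
    fix x assume "x \<in> {x. x \<in> \<int> \<and> \<bar>x\<bar> \<le> C}"
    then obtain i :: int where "x = of_int i" "\<bar>x\<bar> \<le> C" by (auto elim: Ints_cases)
    moreover from this have "- \<lceil>C\<rceil> \<le> i" "i \<le> \<lceil>C\<rceil>" by linarith+
    ultimately show "x \<in> real_of_int ` {- \<lceil>C\<rceil>..\<lceil>C\<rceil>}" by auto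
  qed
qed simp

text \<open>The two vertex vectors and the arc normal form a basis, so the three pairings determine
  the vector; on the lattice they are integers, of which a bound leaves finitely many.\<close>

lemma finite_bounded_pairings:
  "finite {n \<in> int_lattice. \<bar>lform n (vertex_vec k)\<bar> \<le> C \<and> \<bar>lform n (vertex_vec (k + 1))\<bar> \<le> C \<and> \<bar>lform n (arc_normal k)\<bar> \<le> C}"
  (is "finite ?S")
proof -
  define f where "f = (\<lambda>n. (lform n (vertex_vec k), lform n (vertex_vec (k + 1)), lform n (arc_normal k)))"
  have "inj f"
  proof (rule injI)
    fix x x' assume "f x = f x'"
    then have e: "lform x (hat (vertex k)) = lform x' (hat (vertex k))"
      "lform x (hat (vertex (k + 1))) = lform x' (hat (vertex (k + 1)))" "lform x (arc_normal k) = lform x' (arc_normal k)"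
      using height_pos[of k] height_pos[of "k + 1"] by (auto simp: f_def lform_vertex_vec)
    show "x = x'"
    proof (rule lform_nondegenerate)
      show "lform x y = lform x' y" for y
        unfolding lform_arc_decomposition[of x y k] lform_arc_decomposition[of x' y k] e ..
    qed
  qed
  let ?I = "{x::real. x \<in> \<int> \<and> \<bar>x\<bar> \<le> C}"
  have "f ` ?S \<subseteq> ?I \<times> ?I \<times> ?I"
    unfolding f_def by (auto intro!: lform_lattice vertex_vec_in_int_lattice arc_normal_in_int_lattice)
  moreover have "finite (?I \<times> ?I \<times> ?I)" by (intro finite_cartesian_product finite_bounded_Ints)
  ultimately have "finite (f ` ?S)" by (rule finite_subset)
  then show ?thesis using finite_imageD inj_on_subset[OF \<open>inj f\<close>] by blast
qed

text \<open>With the abbreviations of the proof, \<open>D = 2 * (P * Q) / G + R\<^sup>2\<close>, and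
  both summands are nonnegative because \<open>P * Q\<close> and \<open>G\<close> are negative.
  \<open>P\<close> and \<open>Q\<close> are nonzero integers, so neither exceeds the product in
  absolute value, and the product is controlled by \<open>D\<close> and \<open>G\<close>. The
  constant \<open>C\<close> is a coarse bound valid for all three pairings.\<close>

lemma reduced_bound:
  assumes n: "n \<in> int_lattice" and sep: "lform n (hat (vertex k)) * lform n (hat (vertex (k + 1))) < 0"
  defines "C \<equiv> lform n n * (1 + \<bar>lform (vertex_vec k) (vertex_vec (k + 1))\<bar>)"
  shows "\<bar>lform n (vertex_vec k)\<bar> \<le> C" "\<bar>lform n (vertex_vec (k + 1))\<bar> \<le> C" "\<bar>lform n (arc_normal k)\<bar> \<le> C"
proof -
  define P Q R G where "P = lform n (vertex_vec k)" and "Q = lform n (vertex_vec (k + 1))"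
    and "R = lform n (arc_normal k)" and "G = lform (vertex_vec k) (vertex_vec (k + 1))"
  define D where "D = lform n n"
  define h h' where "h = real_of_int (vec_nth (t (nat (k mod int m))) 3)"
    and "h' = real_of_int (vec_nth (t (nat ((k + 1) mod int m))) 3)"
  have hp: "h > 0" "h' > 0" using height_pos[of k] height_pos[of "k + 1"] by (auto simp: h_def h'_def)
  have PQ: "P = h * lform n (hat (vertex k))" "Q = h' * lform n (hat (vertex (k + 1)))"
    by (simp_all add: P_def Q_def lform_vertex_vec h_def h'_def)
  have G: "G = h * h' * lform (hat (vertex k)) (hat (vertex (k + 1)))"
    by (simp add: G_def vertex_vec_def h_def h'_def)
  have g0: "lform (hat (vertex k)) (hat (vertex (k + 1))) < 0"
    by (rule lform_hat_neg[OF vertex_in_circle vertex_in_circle vertex_Suc_neq])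
  then have G0: "G < 0" unfolding G using hp by (simp add: mult_pos_neg)
  have ints: "P \<in> \<int>" "Q \<in> \<int>" "R \<in> \<int>"
    unfolding P_def Q_def R_def using n vertex_vec_in_int_lattice arc_normal_in_int_lattice by (auto intro: lform_lattice)
  have "P * Q = h * h' * (lform n (hat (vertex k)) * lform n (hat (vertex (k + 1))))" by (simp add: PQ)
  then have pq: "P * Q < 0" using sep hp by (simp add: mult_pos_neg)
  then have PQ1: "\<bar>P\<bar> \<ge> 1" "\<bar>Q\<bar> \<ge> 1" using ints by (auto intro!: Ints_nonzero_abs_ge1)
  have "D = 2 * (P * Q) / G + R\<^sup>2"
    using lform_arc_decomposition[of n n k] hp g0 unfolding D_def PQ G R_def
    by (simp add: power2_eq_square mult_ac)
  moreover have "2 * (P * Q) / G = 2 * (\<bar>P\<bar> * \<bar>Q\<bar>) / \<bar>G\<bar>"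
    using pq G0 by (simp add: abs_mult[symmetric])
  ultimately have D: "D = 2 * (\<bar>P\<bar> * \<bar>Q\<bar>) / \<bar>G\<bar> + R\<^sup>2" by simp
  have t: "2 * (\<bar>P\<bar> * \<bar>Q\<bar>) / \<bar>G\<bar> \<ge> 0" by simp
  have D0: "D \<ge> 0" using D t by simp
  have "2 * (\<bar>P\<bar> * \<bar>Q\<bar>) / \<bar>G\<bar> \<le> D" using D by simp
  then have b: "2 * (\<bar>P\<bar> * \<bar>Q\<bar>) \<le> D * \<bar>G\<bar>" using G0 by (simp add: field_simps)
  have le: "\<bar>P\<bar> \<le> \<bar>P\<bar> * \<bar>Q\<bar>" "\<bar>Q\<bar> \<le> \<bar>P\<bar> * \<bar>Q\<bar>"
    using PQ1 by (simp_all add: mult_le_cancel_left1 mult_le_cancel_right1)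
  have C: "C = D + D * \<bar>G\<bar>" by (simp add: C_def D_def G_def algebra_simps)
  show "\<bar>lform n (vertex_vec k)\<bar> \<le> C" "\<bar>lform n (vertex_vec (k + 1))\<bar> \<le> C"
    unfolding C P_def[symmetric] Q_def[symmetric] using b le D0 PQ1 by linarith+
  have "\<bar>R\<bar> \<le> R\<^sup>2"
  proof (cases "R = 0")
    case False
    then have "\<bar>R\<bar> * 1 \<le> \<bar>R\<bar> * \<bar>R\<bar>" using Ints_nonzero_abs_ge1[OF ints(3)] by (intro mult_left_mono) auto
    then show ?thesis by (simp add: power2_eq_square)
  qed simp
  also have "\<dots> \<le> D" using D t by linarith
  also have "\<dots> \<le> C" unfolding C using D0 by simp
  finally show "\<bar>lform n (arc_normal k)\<bar> \<le> C" by (simp add: R_def)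
qed

text \<open>The analogue of the reduced indefinite binary quadratic forms of a given
  discriminant.\<close>

definition reduced :: "real \<Rightarrow> (complex \<times> real) set" where
  "reduced D = {n \<in> int_lattice. lform n n = D \<and>
    (\<exists>k. lform n (hat (vertex k)) * lform n (hat (vertex (k + 1))) < 0)}"

lemma finite_reduced: "finite (reduced D)"
proof -
  define S where "S = (\<lambda>k. {n \<in> int_lattice. \<bar>lform n (vertex_vec k)\<bar> \<le> D * (1 + \<bar>lform (vertex_vec k) (vertex_vec (k + 1))\<bar>) \<and>
    \<bar>lform n (vertex_vec (k + 1))\<bar> \<le> D * (1 + \<bar>lform (vertex_vec k) (vertex_vec (k + 1))\<bar>) \<and>
    \<bar>lform n (arc_normal k)\<bar> \<le> D * (1 + \<bar>lform (vertex_vec k) (vertex_vec (k + 1))\<bar>)})"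
  have "reduced D \<subseteq> (\<Union>a<m. S (int a))"
  proof
    fix n assume "n \<in> reduced D"
    then obtain k where k: "n \<in> int_lattice" "lform n n = D"
        "lform n (hat (vertex k)) * lform n (hat (vertex (k + 1))) < 0"
      by (auto simp: reduced_def)
    define a where "a = nat (k mod int m)"
    have a: "k = int a + int m * (k div int m)" using m_ge_3 by (simp add: a_def)
    have "vertex k = vertex (int a)" "vertex (k + 1) = vertex (int a + 1)"
      using vertex_periodic[of "int a" "k div int m"] vertex_periodic[of "int a + 1" "k div int m"] a
      by (simp_all add: algebra_simps)
    then have "n \<in> S (int a)"
      using reduced_bound[OF k(1), of "int a"] k by (simp add: S_def)
    moreover have "a < m" unfolding a_def by (rule index_bounds)
    ultimately show "n \<in> (\<Union>a<m. S (int a))" by blast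
  qed
  moreover have "finite (\<Union>a<m. S (int a))"
    unfolding S_def by (intro finite_UN_I finite_bounded_pairings) auto
  ultimately show ?thesis by (rule finite_subset)
qed

lemma annihilated_preperiodic:
  assumes z: "z \<in> circle" and n: "annihilates n z"
  shows "\<exists>i j. i < j \<and> (B ^^ i) z = (B ^^ j) z"
proof (cases "z \<in> gaussian_rationals")
  case True
  then obtain i where "(B ^^ i) z \<in> range vertex" using gaussian_reaches_vertex[OF z] by blast
  then have "B ((B ^^ i) z) = (B ^^ i) z"
    using partition_map_fixed_iff[OF funpow_in_circle[OF z]] by blast
  then have "(B ^^ i) z = (B ^^ Suc i) z" by simp
  then show ?thesis by blast
next
  case False
  then obtain q n0 where q: "annihilates n0 ((B ^^ q) z)" "separates n0"
    using separation_reached[OF z _ n] by blast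
  have irr: "(B ^^ i) z \<in> circle" "(B ^^ i) z \<notin> gaussian_rationals" for i
    using z False funpow_in_circle funpow_gaussian_iff by auto
  have sep: "separates n'" if "lform n' (hat (vertex k)) * lform n' (hat (vertex (k + 1))) < 0" for n' k
    using that by (auto simp: separates_def mult_less_0_iff)
  have inv: "\<exists>n'. annihilates n' ((B ^^ (q + p)) z) \<and> lform n' n' = lform n0 n0 \<and> separates n'" for p
  proof (induction p)
    case 0
    then show ?case using q by (intro exI[of _ n0]) simp
  next
    case (Suc p)
    then obtain n' where "annihilates n' ((B ^^ (q + p)) z)" "lform n' n' = lform n0 n0" "separates n'" by blast
    then show ?case using separates_step[OF irr] sep by (metis add_Suc_right comp_apply funpow.simps(2))
  qed
  \<comment> \<open>There are finitely many reduced vectors and each annihilates finitely many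
    points. The tail of the orbit stays in this finite set, so it repeats.\<close>
  define Z where "Z = (\<Union>n'\<in>reduced (lform n0 n0). {z \<in> circle. annihilates n' z})"
  have "finite Z" unfolding Z_def by (intro finite_UN_I finite_reduced finite_annihilated)
  have "(B ^^ (q + Suc p)) z \<in> Z" for p
  proof -
    obtain n' where n': "annihilates n' ((B ^^ (q + p)) z)" "lform n' n' = lform n0 n0" "separates n'" using inv by blast
    then obtain n'' k where "annihilates n'' (B ((B ^^ (q + p)) z))" "lform n'' n'' = lform n0 n0"
       "lform n'' (hat (vertex k)) * lform n'' (hat (vertex (k + 1))) < 0"
      using separates_step[OF irr n'(1,3)] by metis
    then have "n'' \<in> reduced (lform n0 n0)" "annihilates n'' ((B ^^ (q + Suc p)) z)"
      unfolding reduced_def annihilates_def by auto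
    then show ?thesis using irr(1)[of "q + Suc p"] unfolding Z_def by blast
  qed
  then have "range (\<lambda>p. (B ^^ (q + Suc p)) z) \<subseteq> Z" by blast
  then have "finite (range (\<lambda>p. (B ^^ (q + Suc p)) z))" using \<open>finite Z\<close> by (rule finite_subset)
  then have "\<not> inj (\<lambda>p. (B ^^ (q + Suc p)) z)" using finite_imageD infinite_UNIV_nat by blast
  then obtain a b where "a < b" "(B ^^ (q + Suc a)) z = (B ^^ (q + Suc b)) z"
    unfolding inj_def by (metis linorder_neqE_nat)
  then show ?thesis by (intro exI[of _ "q + Suc a"] exI[of _ "q + Suc b"]) simp
qed

section \<open>Preperiodic points are quadratic\<close>

text \<open>An irrational orbit avoids the vertices, where the choice of reflection changes. Each of
  its points is interior to an arc, and nearby points undergo the same reflections.\<close>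

lemma funpow_locally_moebius:
  assumes z: "z \<in> circle" and irr: "z \<notin> gaussian_rationals"
  shows "\<exists>a\<in>gaussian_rationals. \<exists>b\<in>gaussian_rationals. \<exists>c\<in>gaussian_rationals. \<exists>d\<in>gaussian_rationals. \<exists>U.
    open U \<and> z \<in> U \<and> (\<forall>y\<in>circle \<inter> U. c * y + d \<noteq> 0 \<and> (B ^^ p) y = (a * y + b) / (c * y + d))"
proof (induction p)
  case 0
  show ?case
    by (rule bexI[of _ 1], rule bexI[of _ 0], rule bexI[of _ 0], rule bexI[of _ 1], rule exI[of _ UNIV]) auto
next
  case (Suc p)
  then obtain a b c d U where g: "a \<in> gaussian_rationals" "b \<in> gaussian_rationals" "c \<in> gaussian_rationals" "d \<in> gaussian_rationals"
    and U: "open U" "z \<in> U" "\<And>y. y \<in> circle \<inter> U \<Longrightarrow> c * y + d \<noteq> 0 \<and> (B ^^ p) y = (a * y + b) / (c * y + d)"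
    by blast
  define w where "w = (B ^^ p) z"
  have "w \<in> circle" "w \<notin> gaussian_rationals"
    unfolding w_def using z irr funpow_in_circle funpow_gaussian_iff by auto
  then obtain k where k: "lform (hat w) (arc_normal k) > 0" using irrational_arc by metis
  have "continuous_on circle (\<lambda>y. lform (hat ((B ^^ p) y)) (arc_normal k))"
    unfolding lform_def hat_def fst_conv snd_conv by (intro continuous_intros continuous_on_funpow)
  then have "openin (top_of_set circle) (circle \<inter> (\<lambda>y. lform (hat ((B ^^ p) y)) (arc_normal k)) -` {0<..})"
    by (rule continuous_openin_preimage_gen) simp
  then obtain V where V: "open V" "circle \<inter> (\<lambda>y. lform (hat ((B ^^ p) y)) (arc_normal k)) -` {0<..} = circle \<inter> V"
    unfolding openin_open by blast
  define S P where "S = vertex k + vertex (k + 1)" and "P = vertex k * vertex (k + 1)"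
  have SP: "S \<in> gaussian_rationals" "P \<in> gaussian_rationals"
    unfolding S_def P_def by (auto intro: vertex_gaussian)
  \<comment> \<open>The product of the matrix of the reflection, with rows
    \<open>(S, - 2 * P)\<close> and \<open>(2, - S)\<close>, and the matrix with rows
    \<open>(a, b)\<close> and \<open>(c, d)\<close>.\<close>
  define a' b' c' d' where "a' = S * a - 2 * P * c" and "b' = S * b - 2 * P * d"
    and "c' = 2 * a - S * c" and "d' = 2 * b - S * d"
  have "a' \<in> gaussian_rationals" "b' \<in> gaussian_rationals" "c' \<in> gaussian_rationals" "d' \<in> gaussian_rationals"
    unfolding a'_def b'_def c'_def d'_def
    by (intro gaussian_rationals_intros SP g gaussian_rationals_simps)+
  moreover have "open (U \<inter> V)" using U(1) V(1) by blast
  moreover have "z \<in> U \<inter> V"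
  proof -
    have "z \<in> circle \<inter> (\<lambda>y. lform (hat ((B ^^ p) y)) (arc_normal k)) -` {0<..}" using z k by (simp add: w_def)
    then show ?thesis using V(2) U(2) by auto
  qed
  moreover have "c' * y + d' \<noteq> 0 \<and> (B ^^ Suc p) y = (a' * y + b') / (c' * y + d')" if y: "y \<in> circle \<inter> (U \<inter> V)" for y
  proof -
    define e x where "e = c * y + d" and "x = (B ^^ p) y"
    have e: "e \<noteq> 0" "x * e = a * y + b" using U(3)[of y] y by (auto simp: e_def x_def)
    have xc: "x \<in> circle" unfolding x_def using y by (intro funpow_in_circle) auto
    have "y \<in> circle \<inter> V" using y by blast
    then have "lform (hat x) (arc_normal k) > 0" unfolding V(2)[symmetric] by (simp add: x_def)
    then have Bx: "B x = (S * x - 2 * P) / (2 * x - S)"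
      using partition_map_of_pos[OF xc] by (simp add: circle_reflection_def S_def P_def mult.assoc)
    have den: "2 * x - S \<noteq> 0"
      unfolding S_def by (rule circle_reflection_denominator[OF vertex_in_circle vertex_in_circle vertex_Suc_neq xc])
    have cd: "c' * y + d' = (2 * x - S) * e"
    proof -
      have "(2 * x - S) * e = 2 * (x * e) - S * e" by (simp add: algebra_simps)
      then show ?thesis unfolding e(2) by (simp add: c'_def d'_def e_def algebra_simps)
    qed
    have ab: "a' * y + b' = (S * x - 2 * P) * e"
    proof -
      have "(S * x - 2 * P) * e = S * (x * e) - 2 * P * e" by (simp add: algebra_simps)
      then show ?thesis unfolding e(2) by (simp add: a'_def b'_def e_def algebra_simps)
    qed
    have "(B ^^ Suc p) y = B x" by (simp add: x_def)
    then show ?thesis unfolding ab cd Bx using e(1) den by simp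
  qed
  ultimately show ?case by blast
qed

text \<open>The fixed-point equation of the local Moebius map has degree at most 2. It is trivial
  only if \<open>B ^^ p\<close> is the identity near \<open>z\<close>, which contradicts
  \<open>fin\<close> because the circle has no isolated points.\<close>

lemma periodic_quadratic:
  assumes z: "z \<in> circle" and per: "(B ^^ p) z = z" and fin: "finite {y \<in> circle. (B ^^ p) y = y}"
  shows "z \<in> degree_le2_points"
proof (cases "z \<in> gaussian_rationals")
  case True
  then have "0 - z \<in> gaussian_rationals" by (intro gaussian_rationals_intros gaussian_rationals_simps)
  then show ?thesis using z by (intro degree_le2_pointsI[of z 0 1 "- z"]) auto
next
  case False
  obtain a b c d U where g: "a \<in> gaussian_rationals" "b \<in> gaussian_rationals" "c \<in> gaussian_rationals" "d \<in> gaussian_rationals"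
    and U: "open U" "z \<in> U" "\<And>y. y \<in> circle \<inter> U \<Longrightarrow> c * y + d \<noteq> 0 \<and> (B ^^ p) y = (a * y + b) / (c * y + d)"
    using funpow_locally_moebius[OF z False, of p] by blast
  have g': "d - a \<in> gaussian_rationals" "0 - b \<in> gaussian_rationals"
    by (intro gaussian_rationals_intros gaussian_rationals_simps g)+
  have "\<not> (c = 0 \<and> d - a = 0 \<and> b = 0)"
  proof
    assume triv: "c = 0 \<and> d - a = 0 \<and> b = 0"
    then have "circle \<inter> U \<subseteq> {y \<in> circle. (B ^^ p) y = y}" using U(3) by force
    then have "finite (circle \<inter> U)" using fin finite_subset by blast
    moreover have "z islimpt circle"
    proof (rule connected_imp_perfect)
      show "connected circle" by (rule connected_sphere) simp
      show "circle \<noteq> {x}" for x :: complex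
      proof
        assume x: "circle = {x}"
        have "(1::complex) \<in> circle" "(-1::complex) \<in> circle" by auto
        then show False unfolding x by auto
      qed
    qed (rule z)
    then have "infinite (circle \<inter> U)" unfolding islimpt_eq_acc_point using U by (simp add: Int_commute)
    ultimately show False by contradiction
  qed
  moreover have "c * z\<^sup>2 + (d - a) * z + (0 - b) = 0"
  proof -
    have "c * z + d \<noteq> 0" "z = (a * z + b) / (c * z + d)" using U(3)[of z] z U(2) per by auto
    then have "z * (c * z + d) = a * z + b" by (metis nonzero_eq_divide_eq)
    then show ?thesis by (simp add: algebra_simps power2_eq_square)
  qed
  ultimately show ?thesis using degree_le2_pointsI[OF z g(3) g'] by auto
qed

lemma degree_le2_points_iff_preperiodic:
  assumes z: "z \<in> circle" and fin: "\<And>p. p > 0 \<Longrightarrow> finite {y \<in> circle. (B ^^ p) y = y}"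
  shows "z \<in> degree_le2_points \<longleftrightarrow> (\<exists>i j. i < j \<and> (B ^^ i) z = (B ^^ j) z)"
proof
  assume "z \<in> degree_le2_points"
  then show "\<exists>i j. i < j \<and> (B ^^ i) z = (B ^^ j) z"
    using annihilated_preperiodic unfolding degree_le2_points_iff by blast
next
  assume "\<exists>i j. i < j \<and> (B ^^ i) z = (B ^^ j) z"
  then obtain i j where ij: "i < j" "(B ^^ i) z = (B ^^ j) z" by blast
  define y where "y = (B ^^ i) z"
  have "(B ^^ (j - i)) y = (B ^^ (j - i + i)) z" unfolding y_def funpow_add by simp
  then have "(B ^^ (j - i)) y = y" using ij by (simp add: y_def)
  then have "y \<in> degree_le2_points"
    using periodic_quadratic[OF funpow_in_circle[OF z]] fin[of "j - i"] ij(1) unfolding y_def by simp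
  then obtain n where "annihilates n y" unfolding degree_le2_points_iff by blast
  then show "z \<in> degree_le2_points"
    unfolding degree_le2_points_iff using annihilates_back_funpow[OF z] z unfolding y_def by blast
qed

end

section \<open>Existence of the conjugacy\<close>

lemma gaussian_angles_dense:
  fixes a b :: real
  assumes "a < b"
  shows "\<exists>x. a < x \<and> x < b \<and> cis x \<in> gaussian_rationals"
proof -
  define n where "n = \<lfloor>(a + pi) / (2 * pi)\<rfloor>"
  define c where "c = min b (pi + 2 * pi * of_int n)"
  have "of_int n \<le> (a + pi) / (2 * pi)" "(a + pi) / (2 * pi) < of_int n + 1" unfolding n_def by linarith+
  then have a: "2 * pi * of_int n - pi \<le> a" "a < pi + 2 * pi * of_int n" by (simp_all add: field_simps)
  then have c: "a < c" "c \<le> b" "c \<le> pi + 2 * pi * of_int n" using assms by (auto simp: c_def)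
  \<comment> \<open>The middle third of the interval from \<open>a\<close> to \<open>c\<close>,
    moved between \<open>- pi\<close> and \<open>pi\<close>, where the tangent of the half angle is
    increasing. A rational value of that tangent yields a Gaussian rational point.\<close>
  define u v where "u = (2 * a + c) / 3 - 2 * pi * of_int n" and "v = (a + 2 * c) / 3 - 2 * pi * of_int n"
  have uv: "- pi < u" "u < v" "v < pi" "a < u + 2 * pi * of_int n" "v + 2 * pi * of_int n < b"
    using a c by (simp_all add: u_def v_def field_simps)
  have "tan (u / 2) < tan (v / 2)" using uv by (intro tan_monotone) auto
  then obtain r where r: "r \<in> \<rat>" "tan (u / 2) < r" "r < tan (v / 2)" using Rats_dense_in_real by blast
  have "arctan (tan (u / 2)) < arctan r" "arctan r < arctan (tan (v / 2))"
    using r by (simp_all add: arctan_less_iff)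
  then have x: "u < 2 * arctan r" "2 * arctan r < v"
    using uv arctan_tan[of "u / 2"] arctan_tan[of "v / 2"] by auto
  have "complex_of_real r \<in> gaussian_rationals" using r(1) by (simp add: gaussian_rationals_def)
  then have "cis (2 * arctan r) \<in> gaussian_rationals"
    unfolding cis_double_arctan by (intro gaussian_rationals_intros gaussian_rationals_simps)
  moreover have "cis (2 * arctan r + 2 * pi * of_int n) = cis (2 * arctan r)"
    unfolding cis_eq_iff_int by (intro exI[of _ n]) simp
  ultimately show ?thesis using x uv by (intro exI[of _ "2 * arctan r + 2 * pi * of_int n"]) auto
qed

context unimodular_circle
begin

text \<open>On each arc the lift agrees up to a constant with that of
  \<open>circle_reflection_lift\<close>. As vertices are fixed by \<open>B\<close>, \<open>F\<close>
  moves \<open>angle k\<close> by a multiple of \<open>2 * pi\<close>, and passing an arc lowers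
  this multiple by one. Over \<open>m\<close> arcs \<open>F\<close> changes by
  \<open>2 * pi - 2 * pi * m\<close>, which gives the degree.\<close>

lemma partition_map_lift:
  obtains F and c :: int where "continuous_on UNIV F" "\<And>x. cis (F x) = B (cis x)"
    "\<And>x y. x < y \<Longrightarrow> F y < F x" "\<And>x. F (x + 2 * pi) = F x - 2 * pi * real (m - 1)"
    "\<And>k. F (angle k) = angle k - 2 * pi * of_int k + 2 * pi * of_int c"
proof -
  have "continuous_on UNIV (\<lambda>x. B (cis x))"
    by (rule continuous_on_compose2[OF continuous_on_partition_map]) (auto intro!: continuous_intros)
  then obtain F where F: "continuous_on UNIV F" "\<And>x. cis (F x) = B (cis x)"
    using circle_lift partition_map_in_circle cis_in_circle by metis
  have arc: "(\<forall>x y. angle k \<le> x \<longrightarrow> x < y \<longrightarrow> y \<le> angle (k + 1) \<longrightarrow> F y < F x) \<and>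
      F (angle (k + 1)) - F (angle k) = angle (k + 1) - angle k - 2 * pi" for k
  proof -
    obtain G where G: "continuous_on {angle k..angle (k + 1)} G"
      "\<And>x y. angle k \<le> x \<Longrightarrow> x < y \<Longrightarrow> y \<le> angle (k + 1) \<Longrightarrow> G y < G x"
      "\<And>x. x \<in> {angle k..angle (k + 1)} \<Longrightarrow> cis (G x) = circle_reflection (cis (angle k)) (cis (angle (k + 1))) (cis x)"
      "G (angle (k + 1)) - G (angle k) = angle (k + 1) - angle k - 2 * pi"
      using circle_reflection_lift[OF angle_less_Suc angle_Suc_less, of k] by blast
    have diff: "F y - F x = G y - G x" if "x \<in> {angle k..angle (k + 1)}" "y \<in> {angle k..angle (k + 1)}" for x y
    proof (rule lifts_differ_by_const[of "{angle k..angle (k + 1)}"])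
      show "continuous_on {angle k..angle (k + 1)} F" using F(1) continuous_on_subset by blast
      show "cis (F x) = cis (G x)" if "x \<in> {angle k..angle (k + 1)}" for x
        using G(3)[OF that] partition_map_cis[OF that] F(2) by (simp add: cis_angle)
    qed (use G(1) that in auto)
    show ?thesis
    proof (intro conjI allI impI)
      fix x y assume "angle k \<le> x" "x < y" "y \<le> angle (k + 1)"
      then show "F y < F x" using G(2)[of x y] diff[of x y] by auto
    next
      show "F (angle (k + 1)) - F (angle k) = angle (k + 1) - angle k - 2 * pi"
        using diff[of "angle k" "angle (k + 1)"] G(4) angle_less_Suc[of k] by simp
    qed
  qed
  have anti_block: "F y < F x" if "angle k \<le> x" "x < y" "y \<le> angle (k + int n)" for k n x y
    using that
  proof (induction n arbitrary: x y)
    case (Suc n)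
    have e: "angle (k + int (Suc n)) = angle (k + int n + 1)" by (simp add: algebra_simps)
    consider "y \<le> angle (k + int n)" | "angle (k + int n) \<le> x" | "x < angle (k + int n)" "angle (k + int n) < y" by linarith
    then show ?case
    proof cases
      case 1
      then show ?thesis using Suc by blast
    next
      case 2
      then show ?thesis using arc[of "k + int n"] Suc.prems e by auto
    next
      case 3
      then have "F (angle (k + int n)) < F x" using Suc.IH[of x "angle (k + int n)"] Suc.prems by simp
      moreover have "F y < F (angle (k + int n))" using 3 arc[of "k + int n"] Suc.prems e by auto
      ultimately show ?thesis by simp
    qed
  qed auto
  have anti: "F y < F x" if "x < y" for x y
  proof -
    obtain i j where ij: "x \<in> {angle i..<angle (i + 1)}" "y \<in> {angle j..<angle (j + 1)}"
      using angle_arc_exists by meson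
    then have "angle i \<le> x" "y < angle (j + 1)" by auto
    then have "angle i < angle (j + 1)" using that by linarith
    then have "j + 1 = i + int (nat (j + 1 - i))" by simp
    then show ?thesis using anti_block[of i x y "nat (j + 1 - i)"] ij that by auto
  qed
  obtain c :: int where c: "F (angle 0) = angle 0 + 2 * pi * c"
    using F(2)[of "angle 0"] partition_map_fixed_iff[OF vertex_in_circle, of 0] cis_eq_iff_int
    by (metis cis_angle rangeI)
  have Fk: "F (angle k) = angle k - 2 * pi * of_int k + 2 * pi * of_int c" for k
  proof (induction k rule: int_induct[where k = 0])
    case base
    show ?case using c by simp
  next
    case (step1 i)
    then show ?case using arc[of i] by (simp add: algebra_simps)
  next
    case (step2 i)
    then show ?case using arc[of "i - 1"] by (simp add: algebra_simps)
  qed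
  have per: "F (x + 2 * pi) = F x - 2 * pi * real (m - 1)" for x
  proof -
    have "F (x + 2 * pi) - F (angle 0 + 2 * pi) = F x - F (angle 0)"
    proof (rule lifts_differ_by_const[of UNIV])
      show "continuous_on UNIV (\<lambda>x. F (x + 2 * pi))"
        by (rule continuous_on_compose2[OF F(1)]) (auto intro!: continuous_intros)
      show "cis (F (x + 2 * pi)) = cis (F x)" for x
        unfolding F(2) by (simp flip: cis_mult)
    qed (use F(1) in auto)
    moreover have "F (angle 0 + 2 * pi) = F (angle 0) - 2 * pi * real (m - 1)"
      using Fk[of "int m"] Fk[of 0] angle_periodic[of 0 1] m_ge_3 by (simp add: of_nat_diff algebra_simps)
    ultimately show ?thesis by simp
  qed
  show ?thesis using that[OF F anti per Fk] .
qed

lemma power_map_eq: "power_map m z = z powi - int (m - 1)"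
  using m_ge_3 by (simp add: power_map_def of_nat_diff)

lemma conjugacy_exists: "\<exists>\<Phi>. circle_conjugacy B (power_map m) \<Phi>"
proof -
  obtain F and c :: int where F: "continuous_on UNIV F" "\<And>x. cis (F x) = B (cis x)"
    "\<And>x y. x < y \<Longrightarrow> F y < F x" "\<And>x. F (x + 2 * pi) = F x - 2 * pi * real (m - 1)"
    "\<And>k. F (angle k) = angle k - 2 * pi * of_int k + 2 * pi * of_int c"
    using partition_map_lift by blast
  have m2: "m - 1 \<ge> 2" using m_ge_3 by simp
  have "antimono F" using F(3) by (intro antimonoI) (metis less_eq_real_def)
  then obtain \<phi> where \<phi>: "continuous_on UNIV \<phi>" "mono \<phi>" "\<And>x. \<phi> (x + 2 * pi) = \<phi> x + 2 * pi"
    "\<And>x. \<phi> (F x) = - real (m - 1) * \<phi> x"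
    using semiconjugacy_of_lift[OF F(1,4) _ m2] by blast
  have shift: "\<phi> (x + 2 * pi * of_int n) = \<phi> x + 2 * pi * of_int n" for x n
    using quasiperiodic_int_shift[of \<phi>] \<phi>(3) by blast
  \<comment> \<open>At a lifted vertex \<open>F\<close> acts as a shift by \<open>c - k\<close>
    turns, so the two functional equations of \<phi> combine into a linear equation for the
    value.\<close>
  have \<phi>_angle: "real m * \<phi> (angle k) = 2 * pi * of_int (k - c)" for k
  proof -
    have "- real (m - 1) * \<phi> (angle k) = \<phi> (angle k + 2 * pi * of_int (c - k))"
    proof -
      have "F (angle k) = angle k + 2 * pi * of_int (c - k)" using F(5)[of k] by (simp add: algebra_simps)
      then show ?thesis using \<phi>(4)[of "angle k"] by simp
    qed
    then show ?thesis unfolding shift using m_ge_3 by (simp add: of_nat_diff algebra_simps)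
  qed
  have F_angle: "F (angle k) = angle (k + int m * (c - k))" for k
    unfolding angle_periodic F(5) by (simp add: algebra_simps)
  \<comment> \<open>The claim covers all later times, so that two orbits can be compared at a common
    one; by \<open>F_angle\<close> an orbit never leaves the lifted vertices.\<close>
  have reach: "\<exists>n. \<forall>i\<ge>n. \<exists>k. (F ^^ i) x = angle k" if x: "cis x \<in> gaussian_rationals" for x
  proof -
    have cisF: "cis ((F ^^ i) x) = (B ^^ i) (cis x)" for i
      by (induction i) (simp_all add: F(2))
    obtain n where "(B ^^ n) (cis x) \<in> range vertex"
      using gaussian_reaches_vertex[OF cis_in_circle x] by blast
    then obtain k where "cis ((F ^^ n) x) = cis (angle k)" unfolding cisF cis_angle by blast
    then obtain j :: int where "(F ^^ n) x = angle (k + int m * j)"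
      unfolding cis_eq_iff_int angle_periodic by blast
    then have "\<exists>k. (F ^^ (n + i)) x = angle k" for i
    proof (induction i)
      case (Suc i)
      then show ?case using F_angle by auto
    qed auto
    then show ?thesis by (metis le_Suc_ex)
  qed
  have \<phi>_funpow: "\<phi> ((F ^^ i) x) = (- real (m - 1)) ^ i * \<phi> x" for i x
    by (induction i) (simp_all add: \<phi>(4))
  have F_inj: "(F ^^ i) x \<noteq> (F ^^ i) y" if "x \<noteq> y" for i x y
    using that by (induction i) (simp_all, metis F(3) linorder_neq_iff)
  have "strict_mono \<phi>"
  proof (rule strict_monoI)
    fix x y :: real assume "x < y"
    \<comment> \<open>Two distinct rational points between \<open>x\<close> and \<open>y\<close> end
      at different lifted vertices because \<open>F\<close> is injective. There \<phi> takes
      different values, so it separates \<open>u\<close> from \<open>v\<close>, and monotonicity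
      separates \<open>x\<close> from \<open>y\<close>.\<close>
    obtain u where u: "x < u" "u < y" "cis u \<in> gaussian_rationals" using gaussian_angles_dense[OF \<open>x < y\<close>] by blast
    obtain v where v: "u < v" "v < y" "cis v \<in> gaussian_rationals" using gaussian_angles_dense[OF u(2)] by blast
    obtain n1 where n1: "\<And>i. i \<ge> n1 \<Longrightarrow> \<exists>k. (F ^^ i) u = angle k" using reach[OF u(3)] by blast
    obtain n2 where n2: "\<And>i. i \<ge> n2 \<Longrightarrow> \<exists>k. (F ^^ i) v = angle k" using reach[OF v(3)] by blast
    define n where "n = max n1 n2"
    obtain k l where kl: "(F ^^ n) u = angle k" "(F ^^ n) v = angle l"
      using n1[of n] n2[of n] by (auto simp: n_def)
    then have "k \<noteq> l" using F_inj[of u v n] v(1) by auto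
    then have "real m * \<phi> (angle k) \<noteq> real m * \<phi> (angle l)" unfolding \<phi>_angle by simp
    then have "\<phi> u \<noteq> \<phi> v" using \<phi>_funpow[of n u] \<phi>_funpow[of n v] kl by auto
    moreover have "\<phi> x \<le> \<phi> u" "\<phi> u \<le> \<phi> v" "\<phi> v \<le> \<phi> y" using u v by (auto intro!: monoD[OF \<phi>(2)])
    ultimately show "\<phi> x < \<phi> y" by linarith
  qed
  then obtain \<Phi> \<Psi> where \<Phi>: "homeomorphism circle circle \<Phi> \<Psi>" "\<And>x. \<Phi> (cis x) = cis (\<phi> x)"
    using circle_homeomorphism_of_lift[OF \<phi>(1) _ \<phi>(3)] by blast
  have "\<Phi> (B z) = power_map m (\<Phi> z)" if z: "z \<in> circle" for z
  proof -
    obtain x where x: "z = cis x" using circle_cis[OF z] by blast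
    have "\<Phi> (B z) = cis (\<phi> (F x))" unfolding x F(2)[symmetric] by (rule \<Phi>(2))
    also have "\<dots> = power_map m (\<Phi> z)" unfolding x \<Phi>(2) \<phi>(4) power_map_eq by (simp add: cis_power_int)
    finally show ?thesis .
  qed
  then show ?thesis using \<Phi>(1) unfolding circle_conjugacy_def by blast
qed

section \<open>Properties of every conjugacy\<close>

lemma funpow_power_map: "w \<noteq> 0 \<Longrightarrow> (power_map m ^^ n) w = w powi ((- int (m - 1)) ^ n)"
  by (induction n) (simp_all add: power_map_eq power_int_mult[symmetric] mult.commute)

lemma exponent_neq:
  assumes "i \<noteq> j"
  shows "(- int (m - 1)) ^ i \<noteq> (- int (m - 1)) ^ j"
proof
  assume "(- int (m - 1)) ^ i = (- int (m - 1)) ^ j"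
  then have "\<bar>(- int (m - 1)) ^ i\<bar> = \<bar>(- int (m - 1)) ^ j\<bar>" by simp
  then have "int (m - 1) ^ i = int (m - 1) ^ j" by (simp add: power_abs)
  then show False using m_ge_3 assms power_inject_exp[of "int (m - 1)" i j] by simp
qed

lemma power_int_eq_1_iff:
  fixes w :: complex
  shows "w powi k = 1 \<longleftrightarrow> w ^ nat \<bar>k\<bar> = 1"
  by (cases "k \<ge> 0") (simp_all add: power_int_def power_inverse)

context
  fixes \<Phi> \<Phi>i :: "complex \<Rightarrow> complex"
  assumes homeo: "homeomorphism circle circle \<Phi> \<Phi>i"
    and conj: "\<And>z. z \<in> circle \<Longrightarrow> \<Phi> (B z) = power_map m (\<Phi> z)"
begin

private lemma maps_to: "z \<in> circle \<Longrightarrow> \<Phi> z \<in> circle"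
  using homeo by (auto simp: homeomorphism_def)

private lemma inj: "inj_on \<Phi> circle"
  using homeomorphism_apply1[OF homeo] by (rule inj_on_inverseI)

private lemma nonzero: "z \<in> circle \<Longrightarrow> \<Phi> z \<noteq> 0"
  using maps_to by fastforce

private lemma conj_funpow:
  assumes "z \<in> circle"
  shows "\<Phi> ((B ^^ n) z) = \<Phi> z powi ((- int (m - 1)) ^ n)"
proof -
  have "\<Phi> ((B ^^ n) z) = (power_map m ^^ n) (\<Phi> z)"
    by (induction n) (simp_all add: conj[OF funpow_in_circle[OF assms]])
  then show ?thesis using funpow_power_map nonzero assms by simp
qed

private lemma orbit_eq_iff:
  assumes "z \<in> circle"
  shows "(B ^^ i) z = (B ^^ j) z \<longleftrightarrow> \<Phi> z ^ nat \<bar>(- int (m - 1)) ^ i - (- int (m - 1)) ^ j\<bar> = 1"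
proof -
  have "(B ^^ i) z = (B ^^ j) z \<longleftrightarrow> \<Phi> ((B ^^ i) z) = \<Phi> ((B ^^ j) z)"
    using inj_on_eq_iff[OF inj funpow_in_circle[OF assms] funpow_in_circle[OF assms]] by simp
  also have "\<dots> \<longleftrightarrow> \<Phi> z powi ((- int (m - 1)) ^ i - (- int (m - 1)) ^ j) = 1"
    unfolding conj_funpow[OF assms] using nonzero[OF assms] by (simp add: power_int_diff)
  finally show ?thesis unfolding power_int_eq_1_iff .
qed

text \<open>A conjugacy embeds the fixed points of \<open>B ^^ p\<close> into the roots of unity of
  one positive exponent. This supplies the finiteness assumed in
  \<open>degree_le2_points_iff_preperiodic\<close>.\<close>

lemma finite_periodic:
  assumes "p > 0"
  shows "finite {y \<in> circle. (B ^^ p) y = y}"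
proof (rule finite_imageD)
  let ?N = "nat \<bar>(- int (m - 1)) ^ p - (- int (m - 1)) ^ 0\<bar>"
  have "?N > 0" using exponent_neq[of p 0] assms by simp
  then have "finite {w::complex. w ^ ?N = 1}" by (intro finite_roots_unity) auto
  moreover have "\<Phi> ` {y \<in> circle. (B ^^ p) y = y} \<subseteq> {w. w ^ ?N = 1}"
    using orbit_eq_iff[of _ p 0] by auto
  ultimately show "finite (\<Phi> ` {y \<in> circle. (B ^^ p) y = y})" by (rule rev_finite_subset)
  show "inj_on \<Phi> {y \<in> circle. (B ^^ p) y = y}" by (rule inj_on_subset[OF inj]) auto
qed

lemma preperiodic_iff_torsion:
  assumes z: "z \<in> circle"
  shows "(\<exists>i j. i < j \<and> (B ^^ i) z = (B ^^ j) z) \<longleftrightarrow> \<Phi> z \<in> circle_tor"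
proof
  assume "\<exists>i j. i < j \<and> (B ^^ i) z = (B ^^ j) z"
  then obtain i j where ij: "i < j" "\<Phi> z ^ nat \<bar>(- int (m - 1)) ^ i - (- int (m - 1)) ^ j\<bar> = 1"
    using orbit_eq_iff[OF z] by blast
  moreover have "nat \<bar>(- int (m - 1)) ^ i - (- int (m - 1)) ^ j\<bar> > 0" using exponent_neq[of i j] ij(1) by simp
  ultimately show "\<Phi> z \<in> circle_tor" unfolding circle_tor_eq by blast
next
  assume "\<Phi> z \<in> circle_tor"
  then obtain N where N: "N > 0" "\<Phi> z ^ N = 1" unfolding circle_tor_eq by blast
  \<comment> \<open>\<open>T\<close> maps the \<open>N\<close>-th roots of unity into themselves, so
    the orbit of a torsion point is finite and must repeat.\<close>
  have "(\<lambda>i. \<Phi> ((B ^^ i) z)) ` UNIV \<subseteq> {w. w ^ N = 1}"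
  proof
    fix w assume "w \<in> (\<lambda>i. \<Phi> ((B ^^ i) z)) ` UNIV"
    then obtain i where "w = \<Phi> z powi ((- int (m - 1)) ^ i)" using conj_funpow[OF z] by auto
    then have "w ^ N = (\<Phi> z powi int N) powi ((- int (m - 1)) ^ i)"
      by (simp only: power_int_of_nat[symmetric] power_int_mult[symmetric] mult.commute)
    then show "w \<in> {w. w ^ N = 1}" using N by simp
  qed
  moreover have "finite {w::complex. w ^ N = 1}" using N(1) by (intro finite_roots_unity) auto
  ultimately have "finite ((\<lambda>i. \<Phi> ((B ^^ i) z)) ` UNIV)" by (rule finite_subset)
  then have "\<not> inj (\<lambda>i. \<Phi> ((B ^^ i) z))" using finite_imageD infinite_UNIV_nat by blast
  then obtain i j where "i < j" "\<Phi> ((B ^^ i) z) = \<Phi> ((B ^^ j) z)"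
    unfolding inj_def by (metis linorder_neqE_nat)
  then show "\<exists>i j. i < j \<and> (B ^^ i) z = (B ^^ j) z"
    using inj_onD[OF inj] funpow_in_circle[OF z] by blast
qed

text \<open>The vertices are the fixed points of \<open>B\<close>, so being at one at time
  \<open>n\<close> means that times \<open>n\<close> and \<open>n + 1\<close> agree. With
  \<open>x = - (m - 1)\<close> the resulting exponent is
  \<open>x ^ (n + 1) - x ^ n = - m * x ^ n\<close>.\<close>

lemma gaussian_iff_torsion:
  assumes z: "z \<in> circle"
  shows "z \<in> gaussian_rationals \<longleftrightarrow> (\<exists>n. \<Phi> z ^ (m * (m - 1) ^ n) = 1)"
proof -
  have "(B ^^ n) z \<in> range vertex \<longleftrightarrow> \<Phi> z ^ (m * (m - 1) ^ n) = 1" for n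
  proof -
    have "(B ^^ n) z \<in> range vertex \<longleftrightarrow> (B ^^ Suc n) z = (B ^^ n) z"
      using partition_map_fixed_iff[OF funpow_in_circle[OF z]] by simp
    also have "\<dots> \<longleftrightarrow> \<Phi> z ^ nat \<bar>(- int (m - 1)) ^ Suc n - (- int (m - 1)) ^ n\<bar> = 1"
      by (rule orbit_eq_iff[OF z])
    also have "(- int (m - 1)) ^ Suc n - (- int (m - 1)) ^ n = - int m * (- int (m - 1)) ^ n"
      using m_ge_3 by (simp add: of_nat_diff algebra_simps)
    also have "nat \<bar>\<dots>\<bar> = m * (m - 1) ^ n"
      by (simp add: abs_mult power_abs nat_mult_distrib nat_power_eq)
    finally show ?thesis .
  qed
  then show ?thesis using gaussian_iff_reaches_vertex[OF z] by simp
qed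

lemma conjugacy_bij_torsion: "bij_betw \<Phi> degree_le2_points circle_tor"
proof -
  have sub: "degree_le2_points \<subseteq> circle" by (auto simp: degree_le2_points_def)
  have iff: "z \<in> degree_le2_points \<longleftrightarrow> \<Phi> z \<in> circle_tor" if "z \<in> circle" for z
    using degree_le2_points_iff_preperiodic[OF that finite_periodic] preperiodic_iff_torsion[OF that] by blast
  have "\<Phi> ` degree_le2_points = circle_tor"
  proof (intro equalityI subsetI)
    fix w assume w: "w \<in> circle_tor"
    then have "w \<in> circle" by (simp add: circle_tor_def)
    then obtain z where "z \<in> circle" "w = \<Phi> z" using homeo unfolding homeomorphism_def by blast
    then show "w \<in> \<Phi> ` degree_le2_points" using iff w by blast
  qed (use iff sub in blast)
  then show ?thesis unfolding bij_betw_def using inj_on_subset[OF inj sub] by blast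
qed

lemma conjugacy_image_gaussian:
  "\<Phi> ` (circle \<inter> gaussian_rationals) = {w. \<exists>n. w ^ (m * (m - 1) ^ n) = 1}"
proof (intro equalityI subsetI)
  fix w :: complex assume "w \<in> {w. \<exists>n. w ^ (m * (m - 1) ^ n) = 1}"
  then obtain n where n: "w ^ (m * (m - 1) ^ n) = 1" by blast
  have "w \<in> circle" using power_eq_1_iff[OF n] m_ge_3 by auto
  then obtain z where "z \<in> circle" "w = \<Phi> z" using homeo unfolding homeomorphism_def by blast
  then show "w \<in> \<Phi> ` (circle \<inter> gaussian_rationals)" using gaussian_iff_torsion n by blast
qed (use gaussian_iff_torsion in blast)

text \<open>\<open>\<Psi>\<close> after the inverse of \<open>\<Phi>\<close> is a homeomorphism of
  the circle that commutes with \<open>T\<close>, and \<open>commuting_with_power_map\<close>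
  determines all of these.\<close>

lemma conjugacy_unique:
  fixes \<Psi> \<Psi>i :: "complex \<Rightarrow> complex"
  assumes homeo': "homeomorphism circle circle \<Psi> \<Psi>i"
    and conj': "\<And>z. z \<in> circle \<Longrightarrow> \<Psi> (B z) = power_map m (\<Psi> z)"
  shows "\<exists>\<xi>. \<xi> ^ m = 1 \<and> (\<exists>e\<in>{-1,1::int}. \<forall>z\<in>circle. \<Psi> z = \<xi> * \<Phi> z powi e)"
proof -
  note H = homeo[unfolded homeomorphism_def] and H' = homeo'[unfolded homeomorphism_def]
  have "\<exists>\<xi>. \<xi> ^ m = 1 \<and> (\<exists>e\<in>{-1,1::int}. \<forall>z\<in>circle. \<Psi> (\<Phi>i z) = \<xi> * z powi e)"
  proof (rule commuting_with_power_map)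
    show "continuous_on circle (\<lambda>z. \<Psi> (\<Phi>i z))"
      using H H' by (intro continuous_on_compose2[of circle \<Psi> circle \<Phi>i]) auto
    show "(\<lambda>z. \<Psi> (\<Phi>i z)) \<in> circle \<rightarrow> circle" using H H' by blast
    show "inj_on (\<lambda>z. \<Psi> (\<Phi>i z)) circle"
      by (rule inj_on_inverseI[of _ "\<lambda>w. \<Phi> (\<Psi>i w)"]) (use H H' in \<open>metis imageI\<close>)
    show "m \<ge> 3" by (rule m_ge_3)
    fix w :: complex assume w: "w \<in> circle"
    define z where "z = \<Phi>i w"
    have z: "z \<in> circle" "w = \<Phi> z" using H w unfolding z_def by (blast, metis)
    have "\<Phi>i (power_map m w) = B z"
      unfolding z(2) conj[OF z(1), symmetric] using H partition_map_in_circle[OF z(1)] by blast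
    then show "\<Psi> (\<Phi>i (w powi - int (m - 1))) = \<Psi> (\<Phi>i w) powi - int (m - 1)"
      using conj'[OF z(1)] by (simp only: power_map_eq z_def)
  qed
  then obtain \<xi> e where "\<xi> ^ m = 1" "e \<in> {-1,1::int}" "\<And>z. z \<in> circle \<Longrightarrow> \<Psi> (\<Phi>i z) = \<xi> * z powi e" by blast
  moreover have "\<Phi>i (\<Phi> z) = z" if "z \<in> circle" for z using H that by blast
  ultimately show ?thesis using maps_to by metis
qed

text \<open>Power maps commute with each other and \<open>T\<close> fixes \<xi>, whence the
  functional equation. Raising to the power \<open>e\<close> is its own inverse, whence
  bijectivity.\<close>

lemma conjugacy_dihedral:
  assumes \<xi>: "\<xi> ^ m = 1" and e: "e \<in> {-1,1::int}" and \<Psi>: "\<And>z. z \<in> circle \<Longrightarrow> \<Psi> z = \<xi> * \<Phi> z powi e"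
  shows "circle_conjugacy B (power_map m) \<Psi>"
proof -
  note H = homeo[unfolded homeomorphism_def]
  have \<xi>c: "\<xi> \<in> circle" using power_eq_1_iff[OF \<xi>] m_ge_3 by auto
  then have \<xi>0: "\<xi> \<noteq> 0" by auto
  have ee: "(w powi e) powi e = w" for w :: complex using e by (auto simp: power_int_minus)
  have powc: "w powi e \<in> circle" if "w \<in> circle" for w :: complex using that by (simp add: norm_power_int)
  have cont: "continuous_on circle \<Psi>"
  proof (rule continuous_on_eq)
    show "continuous_on circle (\<lambda>z. \<xi> * \<Phi> z powi e)"
      using H nonzero by (intro continuous_intros) auto
  qed (simp add: \<Psi>)
  have surj: "\<Psi> ` circle = circle"
  proof (intro equalityI subsetI)
    fix w assume w: "w \<in> \<Psi> ` circle"
    then show "w \<in> circle" using \<Psi> powc maps_to \<xi>c by (auto simp: norm_mult)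
  next
    fix w :: complex assume w: "w \<in> circle"
    then have "(w / \<xi>) powi e \<in> circle" using \<xi>c by (intro powc) (simp add: norm_divide)
    then obtain z where z: "z \<in> circle" "(w / \<xi>) powi e = \<Phi> z" using H by blast
    then have "\<Psi> z = w" using \<Psi>[OF z(1)] \<xi>0 by (simp add: ee flip: z(2))
    then show "w \<in> \<Psi> ` circle" using z(1) by blast
  qed
  have "inj_on \<Psi> circle"
  proof (rule inj_onI)
    fix x y assume xy: "x \<in> circle" "y \<in> circle" "\<Psi> x = \<Psi> y"
    then have "\<Phi> x powi e = \<Phi> y powi e" using \<Psi> \<xi>0 by simp
    then have "\<Phi> x = \<Phi> y" using ee by metis
    then show "x = y" using inj_onD[OF inj _ xy(1,2)] by blast
  qed
  then obtain \<Psi>i where "homeomorphism circle circle \<Psi> \<Psi>i"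
    using homeomorphism_compact[OF _ cont surj] by auto
  moreover have "\<Psi> (B z) = power_map m (\<Psi> z)" if z: "z \<in> circle" for z
  proof -
    have "\<Psi> (B z) = \<xi> * (\<Phi> z powi - int (m - 1)) powi e"
      using \<Psi>[OF partition_map_in_circle[OF z]] conj[OF z] by (simp add: power_map_eq)
    also have "(\<Phi> z powi - int (m - 1)) powi e = (\<Phi> z powi e) powi - int (m - 1)"
      by (simp only: power_int_mult[symmetric] mult.commute)
    also have "\<xi> * \<dots> = \<xi> powi - int (m - 1) * \<dots>"
      using root_of_unity_powi[OF \<xi>] m_ge_3 by simp
    also have "\<dots> = power_map m (\<Psi> z)" unfolding power_map_eq \<Psi>[OF z] power_int_mult_distrib ..
    finally show ?thesis .
  qed
  ultimately show ?thesis unfolding circle_conjugacy_def by blast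
qed

end

end

theorem theorem9p2:
  fixes m :: nat and t :: "nat \<Rightarrow> int^3" and \<zeta> :: complex
  assumes "unimodular_partition m t"
    and "\<zeta> = exp (2 * of_real pi * \<i> / of_nat m)"
  shows "(\<exists>\<Phi>. circle_conjugacy (partition_map m t) (power_map m) \<Phi>) \<and>
    (\<forall>\<Phi>. circle_conjugacy (partition_map m t) (power_map m) \<Phi> \<longrightarrow>
       (\<forall>\<Psi>. circle_conjugacy (partition_map m t) (power_map m) \<Psi> \<longleftrightarrow>
          (\<exists>h<m. \<exists>e\<in>{-1, 1::int}. \<forall>z\<in>circle. \<Psi> z = \<zeta> ^ h * (\<Phi> z) powi e)) \<and>
       bij_betw \<Phi> degree_le2_points circle_tor \<and>
       internal_direct_sum circle_group
         (insert None (Some ` {p. prime p \<and> p dvd m - 1})) (torsion_summand \<zeta>)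
         (\<Phi> ` (circle \<inter> gaussian_rationals)))"
proof -
  interpret unimodular_circle m t by unfold_locales (rule assms(1))
  have roots: "{\<xi>::complex. \<xi> ^ m = 1} = (\<lambda>h. \<zeta> ^ h) ` {..<m}"
    using roots_of_unity_generated[OF _ assms(2)] m_ge_3 by simp
  show ?thesis
  proof (intro conjI allI impI)
    show "\<exists>\<Phi>. circle_conjugacy (partition_map m t) (power_map m) \<Phi>" by (rule conjugacy_exists)
  next
    fix \<Phi> \<Psi> assume "circle_conjugacy (partition_map m t) (power_map m) \<Phi>"
    then obtain \<Phi>i where \<Phi>: "homeomorphism circle circle \<Phi> \<Phi>i"
      "\<And>z. z \<in> circle \<Longrightarrow> \<Phi> (partition_map m t z) = power_map m (\<Phi> z)"
      unfolding circle_conjugacy_def by blast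
    show "circle_conjugacy (partition_map m t) (power_map m) \<Psi> \<longleftrightarrow>
      (\<exists>h<m. \<exists>e\<in>{-1, 1::int}. \<forall>z\<in>circle. \<Psi> z = \<zeta> ^ h * (\<Phi> z) powi e)"
    proof
      assume "circle_conjugacy (partition_map m t) (power_map m) \<Psi>"
      then obtain \<Psi>i where "homeomorphism circle circle \<Psi> \<Psi>i"
        "\<And>z. z \<in> circle \<Longrightarrow> \<Psi> (partition_map m t z) = power_map m (\<Psi> z)"
        unfolding circle_conjugacy_def by blast
      then obtain \<xi> e where \<xi>: "\<xi> ^ m = 1" "e \<in> {-1, 1::int}" "\<forall>z\<in>circle. \<Psi> z = \<xi> * \<Phi> z powi e"
        using conjugacy_unique[OF \<Phi>, of \<Psi>] by blast
      moreover obtain h where "h < m" "\<xi> = \<zeta> ^ h" using roots \<xi>(1) by blast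
      ultimately show "\<exists>h<m. \<exists>e\<in>{-1, 1::int}. \<forall>z\<in>circle. \<Psi> z = \<zeta> ^ h * (\<Phi> z) powi e" by blast
    next
      assume "\<exists>h<m. \<exists>e\<in>{-1, 1::int}. \<forall>z\<in>circle. \<Psi> z = \<zeta> ^ h * (\<Phi> z) powi e"
      then obtain h e where h: "h < m" "e \<in> {-1, 1::int}" "\<And>z. z \<in> circle \<Longrightarrow> \<Psi> z = \<zeta> ^ h * \<Phi> z powi e" by blast
      have "(\<zeta> ^ h) ^ m = 1" using roots h(1) by blast
      then show "circle_conjugacy (partition_map m t) (power_map m) \<Psi>"
        using conjugacy_dihedral[OF \<Phi> _ h(2,3)] by blast
    qed
  next
    fix \<Phi> assume "circle_conjugacy (partition_map m t) (power_map m) \<Phi>"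
    then obtain \<Phi>i where \<Phi>: "homeomorphism circle circle \<Phi> \<Phi>i"
      "\<And>z. z \<in> circle \<Longrightarrow> \<Phi> (partition_map m t z) = power_map m (\<Phi> z)"
      unfolding circle_conjugacy_def by blast
    show "bij_betw \<Phi> degree_le2_points circle_tor" by (rule conjugacy_bij_torsion[OF \<Phi>])
    have image: "\<Phi> ` (circle \<inter> gaussian_rationals) = {w. \<exists>n. w ^ (m * (m - 1) ^ n) = 1}"
      by (rule conjugacy_image_gaussian[OF \<Phi>])
    show "internal_direct_sum circle_group
         (insert None (Some ` {p. prime p \<and> p dvd m - 1})) (torsion_summand \<zeta>)
         (\<Phi> ` (circle \<inter> gaussian_rationals))"
      unfolding image
      by (rule internal_direct_sum_torsion_summand[OF m_ge_3 assms(2)])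
  qed
qed

end
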